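(* Let $\varphi$ be a PEB-spline of order $m\ge2$ and let $X\subseteq\mathbb{R}$ be a separated set. Assume that the multiplicity function is constant, $\mu_X(x)=s<m-1$ for all $x\in X$. If the maximum gap of $X$ satisfies $\mathfrak{mg}(X)<s+1$, then $(X,\mu_X)$ is a sampling set for $V^p(\varphi)$, $1\le p\le\infty$. In particular, if $\mu_X\equiv0$ and $\mathfrak{mg}(X)<1$, then $X$ is a sampling set for $V^p(\varphi)$, $1\le p\le\infty$.
   Context: PEB-splines. Let $m\in\mathbb{N}=\{1,2,\dots\}$ and $T_yf(x)=f(x-y)$. For $1\le s\le m$ let $\gamma_s\in\mathbb{R}$, let $r_s\in C^{m-s}(\mathbb{R})$ be strictly positive and $1$-periodic, and put $w_s(x)=e^{\gamma_s x}r_s(x)$. Let $u_1=w_1$ and $u_s(x)=w_1(x)\int_0^x w_2(x_2)\int_0^{x_2}w_3(x_3)\cdots\int_0^{x_{s-1}}w_s(x_s)\,dx_s\cdots dx_2$ for $2\le s\le m$, and $\mathcal{U}_m=\mathrm{span}_{\mathbb{C}}(u_1,\dots,u_m)$. The periodic exponential B-spline (PEB-spline) of order $m$ for these weights is the function $\varphi:\mathbb{R}\to\mathbb{R}$, unique up to a positive scalar factor, with $\varphi\in C^{m-2}(\mathbb{R})$ (no condition if $m=1$), $\mathrm{supp}\,\varphi=[0,m]$, $\varphi>0$ on $(0,m)$, and whose restriction to each interval $(\ell,\ell+1)$, $\ell\in\mathbb{Z}$, is the restriction of an element of $\mathcal{U}_m$. Shift-invariant space: $V^p(\varphi)=\{\sum_{\ell\in\mathbb{Z}}c_\ell\varphi(\cdot-\ell):(c_\ell)\in\ell^p(\mathbb{Z})\}\subseteq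 L^p(\mathbb{R})$. Sampling: $X$ is separated if $\inf_{x\ne y\in X}|x-y|>0$; it is labelled as a bi-infinite strictly increasing sequence $X=(x_j)_{j\in\mathbb{Z}}$. Multiplicity functions take values in the nonnegative integers. $(X,\mu_X)$ is a sampling set for $V^p(\varphi)$ if there are constants $A_p,B_p>0$ with $A_p\|f\|_p^p\le\sum_{x\in X}\sum_{s=0}^{\mu_X(x)}|f^{(s)}(x)|^p\le B_p\|f\|_p^p$ for all $f\in V^p(\varphi)$ (with suprema in place of sums if $p=\infty$); if $\mu_X\equiv0$ one says that $X$ is a sampling set. Maximum gap: $\mathfrak{mg}(X)=\sup_{j\in\mathbb{Z}}(x_{j+1}-x_j)$. *)

theory Defs
  imports "HOL-Analysis.Analysis" "HOL-Probability.Essential_Supremum"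
begin

definition nth_derivative :: "nat \<Rightarrow> (real \<Rightarrow> 'a::real_normed_vector) \<Rightarrow> real \<Rightarrow> 'a" where
  "nth_derivative n f = ((\<lambda>g x. vector_derivative g (at x)) ^^ n) f"

definition C_class :: "nat \<Rightarrow> (real \<Rightarrow> 'a::real_normed_vector) \<Rightarrow> bool" where
  "C_class k f \<longleftrightarrow>
     (\<forall>i<k. nth_derivative i f differentiable_on UNIV) \<and> continuous_on UNIV (nth_derivative k f)"

definition PEB_factors :: "nat \<Rightarrow> (nat \<Rightarrow> real \<Rightarrow> real) \<Rightarrow> bool" where
  "PEB_factors m r \<longleftrightarrow>
     (\<forall>s\<in>{1..m}. C_class (m - s) (r s) \<and> (\<forall>x. 0 < r s x) \<and> (\<forall>x. r s (x + 1) = r s x))"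

definition PEB_weight :: "(nat \<Rightarrow> real) \<Rightarrow> (nat \<Rightarrow> real \<Rightarrow> real) \<Rightarrow> nat \<Rightarrow> real \<Rightarrow> real" where
  "PEB_weight \<gamma> r s x = exp (\<gamma> s * x) * r s x"

text \<open>\<open>nested_integral w n i\<close> involves the weights \<open>w\<^sub>i, \<dots>, w\<^bsub>i+n\<^esub>\<close>. The interval
  integral is oriented, so negative \<open>x\<close> are covered with the usual sign convention.\<close>

primrec nested_integral :: "(nat \<Rightarrow> real \<Rightarrow> real) \<Rightarrow> nat \<Rightarrow> nat \<Rightarrow> real \<Rightarrow> real" where
  "nested_integral w 0 i x = w i x"
| "nested_integral w (Suc n) i x = w i x * (LBINT y=0..x. nested_integral w n (Suc i) y)"

definition ECT_basis :: "(nat \<Rightarrow> real \<Rightarrow> real) \<Rightarrow> nat \<Rightarrow> real \<Rightarrow> real" where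
  "ECT_basis w s = nested_integral w (s - 1) 1"

definition ECT_space :: "(nat \<Rightarrow> real \<Rightarrow> real) \<Rightarrow> nat \<Rightarrow> (real \<Rightarrow> complex) set" where
  "ECT_space w m = {\<lambda>x. \<Sum>s=1..m. a s * complex_of_real (ECT_basis w s x) | a :: nat \<Rightarrow> complex. True}"

definition PEB_spline ::
  "nat \<Rightarrow> (nat \<Rightarrow> real) \<Rightarrow> (nat \<Rightarrow> real \<Rightarrow> real) \<Rightarrow> (real \<Rightarrow> real) \<Rightarrow> bool" where
  "PEB_spline m \<gamma> r \<phi> \<longleftrightarrow>
     1 \<le> m \<and> PEB_factors m r \<and>
     (2 \<le> m \<longrightarrow> C_class (m - 2) \<phi>) \<and>
     closure {x. \<phi> x \<noteq> 0} = {0..real m} \<and>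
     (\<forall>x\<in>{0<..<real m}. 0 < \<phi> x) \<and>
     (\<forall>l::int. \<exists>g\<in>ECT_space (PEB_weight \<gamma> r) m.
        \<forall>x\<in>{real_of_int l<..<real_of_int l + 1}. complex_of_real (\<phi> x) = g x)"

definition ell_p :: "ennreal \<Rightarrow> (int \<Rightarrow> complex) set" where
  "ell_p p = {c. if p = \<infinity> then bounded (range c)
                else (\<lambda>l. cmod (c l) powr enn2real p) summable_on UNIV}"

text \<open>For compactly supported \<open>\<phi>\<close> the series has, at every point, only finitely many nonzero
  terms. Elements of the space are thus genuine functions, not classes modulo null sets.\<close>

definition shift_invariant_space :: "ennreal \<Rightarrow> (real \<Rightarrow> real) \<Rightarrow> (real \<Rightarrow> complex) set" where
  "shift_invariant_space p \<phi> =
     {\<lambda>x. \<Sum>\<^sub>\<infinity>l. c l * complex_of_real (\<phi> (x - real_of_int l)) | c. c \<in> ell_p p}"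

text \<open>Here \<open>p\<close> is finite and \<open>Lp_norm_power p f\<close> is the \<open>p\<close>-th power of the norm.\<close>

definition Lp_norm_power :: "ennreal \<Rightarrow> (real \<Rightarrow> complex) \<Rightarrow> ennreal" where
  "Lp_norm_power p f = (\<integral>\<^sup>+x. ennreal (cmod (f x) powr enn2real p) \<partial>lborel)"

definition Linf_norm :: "(real \<Rightarrow> complex) \<Rightarrow> ereal" where
  "Linf_norm f = esssup lborel (\<lambda>x. ereal (cmod (f x)))"

definition sampling_sum ::
  "ennreal \<Rightarrow> real set \<Rightarrow> (real \<Rightarrow> nat) \<Rightarrow> (real \<Rightarrow> complex) \<Rightarrow> ennreal" where
  "sampling_sum p X \<mu> f =
     (\<Sum>\<^sub>\<infinity>x\<in>X. \<Sum>s=0..\<mu> x. ennreal (cmod (nth_derivative s f x) powr enn2real p))"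

definition sampling_sup ::
  "real set \<Rightarrow> (real \<Rightarrow> nat) \<Rightarrow> (real \<Rightarrow> complex) \<Rightarrow> ereal" where
  "sampling_sup X \<mu> f = (SUP x\<in>X. SUP s\<in>{0..\<mu> x}. ereal (cmod (nth_derivative s f x)))"

definition sampling_set_mult ::
  "ennreal \<Rightarrow> (real \<Rightarrow> real) \<Rightarrow> real set \<Rightarrow> (real \<Rightarrow> nat) \<Rightarrow> bool" where
  "sampling_set_mult p \<phi> X \<mu> \<longleftrightarrow>
     (\<exists>A B::real. 0 < A \<and> 0 < B \<and>
       (\<forall>f\<in>shift_invariant_space p \<phi>.
          if p = \<infinity>
          then ereal A * Linf_norm f \<le> sampling_sup X \<mu> f \<and>
               sampling_sup X \<mu> f \<le> ereal B * Linf_norm f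
          else ennreal A * Lp_norm_power p f \<le> sampling_sum p X \<mu> f \<and>
               sampling_sum p X \<mu> f \<le> ennreal B * Lp_norm_power p f))"

definition sampling_set :: "ennreal \<Rightarrow> (real \<Rightarrow> real) \<Rightarrow> real set \<Rightarrow> bool" where
  "sampling_set p \<phi> X \<longleftrightarrow> sampling_set_mult p \<phi> X (\<lambda>_. 0)"

text \<open>The gap is a supremum in the extended reals, so unbounded gaps give \<open>\<infinity>\<close>.\<close>

definition max_gap :: "(int \<Rightarrow> real) \<Rightarrow> ereal" where
  "max_gap x = (SUP j. ereal (x (j + 1) - x j))"

end

theory Submission
  imports Defs
begin

text \<open>A function \<open>f = \<Sum>\<^sub>l c\<^sub>l \<phi>(\<cdot> - l)\<close> is a spline whose highest generalized derivative is, up to a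
  positive weight, constant on every cell \<open>(l, l + 1)\<close>. Rolle's theorem, applied to the iterated
  generalized derivatives, therefore bounds the number of zeros of \<open>f\<close> on a run of cells by the
  number of cells, unless \<open>f\<close> vanishes on a cell. Zeros of multiplicity \<open>s + 1\<close> at points with
  gaps below \<open>s + 1\<close> are too many, so \<open>f\<close> vanishes on cells arbitrarily far to the left and to the
  right, and then, by counting again, on every cell in between. Local linear independence of the
  shifts, itself a consequence of the zero count, gives \<open>c = 0\<close>. No growth condition on \<open>c\<close> enters.

  For this reason uniqueness is inherited by the compact set of all sequences with \<open>c\<^sub>0 = 1\<close> and
  \<open>|c\<^sub>k| \<le> growth k\<close>, and all sampling sequences with the same separation and gap: finitely many
  samples control \<open>c\<^sub>0\<close>. After a shift, \<open>|c\<^sub>l|\<close> is thus bounded by nearby samples or by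
  \<open>|c\<^sub>l\<^sub>+\<^sub>k| / growth k\<close> for some \<open>k\<close>. As the weights \<open>1 / growth k\<close> have sum \<open>1 / 2\<close>, the second
  alternative is absorbed in every \<open>\<ell>\<^sup>p\<close>, which yields all exponents at once without a Wiener type
  lemma. The equivalence of \<open>\<parallel>f\<parallel>\<^sub>p\<close> and \<open>\<parallel>c\<parallel>\<^sub>p\<close> follows in the same way from local linear
  independence.\<close>

section \<open>Iterated derivatives\<close>

text \<open>Sign alternations are counted instead of zeros because the last generalized derivative
  jumps at the integers and may vanish on whole cells, whereas opposite signs always lie in
  different cells. The bookkeeping: if the function vanishes at both ends of an interval,
  differentiation gains one alternation; if it vanishes at one end, the number is kept; with no
  information at the ends, one is lost. Zeros of multiplicity \<open>s + 1\<close> thus give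
  \<open>s + 1\<close> alternations per gap. The remaining \<open>m - 2 - s\<close> differentiations
  find no zeros at the samples: they cost nothing if the run starts beside a flat cell, where
  everything up to order \<open>m - 2\<close> vanishes, and otherwise a fixed amount, which a long
  run outweighs because each gap has a surplus of at least \<open>s + 1 - g\<close>. Hence flat
  cells are found first and joined afterwards.

  It contains unbounded sequences, so the compactness step calls for uniqueness without a growth
  condition.\<close>

lemma nth_derivative_0 [simp]: "nth_derivative 0 f = f"
  by (simp add: nth_derivative_def)

lemma nth_derivative_Suc:
  "nth_derivative (Suc n) f = (\<lambda>x. vector_derivative (nth_derivative n f) (at x))"
  by (simp add: nth_derivative_def)

lemma nth_derivative_Suc_shift:
  "nth_derivative (Suc n) f = nth_derivative n (\<lambda>x. vector_derivative f (at x))"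
  unfolding nth_derivative_def by (subst funpow_Suc_right) simp

lemma vector_derivative_at_cong:
  assumes "open S" "x \<in> S" "\<And>y. y \<in> S \<Longrightarrow> f y = g y"
  shows "vector_derivative f (at x) = vector_derivative g (at x)"
  by (rule vector_derivative_cong_eq) (use assms in \<open>auto simp: eventually_nhds\<close>)

lemma nth_derivative_cong:
  assumes "open S" "\<And>y. y \<in> S \<Longrightarrow> f y = g y" "x \<in> S"
  shows "nth_derivative n f x = nth_derivative n g x"
  using assms(3)
proof (induction n arbitrary: x)
  case (Suc n)
  then show ?case
    unfolding nth_derivative_Suc by (intro vector_derivative_at_cong[OF assms(1)]) auto
qed (use assms in auto)

lemma nth_derivative_zero [simp]: "nth_derivative n (\<lambda>x. 0) = (\<lambda>x. 0)"
  by (induction n) (auto simp: nth_derivative_Suc)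

lemma has_vector_derivative_shift:
  assumes "(f has_vector_derivative d) (at (x - a))"
  shows "((\<lambda>x. f (x - a)) has_vector_derivative d) (at (x::real))"
proof -
  have "((f \<circ> (\<lambda>x. x - a)) has_vector_derivative (1 *\<^sub>R d)) (at x)"
    by (rule vector_diff_chain_at) (auto intro!: derivative_eq_intros assms)
  then show ?thesis by (simp add: o_def)
qed

text \<open>\<open>vector_derivative\<close> is a choice from the predicate
  \<open>has_vector_derivative\<close>, so equivalence of the predicates for every \<open>d\<close>
  gives equality even where \<open>f\<close> is not differentiable.\<close>

lemma vector_derivative_shift:
  fixes f :: "real \<Rightarrow> 'a::real_normed_vector"
  shows "vector_derivative (\<lambda>x. f (x - a)) (at x) = vector_derivative f (at (x - a))"
proof -
  have "((\<lambda>x. f (x - a)) has_vector_derivative d) (at x) \<longleftrightarrow>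
      (f has_vector_derivative d) (at (x - a))" for d
    using has_vector_derivative_shift[of f d x a]
      has_vector_derivative_shift[of "\<lambda>x. f (x - a)" d "x - a" "- a"] by auto
  then show ?thesis by (simp add: vector_derivative_def)
qed

lemma nth_derivative_shift:
  "nth_derivative n (\<lambda>x. f (x - a)) = (\<lambda>x. nth_derivative n f (x - a))"
  by (induction n) (auto simp: nth_derivative_Suc vector_derivative_shift)

lemma C_class_0: "C_class 0 f \<longleftrightarrow> continuous_on UNIV f"
  by (simp add: C_class_def)

lemma C_class_Suc_vd:
  "C_class (Suc k) f \<longleftrightarrow>
    f differentiable_on UNIV \<and> C_class k (\<lambda>x. vector_derivative f (at x))"
proof -
  have "(\<forall>i<Suc k. nth_derivative i f differentiable_on UNIV) \<longleftrightarrow>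
      f differentiable_on UNIV \<and> (\<forall>i<k. nth_derivative (Suc i) f differentiable_on UNIV)"
    by (simp only: All_less_Suc2 nth_derivative_0)
  then show ?thesis
    unfolding C_class_def nth_derivative_Suc_shift by blast
qed

text \<open>With an arbitrary derivative \<open>f'\<close> in place of an iterated
  \<open>vector_derivative\<close>, the closure properties below become inductions on
  \<open>k\<close> over all functions at once.\<close>

lemma C_class_Suc:
  "C_class (Suc k) f \<longleftrightarrow> (\<exists>f'. (\<forall>x. (f has_vector_derivative f' x) (at x)) \<and> C_class k f')"
proof
  assume "C_class (Suc k) f"
  then show "\<exists>f'. (\<forall>x. (f has_vector_derivative f' x) (at x)) \<and> C_class k f'"
    unfolding C_class_Suc_vd
    by (auto simp: differentiable_on_def vector_derivative_works intro!: exI[of _ "\<lambda>x. vector_derivative f (at x)"])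
next
  assume "\<exists>f'. (\<forall>x. (f has_vector_derivative f' x) (at x)) \<and> C_class k f'"
  then obtain f' where f': "\<And>x. (f has_vector_derivative f' x) (at x)" "C_class k f'" by blast
  then have "(\<lambda>x. vector_derivative f (at x)) = f'"
    by (auto intro: vector_derivative_at)
  then show "C_class (Suc k) f"
    unfolding C_class_Suc_vd differentiable_on_def
    using f' by (auto intro: differentiableI_vector)
qed

lemma C_class_SucD:
  assumes "C_class (Suc k) f"
  shows "(f has_vector_derivative vector_derivative f (at x)) (at x)"
    and "C_class k (\<lambda>x. vector_derivative f (at x))"
  using assms unfolding C_class_Suc_vd
  by (auto simp: differentiable_on_def vector_derivative_works)

lemma C_class_imp_continuous: "C_class k f \<Longrightarrow> continuous_on UNIV f"
  by (cases k) (auto simp: C_class_0 C_class_Suc_vd intro: differentiable_imp_continuous_on)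

lemma C_class_pred: "C_class (Suc k) f \<Longrightarrow> C_class k f"
proof (induction k arbitrary: f)
  case 0
  then show ?case using C_class_imp_continuous C_class_0 by blast
next
  case (Suc k)
  then show ?case by (subst C_class_Suc, subst (asm) C_class_Suc) blast
qed

lemma C_class_mono: "C_class k f \<Longrightarrow> j \<le> k \<Longrightarrow> C_class j f"
  by (induction k) (auto simp: le_Suc_eq dest: C_class_pred)

lemma C_class_nth_derivative_continuous:
  "C_class k f \<Longrightarrow> i \<le> k \<Longrightarrow> continuous_on UNIV (nth_derivative i f)"
  using C_class_mono[of k f i] by (auto simp: C_class_def)

lemma C_class_nth_derivative_has_derivative:
  "C_class k f \<Longrightarrow> i < k \<Longrightarrow>
    (nth_derivative i f has_vector_derivative nth_derivative (Suc i) f x) (at x)"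
  by (auto simp: C_class_def differentiable_on_def vector_derivative_works nth_derivative_Suc)

lemma C_class_const: "C_class k (\<lambda>x. c)"
proof (induction k arbitrary: c)
  case (Suc k)
  then show ?case
    unfolding C_class_Suc by (intro exI[of _ "\<lambda>_. 0"]) (auto intro!: derivative_eq_intros)
qed (auto simp: C_class_0)

lemma C_class_add: "C_class k f \<Longrightarrow> C_class k g \<Longrightarrow> C_class k (\<lambda>x. f x + g x)"
proof (induction k arbitrary: f g)
  case (Suc k)
  from Suc.prems obtain f' g' where "\<And>x. (f has_vector_derivative f' x) (at x)" "C_class k f'"
    "\<And>x. (g has_vector_derivative g' x) (at x)" "C_class k g'"
    unfolding C_class_Suc by blast
  with Suc.IH show ?case
    unfolding C_class_Suc
    by (intro exI[of _ "\<lambda>x. f' x + g' x"]) (auto intro!: has_vector_derivative_add)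
qed (auto simp: C_class_0 intro!: continuous_intros)

lemma C_class_scaleR_left:
  fixes v :: "'a::real_normed_vector"
  shows "C_class k f \<Longrightarrow> C_class k (\<lambda>x. f x *\<^sub>R v)"
proof (induction k arbitrary: f)
  case (Suc k)
  from Suc.prems obtain f' where "\<And>x. (f has_vector_derivative f' x) (at x)" "C_class k f'"
    unfolding C_class_Suc by blast
  with Suc.IH show ?case
    unfolding C_class_Suc
    by (intro exI[of _ "\<lambda>x. f' x *\<^sub>R v"])
      (auto intro!: bounded_linear.has_vector_derivative[OF bounded_linear_scaleR_left])
qed (auto simp: C_class_0 intro!: continuous_intros)

lemma C_class_sum:
  "(\<And>i. i \<in> A \<Longrightarrow> C_class k (f i)) \<Longrightarrow> C_class k (\<lambda>x. \<Sum>i\<in>A. f i x)"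
  by (induction A rule: infinite_finite_induct) (auto intro: C_class_const C_class_add)

lemma C_class_mult:
  fixes f g :: "real \<Rightarrow> real"
  shows "C_class k f \<Longrightarrow> C_class k g \<Longrightarrow> C_class k (\<lambda>x. f x * g x)"
proof (induction k arbitrary: f g)
  case (Suc k)
  from Suc.prems obtain f' g' where *: "\<And>x. (f has_vector_derivative f' x) (at x)" "C_class k f'"
    "\<And>x. (g has_vector_derivative g' x) (at x)" "C_class k g'"
    unfolding C_class_Suc by blast
  have "C_class k (\<lambda>x. f x * g' x + f' x * g x)"
    using * Suc by (intro C_class_add Suc.IH) (auto dest: C_class_pred)
  with * show ?case
    unfolding C_class_Suc
    by (intro exI[of _ "\<lambda>x. f x * g' x + f' x * g x"]) (auto intro!: has_vector_derivative_mult)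
qed (auto simp: C_class_0 intro!: continuous_intros)

lemma C_class_inverse:
  fixes f :: "real \<Rightarrow> real"
  assumes "\<And>x. f x \<noteq> 0"
  shows "C_class k f \<Longrightarrow> C_class k (\<lambda>x. inverse (f x))"
proof (induction k)
  case (Suc k)
  from Suc.prems obtain f' where *: "\<And>x. (f has_vector_derivative f' x) (at x)" "C_class k f'"
    unfolding C_class_Suc by blast
  have "C_class k (\<lambda>x. inverse (f x) * ((-1) * (f' x * inverse (f x))))"
    using * Suc by (intro C_class_mult C_class_const) (auto dest: C_class_pred)
  moreover have "((\<lambda>x. inverse (f x)) has_vector_derivative
      inverse (f x) * ((-1) * (f' x * inverse (f x)))) (at x)" for x
    using *(1)[of x] assms[of x]
    by (auto simp flip: has_real_derivative_iff_has_vector_derivative intro!: derivative_eq_intros)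
  ultimately show ?case unfolding C_class_Suc by (intro exI conjI allI)
qed (auto simp: C_class_0 assms intro!: continuous_intros)

lemma C_class_exp: "C_class k (\<lambda>x. exp (c * x :: real))"
proof (induction k)
  case (Suc k)
  have "C_class k (\<lambda>x. exp (c * x) * c)" by (intro C_class_mult C_class_const Suc)
  moreover have "((\<lambda>x. exp (c * x)) has_vector_derivative exp (c * x) * c) (at x)" for x
    by (auto simp flip: has_real_derivative_iff_has_vector_derivative intro!: derivative_eq_intros)
  ultimately show ?case unfolding C_class_Suc by (intro exI conjI allI)
qed (auto simp: C_class_0 intro!: continuous_intros)

lemma C_class_shift: "C_class k f \<Longrightarrow> C_class k (\<lambda>x. f (x - a))"
proof (induction k arbitrary: f)
  case 0
  then show ?case unfolding C_class_0
    by (rule continuous_on_compose2) (auto intro!: continuous_on_diff continuous_on_id continuous_on_const)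
next
  case (Suc k)
  from Suc.prems obtain f' where "\<And>x. (f has_vector_derivative f' x) (at x)" "C_class k f'"
    unfolding C_class_Suc by blast
  with Suc.IH[of f'] show ?case
    unfolding C_class_Suc by (intro exI[of _ "\<lambda>x. f' (x - a)"] conjI allI has_vector_derivative_shift)
qed

text \<open>Meant for series that reduce to finite sums only on bounded windows, with a different
  sum for each window.\<close>

lemma C_class_local:
  assumes "\<And>x. \<exists>S g. open S \<and> x \<in> S \<and> C_class k g \<and> (\<forall>y\<in>S. f y = g y)"
  shows "C_class k f"
proof -
  have *: "isCont (nth_derivative k f) x" "i < k \<Longrightarrow> nth_derivative i f differentiable at x" for x i
  proof -
    from assms[of x] obtain S g where S: "open S" "x \<in> S" "C_class k g" and fg: "\<forall>y\<in>S. f y = g y"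
      by (elim exE conjE)
    have eq: "nth_derivative i g y = nth_derivative i f y" if "y \<in> S" for i y
      using nth_derivative_cong[OF S(1) bspec[OF fg] that, where n = i] by simp
    have "isCont (nth_derivative k g) x"
      using C_class_nth_derivative_continuous[OF S(3) order_refl]
      by (simp add: continuous_on_eq_continuous_at)
    then show "isCont (nth_derivative k f) x"
      unfolding isCont_def eq[OF S(2)]
      by (rule Lim_transform_within_open[OF _ S(1,2)]) (rule eq)
    assume "i < k"
    then have "(nth_derivative i g has_vector_derivative nth_derivative (Suc i) g x) (at x)"
      using C_class_nth_derivative_has_derivative[OF S(3)] by blast
    then have "(nth_derivative i f has_vector_derivative nth_derivative (Suc i) g x) (at x)"
      by (rule has_vector_derivative_transform_within_open[OF _ S(1,2)]) (rule eq)
    then show "nth_derivative i f differentiable at x"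
      by (rule differentiableI_vector)
  qed
  then show ?thesis
    unfolding C_class_def by (simp add: differentiable_on_def continuous_on_eq_continuous_at)
qed

lemma nth_derivative_add:
  assumes "C_class k f" "C_class k g" "i \<le> k"
  shows "nth_derivative i (\<lambda>x. f x + g x) x = nth_derivative i f x + nth_derivative i g x"
  using assms(3)
proof (induction i arbitrary: x)
  case (Suc i)
  then have "nth_derivative i (\<lambda>x. f x + g x) = (\<lambda>x. nth_derivative i f x + nth_derivative i g x)"
    by auto
  then show ?case
    using Suc.prems C_class_nth_derivative_has_derivative[OF assms(1), of i x]
      C_class_nth_derivative_has_derivative[OF assms(2), of i x]
    by (subst nth_derivative_Suc) (auto intro!: vector_derivative_at has_vector_derivative_add)
qed auto

lemma nth_derivative_scaleR_left:
  fixes v :: "'a::real_normed_vector"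
  assumes "C_class k f" "i \<le> k"
  shows "nth_derivative i (\<lambda>x. f x *\<^sub>R v) x = nth_derivative i f x *\<^sub>R v"
  using assms(2)
proof (induction i arbitrary: x)
  case (Suc i)
  then have "nth_derivative i (\<lambda>x. f x *\<^sub>R v) = (\<lambda>x. nth_derivative i f x *\<^sub>R v)"
    by auto
  then show ?case
    using Suc.prems C_class_nth_derivative_has_derivative[OF assms(1), of i x]
    by (subst nth_derivative_Suc)
      (auto intro!: vector_derivative_at bounded_linear.has_vector_derivative[OF bounded_linear_scaleR_left])
qed auto

lemma nth_derivative_sum:
  assumes "finite A" "\<And>j. j \<in> A \<Longrightarrow> C_class k (f j)" "i \<le> k"
  shows "nth_derivative i (\<lambda>x. \<Sum>j\<in>A. f j x) x = (\<Sum>j\<in>A. nth_derivative i (f j) x)"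
  using assms(1,2)
proof (induction A rule: finite_induct)
  case (insert a A)
  then show ?case using assms(3)
    by (simp add: nth_derivative_add[where k=k] C_class_sum)
qed simp

text \<open>This turns zeros of ordinary derivatives into zeros of the generalized ones.\<close>

lemma nth_derivative_mult_eq_0:
  fixes f v :: "real \<Rightarrow> real"
  assumes "C_class s f" "C_class s v" "\<forall>i\<le>s. nth_derivative i f z = 0"
  shows "\<forall>i\<le>s. nth_derivative i (\<lambda>x. f x * v x) z = 0"
  using assms
proof (induction s arbitrary: f v)
  case (Suc s)
  define f' v' where "f' = (\<lambda>x. vector_derivative f (at x))" and "v' = (\<lambda>x. vector_derivative v (at x))"
  have f': "C_class s f'" "\<And>x. (f has_vector_derivative f' x) (at x)"
    and v': "C_class s v'" "\<And>x. (v has_vector_derivative v' x) (at x)"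
    using C_class_SucD[OF Suc.prems(1)] C_class_SucD[OF Suc.prems(2)] by (auto simp: f'_def v'_def)
  have fz: "f z = 0" using Suc.prems(3) by force
  have "\<forall>i\<le>s. nth_derivative i f' z = 0"
    using Suc.prems(3) by (auto simp: f'_def simp flip: nth_derivative_Suc_shift)
  then have "\<forall>i\<le>s. nth_derivative i (\<lambda>x. f' x * v x) z = 0"
    using Suc f' C_class_pred by blast
  moreover have "\<forall>i\<le>s. nth_derivative i (\<lambda>x. f x * v' x) z = 0"
    using Suc v' C_class_pred by (meson le_SucI)
  moreover have d: "(\<lambda>x. vector_derivative (\<lambda>x. f x * v x) (at x)) = (\<lambda>x. f x * v' x + f' x * v x)"
    using f' v' by (auto intro!: vector_derivative_at has_vector_derivative_mult)
  ultimately have "nth_derivative i (\<lambda>x. vector_derivative (\<lambda>x. f x * v x) (at x)) z = 0" if "i \<le> s" for i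
    unfolding d using that Suc.prems f' v'
    by (subst nth_derivative_add[where k = s]) (auto intro: C_class_mult dest: C_class_pred)
  then have "nth_derivative (Suc i) (\<lambda>x. f x * v x) z = 0" if "i \<le> s" for i
    using that by (simp add: nth_derivative_Suc_shift)
  then have "nth_derivative i (\<lambda>x. f x * v x) z = 0" if "i \<le> Suc s" for i
    using that fz by (cases i) auto
  then show ?case by blast
qed simp

section \<open>Generalized derivatives\<close>

text \<open>\<open>ode w n i f I\<close> says that \<open>f\<close> solves, on \<open>I\<close>, the equation
  \<open>D (1 / w\<^bsub>i+n\<^esub>) D \<dots> D (1 / w\<^sub>i) f = 0\<close> characterizing the span of the nested integrals.
  Unlike that span, it is visibly invariant under shifts when the weights are quasi-periodic.\<close>

primrec ode :: "(nat \<Rightarrow> real \<Rightarrow> real) \<Rightarrow> nat \<Rightarrow> nat \<Rightarrow> (real \<Rightarrow> real) \<Rightarrow> real set \<Rightarrow> bool" where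
  "ode w 0 i f I \<longleftrightarrow> (\<exists>a. \<forall>x\<in>I. f x = a * w i x)"
| "ode w (Suc n) i f I \<longleftrightarrow>
    (\<exists>h. (\<forall>x\<in>I. ((\<lambda>y. f y / w i y) has_real_derivative h x) (at x)) \<and> ode w n (Suc i) h I)"

lemma ode_SucI:
  "\<lbrakk>\<And>x. x \<in> I \<Longrightarrow> ((\<lambda>y. f y / w i y) has_real_derivative h x) (at x); ode w n (Suc i) h I\<rbrakk>
    \<Longrightarrow> ode w (Suc n) i f I"
  by auto

lemma ode_cong:
  assumes "open I" "\<And>x. x \<in> I \<Longrightarrow> f x = g x" "ode w n i f I"
  shows "ode w n i g I"
proof (cases n)
  case 0
  with assms show ?thesis by auto
next
  case (Suc k)
  with assms(3) obtain h where h: "ode w k (Suc i) h I"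
    "\<And>x. x \<in> I \<Longrightarrow> ((\<lambda>y. f y / w i y) has_real_derivative h x) (at x)"
    by auto
  have "((\<lambda>y. g y / w i y) has_real_derivative h x) (at x)" if "x \<in> I" for x
    by (rule has_field_derivative_transform_within_open[OF h(2)[OF that] assms(1) that]) (simp add: assms(2))
  with h(1) Suc show ?thesis by auto
qed

lemma ode_add: "ode w n i f I \<Longrightarrow> ode w n i g I \<Longrightarrow> ode w n i (\<lambda>x. f x + g x) I"
proof (induction n arbitrary: i f g)
  case 0
  then obtain a b where "\<forall>x\<in>I. f x = a * w i x" "\<forall>x\<in>I. g x = b * w i x" by auto
  then show ?case by (auto intro!: exI[of _ "a + b"] simp: algebra_simps)
next
  case (Suc n)
  from Suc.prems obtain h k where h: "ode w n (Suc i) h I"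
    "\<And>x. x \<in> I \<Longrightarrow> ((\<lambda>y. f y / w i y) has_real_derivative h x) (at x)"
    and k: "ode w n (Suc i) k I"
    "\<And>x. x \<in> I \<Longrightarrow> ((\<lambda>y. g y / w i y) has_real_derivative k x) (at x)"
    by auto
  have "((\<lambda>y. (f y + g y) / w i y) has_real_derivative h x + k x) (at x)" if "x \<in> I" for x
    using DERIV_add[OF h(2)[OF that] k(2)[OF that]] by (simp add: add_divide_distrib)
  from ode_SucI[of I, OF this Suc.IH[OF h(1) k(1)]] show ?case .
qed

lemma ode_cmult: "ode w n i f I \<Longrightarrow> ode w n i (\<lambda>x. c * f x) I"
proof (induction n arbitrary: i f)
  case 0
  then obtain a where "\<forall>x\<in>I. f x = a * w i x" by auto
  then show ?case by (auto intro!: exI[of _ "c * a"] simp: algebra_simps)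
next
  case (Suc n)
  from Suc.prems obtain h where h: "ode w n (Suc i) h I"
    "\<And>x. x \<in> I \<Longrightarrow> ((\<lambda>y. f y / w i y) has_real_derivative h x) (at x)"
    by auto
  have "((\<lambda>y. (c * f y) / w i y) has_real_derivative c * h x) (at x)" if "x \<in> I" for x
    using DERIV_cmult[OF h(2)[OF that], of c] by simp
  from ode_SucI[of I, OF this Suc.IH[OF h(1)]] show ?case .
qed

lemma ode_zero: "ode w n i (\<lambda>x. 0) I"
  by (induction n arbitrary: i) (auto intro!: exI[of _ "\<lambda>_. 0"])

lemma ode_sum:
  "(\<And>j. j \<in> A \<Longrightarrow> ode w n i (f j) I) \<Longrightarrow> ode w n i (\<lambda>x. \<Sum>j\<in>A. f j x) I"
  by (induction A rule: infinite_finite_induct) (auto intro: ode_zero ode_add)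

text \<open>The shifted quotient \<open>f / w i\<close> differs from the quotient of the shifted
  function only by the constant factor \<open>\<kappa> i\<close>, which the linear equation absorbs
  at every level.\<close>

lemma ode_shift:
  assumes "\<And>j. \<kappa> j \<noteq> 0" and "\<And>x. x \<in> J \<Longrightarrow> x - a \<in> I"
    and "\<And>j x. i \<le> j \<Longrightarrow> j \<le> i + n \<Longrightarrow> w j (x - a) = \<kappa> j * w j x"
    and "ode w n i f I"
  shows "ode w n i (\<lambda>x. f (x - a)) J"
  using assms(3,4)
proof (induction n arbitrary: i f)
  case 0
  then obtain c where "\<forall>x\<in>I. f x = c * w i x" by auto
  with assms(2) 0 show ?case by (auto intro!: exI[of _ "c * \<kappa> i"])
next
  case (Suc n)
  from Suc.prems obtain h where h: "ode w n (Suc i) h I"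
    "\<And>x. x \<in> I \<Longrightarrow> ((\<lambda>y. f y / w i y) has_real_derivative h x) (at x)"
    by auto
  have "((\<lambda>y. f (y - a) / w i y) has_real_derivative \<kappa> i * h (x - a)) (at x)" if "x \<in> J" for x
  proof -
    have "((\<lambda>y. f (y - a) / w i (y - a)) has_real_derivative h (x - a)) (at x)"
      using has_vector_derivative_shift[of "\<lambda>y. f y / w i y" "h (x - a)" x a] h(2)[OF assms(2)[OF that]]
      by (simp add: has_real_derivative_iff_has_vector_derivative)
    from DERIV_cmult[OF this, of "\<kappa> i"] show ?thesis
      using assms(1)[of i] by (simp add: Suc.prems(1))
  qed
  moreover have "ode w n (Suc i) (\<lambda>x. \<kappa> i * h (x - a)) J"
    by (rule ode_cmult, rule Suc.IH[OF _ h(1)], rule Suc.prems(1)) auto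
  ultimately show ?case by (rule ode_SucI[of J])
qed

lemma DERIV_interval_lebesgue_integral:
  fixes f :: "real \<Rightarrow> real"
  assumes "continuous_on UNIV f"
  shows "((\<lambda>u. LBINT y=0..u. f y) has_real_derivative f x) (at x)"
proof -
  \<comment> \<open>The interval contains 0 and has \<open>x\<close> in its interior whatever the
    sign of \<open>x\<close>, so the one-sided notion becomes a derivative at
    \<open>x\<close>.\<close>
  have "((\<lambda>u. LBINT y=0..u. f y) has_vector_derivative f x) (at x within {min 0 x - 1..max 0 x + 1})"
    using interval_integral_FTC2[of "min 0 x - 1" 0 "max 0 x + 1" f x]
      continuous_on_subset[OF assms] by (simp add: zero_ereal_def)
  moreover have "x \<in> {min 0 x - 1<..<max 0 x + 1}" by auto
  ultimately show ?thesis
    unfolding has_real_derivative_iff_has_vector_derivative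
    by (metis at_within_interior interior_atLeastAtMost_real)
qed

lemma continuous_on_nested_integral:
  assumes "\<And>j. i \<le> j \<Longrightarrow> j \<le> i + n \<Longrightarrow> continuous_on UNIV (w j)"
  shows "continuous_on UNIV (nested_integral w n i)"
  using assms
proof (induction n arbitrary: i)
  case (Suc n)
  have "continuous_on UNIV (\<lambda>u. LBINT y=0..ereal u. nested_integral w n (Suc i) y)"
    by (rule DERIV_continuous_on, rule has_field_derivative_at_within,
        rule DERIV_interval_lebesgue_integral, rule Suc.IH) (auto intro: Suc.prems)
  then show ?case
    using Suc.prems[of i] by (simp add: continuous_on_mult)
qed simp

text \<open>Shorter nested integrals solve the longer equation too: after \<open>n\<close> steps the
  quotient by the weight is the constant 1, and the next derivative is zero.\<close>

lemma ode_nested_integral: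
  assumes "\<And>j. i \<le> j \<Longrightarrow> j \<le> i + N \<Longrightarrow> continuous_on UNIV (w j) \<and> (\<forall>x. w j x \<noteq> 0)"
    and "n \<le> N"
  shows "ode w N i (nested_integral w n i) I"
  using assms
proof (induction N arbitrary: i n)
  case 0
  then show ?case by (auto intro!: exI[of _ 1])
next
  case (Suc N)
  show ?case
  proof (cases n)
    case 0
    have "w i x \<noteq> 0" for x using Suc.prems by auto
    then show ?thesis using 0 ode_zero by (auto intro!: exI[of _ "\<lambda>_. 0"])
  next
    case (Suc k)
    have 1: "ode w N (Suc i) (nested_integral w k (Suc i)) I"
      using Suc.prems Suc by (intro Suc.IH) auto
    have "((\<lambda>u. LBINT y=0..ereal u. nested_integral w k (Suc i) y) has_real_derivative
        nested_integral w k (Suc i) x) (at x)" for x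
      using Suc.prems Suc
      by (intro DERIV_interval_lebesgue_integral continuous_on_nested_integral) auto
    moreover have "nested_integral w n i y / w i y = (LBINT y=0..ereal y. nested_integral w k (Suc i) y)" for y
      using Suc.prems(1)[of i] Suc by simp
    ultimately show ?thesis using 1 by auto
  qed
qed

text \<open>Unique continuation. The inner derivative \<open>h\<close> vanishes on the small
  interval, hence by induction on the large one; then \<open>f / w i\<close> is constant, and its
  value is read off at a point of the small interval.\<close>

lemma ode_unique:
  assumes "\<And>j x. i \<le> j \<Longrightarrow> j \<le> i + n \<Longrightarrow> w j x \<noteq> 0"
    and "ode w n i f {a<..<b}" and "c < d" "{c<..<d} \<subseteq> {a<..<b}" "\<And>x. x \<in> {c<..<d} \<Longrightarrow> f x = 0"
    and "x \<in> {a<..<b}"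
  shows "f x = 0"
  using assms(1,2,5,6)
proof (induction n arbitrary: i f x)
  case 0
  then obtain e where e: "\<forall>x\<in>{a<..<b}. f x = e * w i x" by auto
  have "(c + d) / 2 \<in> {c<..<d}" using \<open>c < d\<close> by auto
  with 0 e assms(4) have "e = 0" by (metis add.right_neutral le_refl mult_eq_0_iff subsetD)
  with e 0 show ?case by auto
next
  case (Suc n)
  from Suc.prems obtain h where h: "ode w n (Suc i) h {a<..<b}"
    "\<And>x. x \<in> {a<..<b} \<Longrightarrow> ((\<lambda>y. f y / w i y) has_real_derivative h x) (at x)"
    by auto
  have mid: "(c + d) / 2 \<in> {c<..<d}" using \<open>c < d\<close> by auto
  have "h y = 0" if y: "y \<in> {c<..<d}" for y
  proof -
    have "((\<lambda>y. 0) has_real_derivative h y) (at y)"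
      by (rule has_field_derivative_transform_within_open[OF h(2), of _ "{c<..<d}"]) (use y assms(4) Suc.prems(3) in auto)
    then show ?thesis using DERIV_unique DERIV_const by blast
  qed
  then have h0: "h y = 0" if "y \<in> {a<..<b}" for y
    using Suc.IH[OF _ h(1) _ that] Suc.prems(1) by simp
  have "\<exists>k. \<forall>y\<in>{a<..<b}. f y / w i y = k"
    by (rule has_field_derivative_zero_constant)
      (use h(2) h0 in \<open>auto intro: has_field_derivative_at_within\<close>)
  then obtain k where k: "\<And>y. y \<in> {a<..<b} \<Longrightarrow> f y / w i y = k" by blast
  have "k = 0" using k[OF subsetD[OF assms(4) mid]] Suc.prems(3)[OF mid] by simp
  with k[OF Suc.prems(4)] Suc.prems(1)[of i x] show ?case by simp
qed

text \<open>In operator notation \<open>D (1 / w (i + k - 1)) D \<dots> D (1 / w i) f\<close>. The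
  recursion peels off the outermost operator, whereas \<open>ode\<close> peels off the innermost;
  \<open>gen_deriv_Suc_shift\<close> mediates.\<close>

primrec gen_deriv :: "(nat \<Rightarrow> real \<Rightarrow> real) \<Rightarrow> nat \<Rightarrow> nat \<Rightarrow> (real \<Rightarrow> real) \<Rightarrow> real \<Rightarrow> real" where
  "gen_deriv w 0 i f = f"
| "gen_deriv w (Suc k) i f =
    (\<lambda>x. vector_derivative (\<lambda>y. gen_deriv w k i f y / w (i + k) y) (at x))"

lemma gen_deriv_Suc_shift:
  "gen_deriv w (Suc k) i f =
    gen_deriv w k (Suc i) (\<lambda>x. vector_derivative (\<lambda>y. f y / w i y) (at x))"
  by (induction k) auto

lemma gen_deriv_cong:
  assumes "open I" "\<And>y. y \<in> I \<Longrightarrow> f y = g y" "x \<in> I"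
  shows "gen_deriv w k i f x = gen_deriv w k i g x"
  using assms(3)
proof (induction k arbitrary: x)
  case (Suc k)
  then show ?case
    unfolding gen_deriv.simps by (intro vector_derivative_at_cong[OF assms(1)]) auto
qed (use assms in auto)

lemma gen_deriv_zero: "gen_deriv w k i (\<lambda>x. 0) = (\<lambda>x. 0)"
  by (induction k) auto

text \<open>Derivatives are unique, so the witnesses hidden in \<open>ode\<close> agree on
  \<open>I\<close> with the iterates of \<open>gen_deriv\<close>.\<close>

lemma ode_gen_deriv:
  assumes "open I" "ode w n i f I"
  shows "k < n \<Longrightarrow> x \<in> I \<Longrightarrow>
      ((\<lambda>y. gen_deriv w k i f y / w (i + k) y) has_real_derivative gen_deriv w (Suc k) i f x) (at x)"
    and "\<exists>a. \<forall>x\<in>I. gen_deriv w n i f x = a * w (i + n) x"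
proof -
  have "(\<forall>k<n. \<forall>x\<in>I. ((\<lambda>y. gen_deriv w k i f y / w (i + k) y) has_real_derivative
      gen_deriv w (Suc k) i f x) (at x)) \<and> (\<exists>a. \<forall>x\<in>I. gen_deriv w n i f x = a * w (i + n) x)"
    using assms(2)
  proof (induction n arbitrary: i f)
    case (Suc n)
    define f' where "f' = (\<lambda>x. vector_derivative (\<lambda>y. f y / w i y) (at x))"
    from Suc.prems obtain h where h: "ode w n (Suc i) h I"
      "\<And>x. x \<in> I \<Longrightarrow> ((\<lambda>y. f y / w i y) has_real_derivative h x) (at x)"
      by auto
    have hf': "h x = f' x" if "x \<in> I" for x
      using h(2)[OF that] unfolding f'_def
      by (simp add: has_real_derivative_iff_has_vector_derivative vector_derivative_at)
    have IH: "\<forall>k<n. \<forall>x\<in>I. ((\<lambda>y. gen_deriv w k (Suc i) f' y / w (Suc i + k) y) has_real_derivative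
      gen_deriv w (Suc k) (Suc i) f' x) (at x)" "\<exists>a. \<forall>x\<in>I. gen_deriv w n (Suc i) f' x = a * w (Suc i + n) x"
      using Suc.IH[OF ode_cong[OF assms(1) hf' h(1)]] by blast+
    have sh: "gen_deriv w (Suc k) i f = gen_deriv w k (Suc i) f'" for k
      unfolding f'_def by (rule gen_deriv_Suc_shift)
    have "((\<lambda>y. gen_deriv w k i f y / w (i + k) y) has_real_derivative gen_deriv w (Suc k) i f x) (at x)"
      if "k < Suc n" "x \<in> I" for k x
    proof (cases k)
      case 0
      then show ?thesis unfolding sh using h(2)[OF that(2)] hf'[OF that(2)] by simp
    next
      case (Suc j)
      then show ?thesis using IH(1) that by (simp only: sh) simp
    qed
    with IH(2) show ?case by (simp only: sh) simp
  qed auto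
  then show "k < n \<Longrightarrow> x \<in> I \<Longrightarrow>
      ((\<lambda>y. gen_deriv w k i f y / w (i + k) y) has_real_derivative gen_deriv w (Suc k) i f x) (at x)"
    and "\<exists>a. \<forall>x\<in>I. gen_deriv w n i f x = a * w (i + n) x"
    by blast+
qed

section \<open>Sign changes\<close>

text \<open>Here \<open>\<sigma>\<close> is the first of the \<open>n + 1\<close> alternating signs. The points avoid \<open>\<int>\<close>, where the highest generalized
  derivative of a spline need not exist.\<close>

primrec sign_changes :: "(real \<Rightarrow> real) \<Rightarrow> nat \<Rightarrow> real \<Rightarrow> real \<Rightarrow> real \<Rightarrow> bool" where
  "sign_changes g 0 \<sigma> a b \<longleftrightarrow> (\<exists>t. a < t \<and> t < b \<and> t \<notin> \<int> \<and> 0 < \<sigma> * g t)"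
| "sign_changes g (Suc n) \<sigma> a b \<longleftrightarrow>
    (\<exists>t. a < t \<and> t < b \<and> t \<notin> \<int> \<and> 0 < \<sigma> * g t \<and> sign_changes g n (- \<sigma>) t b)"

lemma sign_changes_weaken: "sign_changes g n \<sigma> a b \<Longrightarrow> a' \<le> a \<Longrightarrow> sign_changes g n \<sigma> a' b"
  by (cases n) force+

text \<open>The last sign is dropped rather than the first, which preserves the leading
  sign.\<close>

lemma sign_changes_drop: "sign_changes g (Suc n) \<sigma> a b \<Longrightarrow> sign_changes g n \<sigma> a b"
  by (induction n arbitrary: \<sigma> a) force+

lemma sign_changes_cong:
  assumes "\<And>t \<sigma>. 0 < \<sigma> * g t \<longleftrightarrow> 0 < \<sigma> * h t"
  shows "sign_changes g n \<sigma> a b \<longleftrightarrow> sign_changes h n \<sigma> a b"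
  by (induction n arbitrary: \<sigma> a) (auto simp: assms)

text \<open>The two patterns have \<open>n + 1\<close> and \<open>n' + 1\<close> points. If the
  signs at the junction coincide, one point is discarded; if they differ, there is one alternation
  to spare. In both cases \<open>n + n'\<close> remain.\<close>

lemma sign_changes_concat:
  assumes "sign_changes g n \<sigma> a b" "sign_changes g n' \<tau> b c"
    and "\<sigma> \<in> {1, -1}" "\<tau> \<in> {1, -1}"
  shows "sign_changes g (n + n') \<sigma> a c"
  using assms(1,3)
proof (induction n arbitrary: \<sigma> a)
  case 0
  then obtain t where t: "a < t" "t < b" "t \<notin> \<int>" "0 < \<sigma> * g t" by auto
  have "b < c" using assms(2) by (cases n') auto
  show ?case
  proof (cases "\<sigma> = \<tau>")
    case True
    then show ?thesis using assms(2) t sign_changes_weaken[of g n' \<tau> b c a] by simp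
  next
    case False
    then have "- \<sigma> = \<tau>" using 0 assms(4) by auto
    then have "sign_changes g n' (- \<sigma>) t c"
      using sign_changes_weaken[OF assms(2), of t] t by simp
    then have "sign_changes g (Suc n') \<sigma> a c" using t \<open>b < c\<close> by auto
    then show ?thesis using sign_changes_drop by simp
  qed
next
  case (Suc n)
  then obtain t where t: "a < t" "t < b" "t \<notin> \<int>" "0 < \<sigma> * g t" "sign_changes g n (- \<sigma>) t b" by auto
  have "b < c" using assms(2) by (cases n') auto
  have "sign_changes g (n + n') (- \<sigma>) t c" using Suc t by auto
  then show ?case using t \<open>b < c\<close> by auto
qed

text \<open>The mean value theorem would require a derivative at integers and might return one.
  Instead, if \<open>\<sigma> * h'\<close> were nonpositive off the integers, integrating it with
  finitely many exceptional points would contradict the increase of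
  \<open>\<sigma> * h\<close>.\<close>

lemma mvt_sign:
  fixes h :: "real \<Rightarrow> real"
  assumes "a < b" "continuous_on {a..b} h"
    and "\<And>x. a < x \<Longrightarrow> x < b \<Longrightarrow> x \<notin> \<int> \<Longrightarrow> (h has_real_derivative h' x) (at x)"
    and "\<sigma> * h a < \<sigma> * h b"
  shows "\<exists>t. a < t \<and> t < b \<and> t \<notin> \<int> \<and> 0 < \<sigma> * h' t"
proof (rule ccontr)
  assume neg: "\<not> ?thesis"
  define S where "S = insert a (insert b (\<int> \<inter> {a..b}))"
  have fin: "finite S" using finite_int_segment[of a b] by (simp add: S_def Int_def)
  \<comment> \<open>The value 0 at exceptional points keeps the sign bound valid on all of the
    interval.\<close>
  define k where "k = (\<lambda>x. if x \<in> S then 0 else h' x)"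
  have "(k has_integral (h b - h a)) {a..b}"
  proof (rule fundamental_theorem_of_calculus_interior_strong[OF fin])
    fix x assume "x \<in> {a<..<b} - S"
    then have "x \<notin> S" "a < x" "x < b" "x \<notin> \<int>" by (auto simp: S_def)
    then show "(h has_vector_derivative k x) (at x)"
      using assms(3) by (simp add: k_def has_real_derivative_iff_has_vector_derivative)
  qed (use assms in auto)
  from has_integral_mult_right[OF this, of \<sigma>]
  have "((\<lambda>x. \<sigma> * k x) has_integral \<sigma> * (h b - h a)) {a..b}" .
  moreover have "\<sigma> * k x \<le> 0" if "x \<in> {a..b}" for x
    using neg that by (auto simp: k_def S_def not_less dest: spec[of _ x])
  ultimately have "\<sigma> * (h b - h a) \<le> 0"
    by (rule has_integral_le[OF _ has_integral_0]) auto
  with assms(4) show False by (simp add: algebra_simps)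
qed

text \<open>With \<open>a\<close> as an additional point there are \<open>n + 1\<close> increments
  of alternating direction, as many as there were signs.\<close>

lemma sign_changes_deriv_left:
  fixes h :: "real \<Rightarrow> real"
  assumes "continuous_on UNIV h" "\<And>x. x \<notin> \<int> \<Longrightarrow> (h has_real_derivative h' x) (at x)"
    and "sign_changes h n \<sigma> a b" "\<sigma> * h a \<le> 0"
  shows "sign_changes h' n \<sigma> a b"
  using assms(3,4)
proof (induction n arbitrary: \<sigma> a)
  case 0
  then obtain t where t: "a < t" "t < b" "0 < \<sigma> * h t" by auto
  from mvt_sign[of a t h h' \<sigma>] t 0 assms(1,2) obtain u where "a < u" "u < t" "u \<notin> \<int>" "0 < \<sigma> * h' u"
    using continuous_on_subset by (metis le_less_trans subset_UNIV)
  then show ?case using t by auto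
next
  case (Suc n)
  then obtain t where t: "a < t" "t < b" "0 < \<sigma> * h t" "sign_changes h n (- \<sigma>) t b" by auto
  from mvt_sign[of a t h h' \<sigma>] t Suc.prems assms(1,2) obtain u where
    u: "a < u" "u < t" "u \<notin> \<int>" "0 < \<sigma> * h' u"
    using continuous_on_subset by (metis le_less_trans subset_UNIV)
  have "sign_changes h' n (- \<sigma>) t b" using Suc.IH[OF t(4)] t by simp
  then have "sign_changes h' n (- \<sigma>) u b" by (rule sign_changes_weaken) (use u in simp)
  then show ?case using t u by auto
qed

text \<open>The return to zero at \<open>b\<close> adds one more increment to those of
  \<open>sign_changes_deriv_left\<close>.\<close>

lemma sign_changes_deriv_both:
  fixes h :: "real \<Rightarrow> real"
  assumes "continuous_on UNIV h" "\<And>x. x \<notin> \<int> \<Longrightarrow> (h has_real_derivative h' x) (at x)"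
    and "sign_changes h n \<sigma> a b" "\<sigma> * h a \<le> 0" "h b = 0"
  shows "sign_changes h' (Suc n) \<sigma> a b"
  using assms(3,4)
proof (induction n arbitrary: \<sigma> a)
  case 0
  then obtain t where t: "a < t" "t < b" "0 < \<sigma> * h t" by auto
  from mvt_sign[of a t h h' \<sigma>] t 0 assms(1,2) obtain u where
    u: "a < u" "u < t" "u \<notin> \<int>" "0 < \<sigma> * h' u"
    using continuous_on_subset by (metis le_less_trans subset_UNIV)
  from mvt_sign[of t b h h' "- \<sigma>"] t assms obtain v where
    v: "t < v" "v < b" "v \<notin> \<int>" "0 < - \<sigma> * h' v"
    using continuous_on_subset by (metis minus_mult_left mult_zero_right neg_less_0_iff_less subset_UNIV)
  have "sign_changes h' 0 (- \<sigma>) u b" unfolding sign_changes.simps by (rule exI[of _ v]) (use u v in auto)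
  then show ?case unfolding sign_changes.simps(2) by (intro exI[of _ u]) (use t u v in auto)
next
  case (Suc n)
  then obtain t where t: "a < t" "t < b" "0 < \<sigma> * h t" "sign_changes h n (- \<sigma>) t b" by auto
  from mvt_sign[of a t h h' \<sigma>] t Suc.prems assms(1,2) obtain u where
    u: "a < u" "u < t" "u \<notin> \<int>" "0 < \<sigma> * h' u"
    using continuous_on_subset by (metis le_less_trans subset_UNIV)
  have "sign_changes h' (Suc n) (- \<sigma>) t b" using Suc.IH[OF t(4)] t by simp
  then have "sign_changes h' (Suc n) (- \<sigma>) u b" by (rule sign_changes_weaken) (use u in simp)
  then show ?case using t u by (subst sign_changes.simps) auto
qed

text \<open>The first sign point is used up as the left end for
  \<open>sign_changes_deriv_left\<close>; this loses one alternation and flips the leading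
  sign.\<close>

lemma sign_changes_deriv_lossy:
  fixes h :: "real \<Rightarrow> real"
  assumes "continuous_on UNIV h" "\<And>x. x \<notin> \<int> \<Longrightarrow> (h has_real_derivative h' x) (at x)"
    and "sign_changes h (Suc n) \<sigma> a b"
  shows "sign_changes h' n (- \<sigma>) a b"
proof -
  from assms(3) obtain t where t: "a < t" "0 < \<sigma> * h t" "sign_changes h n (- \<sigma>) t b" by auto
  have "sign_changes h' n (- \<sigma>) t b"
    by (rule sign_changes_deriv_left[OF assms(1,2) t(3)]) (use t in auto)
  then show ?thesis by (rule sign_changes_weaken) (use t in simp)
qed

text \<open>Opposite signs never occur in one open cell, so the \<open>n + 1\<close> points lie in
  different cells, and only \<open>\<lceil>b\<rceil> - \<lfloor>a\<rfloor>\<close> cells meet the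
  interval.\<close>

lemma sign_changes_le:
  assumes "\<And>(l::int) x y \<sigma>. \<lbrakk>x \<in> {real_of_int l<..<real_of_int l + 1}; y \<in> {real_of_int l<..<real_of_int l + 1}; 0 < \<sigma> * g x\<rbrakk> \<Longrightarrow> 0 \<le> \<sigma> * g y"
    and "sign_changes g n \<sigma> a b"
  shows "int n \<le> \<lceil>b\<rceil> - \<lfloor>a\<rfloor> - 1"
proof -
  \<comment> \<open>Here \<open>a\<close> itself carries the sign \<open>- \<sigma>\<close>, so its
    cell is closed to the next point; this is the extra 1.\<close>
  have *: "int n + 1 \<le> \<lceil>b\<rceil> - \<lfloor>a\<rfloor> - 1"
    if "sign_changes g n \<sigma> a b" "a \<notin> \<int>" "0 < - \<sigma> * g a" for n \<sigma> a
    using that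
  proof (induction n arbitrary: \<sigma> a)
    have step: "\<lfloor>a\<rfloor> + 1 \<le> \<lfloor>t\<rfloor>" if "a \<notin> \<int>" "t \<notin> \<int>" "a < t" "0 < - \<sigma> * g a" "0 < \<sigma> * g t" for a t \<sigma>
    proof (rule ccontr)
      assume "\<not> ?thesis"
      then have eq: "\<lfloor>t\<rfloor> = \<lfloor>a\<rfloor>" using that floor_mono[of a t] by linarith
      have "a \<in> {real_of_int \<lfloor>a\<rfloor><..<real_of_int \<lfloor>a\<rfloor> + 1}" "t \<in> {real_of_int \<lfloor>a\<rfloor><..<real_of_int \<lfloor>a\<rfloor> + 1}"
        using that eq floor_correct[of a] floor_correct[of t]
        by (auto simp: less_le)
      from assms(1)[OF this that(4)] that(5) show False by simp
    qed
    {
      case 0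
      then obtain t where t: "a < t" "t < b" "t \<notin> \<int>" "0 < \<sigma> * g t" by auto
      have "\<lfloor>t\<rfloor> < \<lceil>b\<rceil>" using t by linarith
      with step[OF 0(2) t(3,1) 0(3) t(4)] show ?case by simp
    next
      case (Suc n)
      then obtain t where t: "a < t" "t < b" "t \<notin> \<int>" "0 < \<sigma> * g t" "sign_changes g n (- \<sigma>) t b" by auto
      have "int n + 1 \<le> \<lceil>b\<rceil> - \<lfloor>t\<rfloor> - 1" using Suc.IH[OF t(5,3)] t(4) by simp
      with step[OF Suc.prems(2) t(3,1) Suc.prems(3) t(4)] show ?case by simp
    }
  qed
  show ?thesis
  proof (cases n)
    case 0
    then obtain t where t: "a < t" "t < b" using assms(2) by auto
    have "\<lfloor>a\<rfloor> < \<lceil>b\<rceil>" using t by linarith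
    then show ?thesis using 0 by simp
  next
    case (Suc k)
    then obtain t where t: "a < t" "t < b" "t \<notin> \<int>" "0 < \<sigma> * g t" "sign_changes g k (- \<sigma>) t b"
      using assms(2) by auto
    have "int k + 1 \<le> \<lceil>b\<rceil> - \<lfloor>t\<rfloor> - 1" by (rule *[OF t(5,3)]) (use t in simp)
    moreover have "\<lfloor>a\<rfloor> \<le> \<lfloor>t\<rfloor>" using t by (simp add: floor_mono)
    ultimately show ?thesis using Suc by simp
  qed
qed

section \<open>PEB-splines\<close>

lemma C_class_gen_step:
  fixes f w :: "real \<Rightarrow> real"
  assumes "C_class (Suc n) f" "C_class (Suc n) w" "\<And>x. w x \<noteq> 0"
  shows "C_class n (\<lambda>x. vector_derivative (\<lambda>y. f y / w y) (at x))"
    and "\<forall>i\<le>Suc s. nth_derivative i f z = 0 \<Longrightarrow> s \<le> n \<Longrightarrow>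
      \<forall>i\<le>s. nth_derivative i (\<lambda>x. vector_derivative (\<lambda>y. f y / w y) (at x)) z = 0"
proof -
  have C: "C_class (Suc n) (\<lambda>x. inverse (w x))"
    using assms C_class_inverse by blast
  then have "C_class (Suc n) (\<lambda>x. f x / w x)"
    unfolding divide_inverse using assms C_class_mult by blast
  then show "C_class n (\<lambda>x. vector_derivative (\<lambda>y. f y / w y) (at x))"
    by (rule C_class_SucD)
  assume 0: "\<forall>i\<le>Suc s. nth_derivative i f z = 0" and "s \<le> n"
  then have "\<forall>i\<le>Suc s. nth_derivative i (\<lambda>x. f x * inverse (w x)) z = 0"
    using assms C C_class_mono by (intro nth_derivative_mult_eq_0) (auto simp: C_class_mono)
  then show "\<forall>i\<le>s. nth_derivative i (\<lambda>x. vector_derivative (\<lambda>y. f y / w y) (at x)) z = 0"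
    unfolding divide_inverse nth_derivative_Suc_shift[symmetric] by auto
qed

locale peb =
  fixes m :: nat and \<gamma> :: "nat \<Rightarrow> real" and r :: "nat \<Rightarrow> real \<Rightarrow> real" and \<phi> :: "real \<Rightarrow> real"
  assumes m2: "2 \<le> m" and spline: "PEB_spline m \<gamma> r \<phi>"
begin

abbreviation "w \<equiv> PEB_weight \<gamma> r"

definition gd :: "nat \<Rightarrow> (real \<Rightarrow> real) \<Rightarrow> real \<Rightarrow> real" where
  "gd k f = gen_deriv w k 1 f"

lemma gd_0 [simp]: "gd 0 f = f"
  by (simp add: gd_def)

lemma gd_Suc: "gd (Suc k) f = (\<lambda>x. vector_derivative (\<lambda>y. gd k f y / w (Suc k) y) (at x))"
  by (simp add: gd_def)

lemma w_pos: "1 \<le> s \<Longrightarrow> s \<le> m \<Longrightarrow> 0 < w s x"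
  using spline by (auto simp: PEB_spline_def PEB_factors_def PEB_weight_def)

lemma w_neq_0: "1 \<le> s \<Longrightarrow> s \<le> m \<Longrightarrow> w s x \<noteq> 0"
  using w_pos[of s x] by simp

lemma w_C_class: "1 \<le> s \<Longrightarrow> s \<le> m \<Longrightarrow> C_class (m - s) (w s)"
  using spline unfolding PEB_spline_def PEB_factors_def PEB_weight_def
  by (intro C_class_mult C_class_exp) auto

lemma w_continuous: "1 \<le> s \<Longrightarrow> s \<le> m \<Longrightarrow> continuous_on UNIV (w s)"
  using w_C_class C_class_imp_continuous by blast

lemma w_shift:
  assumes "1 \<le> s" "s \<le> m"
  shows "w s (x - real_of_int l) = exp (- \<gamma> s * real_of_int l) * w s x"
proof -
  have per: "r s (y + 1) = r s y" for y
    using spline assms by (auto simp: PEB_spline_def PEB_factors_def)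
  have nat: "r s (y + real n) = r s y" for y n
  proof (induction n)
    case (Suc n)
    then show ?case using per[of "y + real n"] by (simp add: add.assoc add.commute[of 1])
  qed simp
  have "r s (x - real_of_int l) = r s x"
  proof (cases "0 \<le> l")
    case True
    then show ?thesis using nat[of "x - real_of_int l" "nat l"] by simp
  next
    case False
    then show ?thesis using nat[of x "nat (- l)"] by simp
  qed
  then show ?thesis
    by (simp add: PEB_weight_def algebra_simps flip: exp_add)
qed

text \<open>The index \<open>m - 1\<close> counts derivatives, so the equation involves the weights
  1 to \<open>m\<close>. Compact support is not demanded, since infinite series must be
  covered.\<close>

definition spl :: "(real \<Rightarrow> real) \<Rightarrow> bool" where
  "spl f \<longleftrightarrow> C_class (m - 2) f \<and>
    (\<forall>l::int. ode w (m - 1) 1 f {real_of_int l<..<real_of_int l + 1})"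

lemma splI:
  "C_class (m - 2) f \<Longrightarrow> (\<And>l::int. ode w (m - 1) 1 f {real_of_int l<..<real_of_int l + 1}) \<Longrightarrow> spl f"
  by (auto simp: spl_def)

lemma phi_C_class: "C_class (m - 2) \<phi>"
  using spline m2 by (auto simp: PEB_spline_def)

lemma phi_pos: "0 < x \<Longrightarrow> x < real m \<Longrightarrow> 0 < \<phi> x"
  using spline by (auto simp: PEB_spline_def)

text \<open>The support condition alone does not settle the values at 0 and \<open>m\<close>. By
  continuity the set where \<open>\<phi>\<close> is nonzero is open, hence contained in the interior
  of its closure.\<close>

lemma phi_eq_0:
  assumes "x \<le> 0 \<or> real m \<le> x"
  shows "\<phi> x = 0"
proof -
  have sub: "{x. \<phi> x \<noteq> 0} \<subseteq> {0..real m}"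
    using spline closure_subset[of "{x. \<phi> x \<noteq> 0}"] by (auto simp: PEB_spline_def)
  have cont: "isCont \<phi> y" for y
    using C_class_imp_continuous[OF phi_C_class] by (simp add: continuous_on_eq_continuous_at)
  have op: "open {x. \<phi> x \<noteq> 0}"
    using open_Collect_neq[OF C_class_imp_continuous[OF phi_C_class] continuous_on_const] by simp
  then have "{x. \<phi> x \<noteq> 0} \<subseteq> interior {0..real m}"
    using sub by (rule interior_maximal[rotated])
  then show ?thesis using assms by auto
qed

lemma spl_phi: "spl \<phi>"
proof (rule splI[OF phi_C_class])
  fix l :: int
  let ?I = "{real_of_int l<..<real_of_int l + 1}"
  from spline obtain a where
    a: "\<And>x. x \<in> ?I \<Longrightarrow> complex_of_real (\<phi> x) = (\<Sum>s=1..m. a s * complex_of_real (ECT_basis w s x))"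
    unfolding PEB_spline_def ECT_space_def by blast
  \<comment> \<open>The coefficients are complex but the spline is real, so their real parts
    represent it as well.\<close>
  have eq: "(\<Sum>s=1..m. Re (a s) * ECT_basis w s x) = \<phi> x" if "x \<in> ?I" for x
    using arg_cong[OF a[OF that], of Re] by simp
  have "ode w (m - 1) 1 (\<lambda>x. \<Sum>s=1..m. Re (a s) * ECT_basis w s x) ?I"
  proof (intro ode_sum ode_cmult)
    fix s assume "s \<in> {1..m}"
    then show "ode w (m - 1) 1 (ECT_basis w s) ?I"
      unfolding ECT_basis_def
      using w_pos w_continuous m2 by (intro ode_nested_integral) (auto simp: less_imp_neq[symmetric])
  qed
  then show "ode w (m - 1) 1 \<phi> ?I"
    by (rule ode_cong[rotated 2]) (simp, rule eq)
qed

lemma spl_shift: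
  assumes "spl f"
  shows "spl (\<lambda>x. f (x - real_of_int j))"
proof (rule splI)
  show "C_class (m - 2) (\<lambda>x. f (x - real_of_int j))"
    using assms by (auto simp: spl_def intro: C_class_shift)
  fix l :: int
  have "ode w (m - 1) 1 f {real_of_int (l - j)<..<real_of_int (l - j) + 1}"
    using assms unfolding spl_def by blast
  then show "ode w (m - 1) 1 (\<lambda>x. f (x - real_of_int j)) {real_of_int l<..<real_of_int l + 1}"
    using m2 by (intro ode_shift[where \<kappa> = "\<lambda>s. exp (- \<gamma> s * real_of_int j)" and
          I = "{real_of_int (l - j)<..<real_of_int (l - j) + 1}"] w_shift) auto
qed

lemma spl_cmult: "spl f \<Longrightarrow> spl (\<lambda>x. c * f x)"
  unfolding spl_def by (auto intro: ode_cmult C_class_mult C_class_const)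

lemma spl_sum: "(\<And>i. i \<in> A \<Longrightarrow> spl (f i)) \<Longrightarrow> spl (\<lambda>x. \<Sum>i\<in>A. f i x)"
  unfolding spl_def by (auto intro: ode_sum C_class_sum)

lemma spl_local:
  assumes "\<And>N::nat. \<exists>g. spl g \<and> (\<forall>x\<in>{- real N<..<real N}. f x = g x)"
  shows "spl f"
proof (rule splI)
  show "C_class (m - 2) f"
  proof (rule C_class_local)
    fix x :: real
    obtain N where N: "\<bar>x\<bar> < real N" using reals_Archimedean2 by blast
    obtain g where "spl g" "\<forall>x\<in>{- real N<..<real N}. f x = g x" using assms by blast
    with N show "\<exists>S g. open S \<and> x \<in> S \<and> C_class (m - 2) g \<and> (\<forall>y\<in>S. f y = g y)"
      by (intro exI[of _ "{- real N<..<real N}"] exI[of _ g]) (auto simp: spl_def)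
  qed
  fix l :: int
  obtain N where N: "\<bar>real_of_int l\<bar> + 1 < real N" using reals_Archimedean2 by blast
  obtain g where g: "spl g" "\<forall>x\<in>{- real N<..<real N}. f x = g x" using assms by blast
  then have "ode w (m - 1) 1 g {real_of_int l<..<real_of_int l + 1}" by (auto simp: spl_def)
  then show "ode w (m - 1) 1 f {real_of_int l<..<real_of_int l + 1}"
  proof (rule ode_cong[rotated 2])
    fix x assume "x \<in> {real_of_int l<..<real_of_int l + 1}"
    with N have "x \<in> {- real N<..<real N}" by auto
    with g(2) show "g x = f x" by simp
  qed simp
qed

text \<open>Each step uses up one order of smoothness; \<open>w (Suc k)\<close>, of class
  \<open>m - Suc k\<close>, is smooth enough for step \<open>k\<close>.\<close>

lemma gd_C_class:
  assumes "spl f" "k \<le> m - 2"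
  shows "C_class (m - 2 - k) (gd k f)"
  using assms(2)
proof (induction k)
  case 0
  then show ?case using assms by (simp add: spl_def)
next
  case (Suc k)
  have eq: "Suc (m - 2 - Suc k) = m - 2 - k" using Suc by simp
  have "C_class (m - Suc k) (w (Suc k))" using Suc by (intro w_C_class) auto
  then have "C_class (Suc (m - 2 - Suc k)) (w (Suc k))" by (rule C_class_mono) (use Suc in simp)
  moreover have "w (Suc k) x \<noteq> 0" for x using Suc by (intro w_neq_0) auto
  ultimately show ?case
    using Suc eq unfolding gd_Suc by (intro C_class_gen_step) auto
qed

lemma continuous_on_gd:
  "spl f \<Longrightarrow> k \<le> m - 2 \<Longrightarrow> continuous_on UNIV (gd k f)"
  using gd_C_class C_class_imp_continuous by blast

lemma gd_eq_0:
  assumes "spl f" "s \<le> m - 2" "\<forall>i\<le>s. nth_derivative i f z = 0" "k \<le> s"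
  shows "gd k f z = 0"
proof -
  \<comment> \<open>The induction must carry the whole remaining multiplicity, not only the value at
    \<open>z\<close>.\<close>
  have "\<forall>i\<le>s - k. nth_derivative i (gd k f) z = 0" using assms(4)
  proof (induction k)
    case 0
    then show ?case using assms by simp
  next
    case (Suc k)
    have eq: "Suc (m - 2 - Suc k) = m - 2 - k" "Suc (s - Suc k) = s - k" using Suc assms by auto
    have "C_class (m - Suc k) (w (Suc k))" using Suc assms by (intro w_C_class) auto
    then have "C_class (Suc (m - 2 - Suc k)) (w (Suc k))" by (rule C_class_mono) (use Suc assms in simp)
    moreover have "w (Suc k) x \<noteq> 0" for x using Suc assms by (intro w_neq_0) auto
    ultimately show ?case
      using Suc eq assms gd_C_class[OF assms(1), of k] unfolding gd_Suc
      by (intro C_class_gen_step(2)[where n = "m - 2 - Suc k"]) auto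
  qed
  then show ?thesis by (metis le0 nth_derivative_0)
qed

lemma DERIV_gd:
  assumes "spl f" "k \<le> m - 2" "x \<notin> \<int>"
  shows "((\<lambda>y. gd k f y / w (Suc k) y) has_real_derivative gd (Suc k) f x) (at x)"
proof -
  have "x \<noteq> real_of_int \<lfloor>x\<rfloor>" using assms(3) by (metis Ints_of_int)
  then have x: "x \<in> {real_of_int \<lfloor>x\<rfloor><..<real_of_int \<lfloor>x\<rfloor> + 1}"
    using of_int_floor_le[of x] floor_correct[of x] by (auto simp: less_le simp del: of_int_floor_le)
  have "ode w (m - 1) 1 f {real_of_int \<lfloor>x\<rfloor><..<real_of_int \<lfloor>x\<rfloor> + 1}" "k < m - 1"
    using assms m2 by (auto simp: spl_def)
  from ode_gen_deriv(1)[OF _ this x] show ?thesis by (simp add: gd_def)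
qed

lemma continuous_on_gd_div:
  assumes "spl f" "k \<le> m - 2"
  shows "continuous_on UNIV (\<lambda>y. gd k f y / w (Suc k) y)"
proof (intro continuous_on_divide continuous_on_gd assms)
  show "continuous_on UNIV (w (Suc k))"
    using assms m2 by (intro w_continuous) auto
  have "w (Suc k) x \<noteq> 0" for x using assms m2 by (intro w_neq_0) auto
  then show "\<forall>x\<in>UNIV. w (Suc k) x \<noteq> 0" by blast
qed

lemma sign_changes_gd_div:
  assumes "k \<le> m - 2"
  shows "sign_changes (\<lambda>y. gd k f y / w (Suc k) y) n \<sigma> a b \<longleftrightarrow> sign_changes (gd k f) n \<sigma> a b"
proof (rule sign_changes_cong)
  fix t \<sigma> :: real
  have "0 < w (Suc k) t" using w_pos[of "Suc k"] assms m2 by auto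
  then show "(0 < \<sigma> * (gd k f t / w (Suc k) t)) = (0 < \<sigma> * gd k f t)"
    by (simp add: zero_less_divide_iff)
qed

section \<open>Sign alternations of the generalized derivatives of a spline\<close>

lemma sign_changes_gd_left:
  assumes "spl f" "k \<le> m - 2" "sign_changes (gd k f) n \<sigma> a b" "gd k f a = 0"
  shows "sign_changes (gd (Suc k) f) n \<sigma> a b"
  by (rule sign_changes_deriv_left[OF continuous_on_gd_div[OF assms(1,2)] DERIV_gd[OF assms(1,2)]])
    (simp_all add: sign_changes_gd_div assms)

lemma sign_changes_gd_both:
  assumes "spl f" "k \<le> m - 2" "sign_changes (gd k f) n \<sigma> a b" "gd k f a = 0" "gd k f b = 0"
  shows "sign_changes (gd (Suc k) f) (Suc n) \<sigma> a b"
  by (rule sign_changes_deriv_both[OF continuous_on_gd_div[OF assms(1,2)] DERIV_gd[OF assms(1,2)]])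
    (simp_all add: sign_changes_gd_div assms)

lemma sign_changes_gd_lossy:
  assumes "spl f" "k \<le> m - 2" "sign_changes (gd k f) (Suc n) \<sigma> a b"
  shows "sign_changes (gd (Suc k) f) n (- \<sigma>) a b"
  by (rule sign_changes_deriv_lossy[OF continuous_on_gd_div[OF assms(1,2)] DERIV_gd[OF assms(1,2)]])
    (assumption | simp only: sign_changes_gd_div[OF assms(2)] assms(3))+

text \<open>On each cell the last generalized derivative is a constant multiple of the positive
  weight \<open>w m\<close>, so it has no sign change there.\<close>

lemma sign_changes_gd_last:
  assumes "spl f" "sign_changes (gd (m - 1) f) n \<sigma> a b"
  shows "int n \<le> \<lceil>b\<rceil> - \<lfloor>a\<rfloor> - 1"
proof (rule sign_changes_le[OF _ assms(2)])
  fix l :: int and x y \<sigma> :: real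
  let ?I = "{real_of_int l<..<real_of_int l + 1}"
  assume xy: "x \<in> ?I" "y \<in> ?I" and pos: "0 < \<sigma> * gd (m - 1) f x"
  have "ode w (m - 1) 1 f ?I" using assms by (simp add: spl_def)
  from ode_gen_deriv(2)[OF _ this] m2
  obtain a where "\<forall>x\<in>?I. gd (m - 1) f x = a * w m x" by (auto simp: gd_def)
  then have a: "\<And>x. x \<in> ?I \<Longrightarrow> gd (m - 1) f x = a * w m x" by blast
  have "0 < w m x" "0 < w m y" using w_pos m2 by auto
  with pos show "0 \<le> \<sigma> * gd (m - 1) f y"
    unfolding a[OF xy(1)] a[OF xy(2)]
    by (auto simp: zero_less_mult_iff zero_le_mult_iff mult_less_0_iff mult_le_0_iff)
qed

text \<open>One nonzero value is a pattern with no alternation; the zeros at both ends add an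
  alternation at each of the \<open>s + 1\<close> differentiations.\<close>

lemma sign_changes_gap:
  assumes f: "spl f" and s: "s \<le> m - 2"
    and za: "\<And>k. k \<le> s \<Longrightarrow> gd k f a = 0" and zb: "\<And>k. k \<le> s \<Longrightarrow> gd k f b = 0"
    and t: "a < t" "t < b" "f t \<noteq> 0"
  shows "\<exists>\<sigma>\<in>{1,-1}. sign_changes (gd (Suc s) f) (Suc s) \<sigma> a b"
proof -
  define \<sigma> where "\<sigma> = sgn (f t)"
  have cont: "continuous_on UNIV (\<lambda>t. \<sigma> * f t)"
    using continuous_on_gd[OF f, of 0] by (intro continuous_on_mult) auto
  \<comment> \<open>The point \<open>t\<close> may be an integer; an open set is not exhausted by
    countably many points, so it can be replaced by a non-integer with the same sign.\<close>
  have "open ({a<..<b} \<inter> {t. 0 < \<sigma> * f t})"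
    using open_Collect_less[OF continuous_on_const cont] by (intro open_Int) auto
  moreover have "t \<in> {a<..<b} \<inter> {t. 0 < \<sigma> * f t}"
    using t by (auto simp: \<sigma>_def sgn_if)
  moreover have "countable (\<int> :: real set)" by (simp add: Ints_def)
  ultimately obtain u where "u \<in> {a<..<b} \<inter> {t. 0 < \<sigma> * f t}" "u \<notin> \<int>"
    using open_minus_countable[of "\<int>" "{a<..<b} \<inter> {t. 0 < \<sigma> * f t}"] by blast
  then have 0: "sign_changes (gd 0 f) 0 \<sigma> a b" by auto
  have "sign_changes (gd q f) q \<sigma> a b" if "q \<le> Suc s" for q
    using that
  proof (induction q)
    case (Suc q)
    then show ?case using f s za zb by (intro sign_changes_gd_both) auto
  qed (use 0 in simp)
  moreover have "\<sigma> \<in> {1, -1}" using t by (auto simp: \<sigma>_def sgn_if)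
  ultimately show ?thesis by blast
qed

lemma sign_changes_chain:
  assumes f: "spl f" and s: "s \<le> m - 2"
    and z: "\<And>i k. i \<le> Suc K \<Longrightarrow> k \<le> s \<Longrightarrow> gd k f (z i) = 0"
    and gap: "\<And>i. i \<le> K \<Longrightarrow> \<exists>t. z i < t \<and> t < z (Suc i) \<and> f t \<noteq> 0"
  shows "\<exists>\<sigma>\<in>{1,-1}. sign_changes (gd (Suc s) f) (Suc K * Suc s) \<sigma> (z 0) (z (Suc K))"
  using z gap
proof (induction K)
  case 0
  from 0(2)[of 0] obtain t where t: "z 0 < t" "t < z (Suc 0)" "f t \<noteq> 0" by auto
  show ?case using sign_changes_gap[OF f s _ _ t] 0(1) by auto
next
  case (Suc K)
  from Suc obtain \<sigma> where \<sigma>: "\<sigma> \<in> {1, -1}"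
    "sign_changes (gd (Suc s) f) (Suc K * Suc s) \<sigma> (z 0) (z (Suc K))"
    by (meson le_SucI)
  from Suc.prems(2)[of "Suc K"] obtain t where
    t: "z (Suc K) < t" "t < z (Suc (Suc K))" "f t \<noteq> 0" by auto
  obtain \<tau> where \<tau>: "\<tau> \<in> {1, -1}" "sign_changes (gd (Suc s) f) (Suc s) \<tau> (z (Suc K)) (z (Suc (Suc K)))"
    using sign_changes_gap[OF f s _ _ t] Suc.prems(1) by (meson le_SucI order_refl)
  have "sign_changes (gd (Suc s) f) (Suc K * Suc s + Suc s) \<sigma> (z 0) (z (Suc (Suc K)))"
    by (rule sign_changes_concat[OF \<sigma>(2) \<tau>(2) \<sigma>(1) \<tau>(1)])
  then show ?case using \<sigma>(1) by (intro bexI[of _ \<sigma>]) (simp_all add: algebra_simps)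
qed

text \<open>Intended for \<open>a\<close> at the right end of a flat cell, where all continuous
  generalized derivatives vanish.\<close>

lemma sign_changes_persist:
  assumes "spl f" "sign_changes (gd j f) n \<sigma> a b" "\<And>k. k \<le> m - 2 \<Longrightarrow> gd k f a = 0" "j + d \<le> m - 1"
  shows "sign_changes (gd (j + d) f) n \<sigma> a b"
  using assms(4)
proof (induction d)
  case (Suc d)
  then show ?case using assms sign_changes_gd_left[of f "j + d" n \<sigma> a b] by simp
qed (use assms in simp)

text \<open>The counterpart without information at the ends: each differentiation costs one
  alternation.\<close>

lemma sign_changes_lose:
  assumes "spl f" "sign_changes (gd j f) (n + d) \<sigma> a b" "j + d \<le> m - 1"
  shows "\<exists>\<sigma>. sign_changes (gd (j + d) f) n \<sigma> a b"
  using assms(2,3)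
proof (induction d arbitrary: n)
  case (Suc d)
  have "sign_changes (gd j f) (Suc n + d) \<sigma> a b" "j + d \<le> m - 1" "j + d \<le> m - 2"
    using Suc.prems by simp_all
  with Suc.IH obtain \<sigma>' where "sign_changes (gd (j + d) f) (Suc n) \<sigma>' a b"
    by blast
  from sign_changes_gd_lossy[OF assms(1) \<open>j + d \<le> m - 2\<close> this] show ?case by auto
qed auto

end

section \<open>Shifts of a PEB-spline\<close>

text \<open>Real coefficients serve the sign counts and complex ones the function space;
  \<open>\<psi>\<close> will be \<open>\<phi>\<close> or one of its derivatives.\<close>

definition lattice_sum :: "(real \<Rightarrow> real) \<Rightarrow> (int \<Rightarrow> 'a::real_normed_vector) \<Rightarrow> real \<Rightarrow> 'a" where
  "lattice_sum \<psi> c x = (\<Sum>\<^sub>\<infinity>l. \<psi> (x - real_of_int l) *\<^sub>R c l)"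

lemma lattice_sum_eq:
  assumes "finite A" "\<And>l. l \<notin> A \<Longrightarrow> \<psi> (x - real_of_int l) = 0"
  shows "lattice_sum \<psi> c x = (\<Sum>l\<in>A. \<psi> (x - real_of_int l) *\<^sub>R c l)"
proof -
  have "lattice_sum \<psi> c x = (\<Sum>\<^sub>\<infinity>l\<in>A. \<psi> (x - real_of_int l) *\<^sub>R c l)"
    unfolding lattice_sum_def by (rule infsum_cong_neutral) (use assms in auto)
  then show ?thesis using assms by simp
qed

lemma lattice_sum_shift:
  "lattice_sum \<psi> c (x + real_of_int j) = lattice_sum \<psi> (\<lambda>l. c (l + j)) x"
proof -
  have "bij (\<lambda>l::int. l + j)" by (rule bij_plus_right)
  from infsum_reindex_bij_betw[OF this, of "\<lambda>l. \<psi> (x + real_of_int j - real_of_int l) *\<^sub>R c l"]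
  show ?thesis unfolding lattice_sum_def by (simp add: algebra_simps)
qed

lemma int_maximal_run:
  fixes l1 l2 q :: int
  assumes "P l1" "P l2" "l1 < q" "q < l2" "\<not> P q"
  shows "\<exists>a b. l1 \<le> a \<and> a < q \<and> q < b \<and> b \<le> l2 \<and> P a \<and> P b \<and> (\<forall>l. a < l \<and> l < b \<longrightarrow> \<not> P l)"
proof -
  define A B where "A = {l\<in>{l1..q}. P l}" and "B = {l\<in>{q..l2}. P l}"
  have fin: "finite A" "finite B"
    unfolding A_def B_def by (rule finite_subset[of _ "{l1..l2}"], use assms in auto)+
  have "l1 \<in> A" "l2 \<in> B"
    using assms by (auto simp: A_def B_def)
  then have ne: "A \<noteq> {}" "B \<noteq> {}" by auto
  have A: "Max A \<in> A" "\<And>l. l \<in> A \<Longrightarrow> l \<le> Max A" and B: "Min B \<in> B" "\<And>l. l \<in> B \<Longrightarrow> Min B \<le> l"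
    using fin ne by auto
  have ab: "l1 \<le> Max A" "Max A < q" "P (Max A)" "q < Min B" "Min B \<le> l2" "P (Min B)"
    using A(1) B(1) assms(5) by (auto simp: A_def B_def less_le)
  have "\<not> P l" if "Max A < l" "l < Min B" for l
  proof
    assume "P l"
    show False
    proof (cases "l \<le> q")
      case True
      then have "l \<in> A" using that ab \<open>P l\<close> by (auto simp: A_def)
      with A(2)[of l] that show False by simp
    next
      case False
      then have "l \<in> B" using that ab \<open>P l\<close> by (auto simp: B_def)
      with B(2)[of l] that show False by simp
    qed
  qed
  with ab show ?thesis by blast
qed

definition flat_cell :: "(real \<Rightarrow> 'a::zero) \<Rightarrow> int \<Rightarrow> bool" where
  "flat_cell f l \<longleftrightarrow> (\<forall>x\<in>{real_of_int l<..<real_of_int l + 1}. f x = 0)"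

context peb
begin

definition supported :: "(real \<Rightarrow> real) \<Rightarrow> bool" where
  "supported \<psi> \<longleftrightarrow> (\<forall>y. y \<le> 0 \<or> real m \<le> y \<longrightarrow> \<psi> y = 0)"

lemma supported_phi: "supported \<phi>"
  using phi_eq_0 by (simp add: supported_def)

text \<open>Off the closed support \<open>\<phi>\<close> is locally zero; the two endpoints follow
  by continuity of the derivative.\<close>

lemma supported_nth_derivative:
  assumes "i \<le> m - 2"
  shows "supported (nth_derivative i \<phi>)"
proof -
  have cont: "continuous_on UNIV (nth_derivative i \<phi>)"
    using C_class_nth_derivative_continuous[OF phi_C_class assms] .
  have cl: "closed {y. nth_derivative i \<phi> y = 0}"
    using closed_Collect_eq[OF cont continuous_on_const] by simp
  have 1: "{..<0} \<union> {real m<..} \<subseteq> {y. nth_derivative i \<phi> y = 0}"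
  proof
    fix y assume y: "y \<in> {..<0} \<union> {real m<..}"
    have "nth_derivative i \<phi> y = nth_derivative i (\<lambda>x. 0) y"
      by (rule nth_derivative_cong[of "{..<0} \<union> {real m<..}"]) (use y phi_eq_0 in auto)
    then show "y \<in> {y. nth_derivative i \<phi> y = 0}" by simp
  qed
  have "closure ({..<0} \<union> {real m<..}) \<subseteq> {y. nth_derivative i \<phi> y = 0}"
    by (rule closure_minimal[OF 1 cl])
  then show ?thesis by (auto simp: supported_def closure_Un)
qed

text \<open>The index set does not depend on \<open>x\<close>, so on the window the series is one
  finite sum, to which differentiation and \<open>ode\<close> apply termwise.\<close>

lemma lattice_sum_window:
  assumes "supported \<psi>" "x \<in> {- real N<..<real N}"
  shows "lattice_sum \<psi> c x = (\<Sum>l\<in>{- int N - int m..int N}. \<psi> (x - real_of_int l) *\<^sub>R c l)"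
proof (rule lattice_sum_eq)
  fix l assume "l \<notin> {- int N - int m..int N}"
  then have "real_of_int l \<ge> real N \<or> real_of_int l \<le> - real N - real m"
    by (auto simp: not_le)
  then show "\<psi> (x - real_of_int l) = 0"
    using assms by (auto simp: supported_def)
qed simp

lemma lattice_sum_cell:
  assumes "supported \<psi>" "x \<in> {real_of_int l..real_of_int l + 1}"
  shows "lattice_sum \<psi> c x = (\<Sum>k\<in>{l - int m<..l}. \<psi> (x - real_of_int k) *\<^sub>R c k)"
proof (rule lattice_sum_eq)
  fix k assume "k \<notin> {l - int m<..l}"
  then have "real_of_int k \<ge> real_of_int l + 1 \<or> real_of_int k \<le> real_of_int l - real m"
    by (auto simp: not_le)
  then show "\<psi> (x - real_of_int k) = 0"
    using assms by (auto simp: supported_def)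
qed simp

lemma spl_lattice_sum: "spl (lattice_sum \<phi> c)"
proof (rule spl_local)
  fix N :: nat
  have "spl (\<lambda>x. \<Sum>l\<in>{- int N - int m..int N}. c l * \<phi> (x - real_of_int l))"
    by (intro spl_sum spl_cmult spl_shift spl_phi)
  then show "\<exists>g. spl g \<and> (\<forall>x\<in>{- real N<..<real N}. lattice_sum \<phi> c x = g x)"
    using lattice_sum_window[OF supported_phi, of _ N c] by (intro exI conjI) (auto simp: mult.commute)
qed

lemma nth_derivative_lattice_sum:
  fixes c :: "int \<Rightarrow> 'a::real_normed_vector"
  assumes "i \<le> m - 2"
  shows "nth_derivative i (lattice_sum \<phi> c) x = lattice_sum (nth_derivative i \<phi>) c x"
proof -
  obtain N where N: "\<bar>x\<bar> < real N" using reals_Archimedean2 by blast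
  let ?I = "{- real N<..<real N}" and ?A = "{- int N - int m..int N}"
  have x: "x \<in> ?I" using N by auto
  have C: "C_class (m - 2) (\<lambda>x. \<phi> (x - real_of_int l))" for l
    by (rule C_class_shift[OF phi_C_class])
  have "nth_derivative i (lattice_sum \<phi> c) x =
      nth_derivative i (\<lambda>x. \<Sum>l\<in>?A. \<phi> (x - real_of_int l) *\<^sub>R c l) x"
    by (rule nth_derivative_cong[of ?I]) (use x lattice_sum_window[OF supported_phi] in auto)
  also have "\<dots> = (\<Sum>l\<in>?A. nth_derivative i (\<lambda>x. \<phi> (x - real_of_int l) *\<^sub>R c l) x)"
    by (rule nth_derivative_sum[OF _ _ assms]) (use C in \<open>auto intro: C_class_scaleR_left\<close>)
  also have "\<dots> = (\<Sum>l\<in>?A. nth_derivative i \<phi> (x - real_of_int l) *\<^sub>R c l)"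
    by (simp add: nth_derivative_scaleR_left[OF C assms] nth_derivative_shift)
  also have "\<dots> = lattice_sum (nth_derivative i \<phi>) c x"
    by (rule lattice_sum_window[OF supported_nth_derivative[OF assms] x, symmetric])
  finally show ?thesis .
qed

text \<open>Some part of the interval lies in the cell of \<open>\<lfloor>c\<rfloor>\<close>, and
  unique continuation spreads the zero to this whole cell.\<close>

lemma flat_cell_of_interval:
  assumes "spl f" "c < d" "\<And>x. c < x \<Longrightarrow> x < d \<Longrightarrow> f x = 0"
  shows "\<exists>l. flat_cell f l \<and> c < real_of_int l + 1 \<and> real_of_int l < d"
proof (intro exI conjI)
  let ?l = "\<lfloor>c\<rfloor>"
  have l: "real_of_int ?l \<le> c" "c < real_of_int ?l + 1" by linarith+
  then show "c < real_of_int ?l + 1" "real_of_int ?l < d" using assms(2) by linarith+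
  show "flat_cell f ?l"
    unfolding flat_cell_def
  proof
    fix x assume x: "x \<in> {real_of_int ?l<..<real_of_int ?l + 1}"
    have ode: "ode w (m - 1) 1 f {real_of_int ?l<..<real_of_int ?l + 1}"
      using assms by (simp add: spl_def)
    show "f x = 0"
    proof (rule ode_unique[OF _ ode _ _ _ x])
      show "w j y \<noteq> 0" if "1 \<le> j" "j \<le> 1 + (m - 1)" for j y
        using that m2 by (intro w_neq_0) auto
      show "c < min d (real_of_int ?l + 1)" using l assms(2) by simp
      show "{c<..<min d (real_of_int ?l + 1)} \<subseteq> {real_of_int ?l<..<real_of_int ?l + 1}"
      proof
        fix y assume "y \<in> {c<..<min d (real_of_int ?l + 1)}"
        then have "c < y" "y < real_of_int ?l + 1" by auto
        with l(1) have "real_of_int ?l < y" by linarith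
        with \<open>y < real_of_int ?l + 1\<close> show "y \<in> {real_of_int ?l<..<real_of_int ?l + 1}" by simp
      qed
      show "f y = 0" if "y \<in> {c<..<min d (real_of_int ?l + 1)}" for y
        using that assms(3) by auto
    qed
  qed
qed

text \<open>Continuity carries the zeros to the closed cell; its endpoints act as zeros of full
  multiplicity for the neighbouring run.\<close>

lemma gd_flat_cell:
  assumes "spl f" "flat_cell f l" "k \<le> m - 2" "real_of_int l \<le> x" "x \<le> real_of_int l + 1"
  shows "gd k f x = 0"
proof -
  let ?I = "{real_of_int l<..<real_of_int l + 1}"
  have "gd k f y = gd k (\<lambda>x. 0) y" if "y \<in> ?I" for y
    unfolding gd_def by (rule gen_deriv_cong[of ?I]) (use assms(2) that in \<open>auto simp: flat_cell_def\<close>)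
  then have 1: "?I \<subseteq> {y. gd k f y = 0}" by (auto simp: gd_def gen_deriv_zero)
  have "closed {y. gd k f y = 0}"
    using closed_Collect_eq[OF continuous_on_gd[OF assms(1,3)] continuous_on_const] by simp
  from closure_minimal[OF 1 this] show ?thesis using assms by auto
qed

text \<open>Minimal support: both ends are zeros of all orders up to \<open>m - 2\<close>, so the
  last derivative has \<open>m - 1\<close> alternations on the run, which needs \<open>m\<close>
  cells.\<close>

lemma flat_cells_distance:
  assumes "spl f" "flat_cell f l1" "flat_cell f l2" "l1 + 1 < l2"
    and "\<And>l. l1 < l \<Longrightarrow> l < l2 \<Longrightarrow> \<not> flat_cell f l"
  shows "int m \<le> l2 - l1 - 1"
proof -
  let ?a = "real_of_int l1 + 1" and ?b = "real_of_int l2"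
  have z: "gd k f ?a = 0" "gd k f ?b = 0" if "k \<le> m - 2" for k
    using gd_flat_cell[OF assms(1,2) that] gd_flat_cell[OF assms(1,3) that] by auto
  have "\<not> flat_cell f (l1 + 1)" using assms by auto
  then obtain t where t: "?a < t" "t < ?a + 1" "f t \<noteq> 0" by (auto simp: flat_cell_def)
  have "t < ?b" using t(2) assms(4) by linarith
  have "\<exists>\<sigma>\<in>{1,-1}. sign_changes (gd (Suc (m - 2)) f) (Suc (m - 2)) \<sigma> ?a ?b"
    by (rule sign_changes_gap[OF assms(1) order_refl z t(1) \<open>t < ?b\<close> t(3)])
  then obtain \<sigma> where "sign_changes (gd (Suc (m - 2)) f) (Suc (m - 2)) \<sigma> ?a ?b"
    by blast
  moreover have "Suc (m - 2) = m - 1" using m2 by simp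
  ultimately have "int (m - 1) \<le> \<lceil>?b\<rceil> - \<lfloor>?a\<rfloor> - 1"
    using sign_changes_gd_last[OF assms(1)] by metis
  then show ?thesis using m2 by simp
qed

lemma flat_cells_run:
  assumes "spl f" "flat_cell f l1" "flat_cell f l2" "l1 < q" "q < l2" "l2 - l1 \<le> int m"
  shows "flat_cell f q"
proof (rule ccontr)
  assume "\<not> flat_cell f q"
  from int_maximal_run[of "flat_cell f", OF assms(2-5) this] obtain a b where
    ab: "l1 \<le> a" "a < q" "q < b" "b \<le> l2" "flat_cell f a" "flat_cell f b"
    "\<And>l. a < l \<Longrightarrow> l < b \<Longrightarrow> \<not> flat_cell f l" by blast
  have "int m \<le> b - a - 1" by (rule flat_cells_distance[OF assms(1) ab(5,6) _ ab(7)]) (use ab in auto)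
  with ab assms(6) show False by simp
qed

text \<open>Keeping only the \<open>m\<close> coefficients active on cell \<open>l\<close> makes the
  series vanish on cells from \<open>l + m\<close> on and up to \<open>l - m\<close>. With cell
  \<open>l\<close> flat, the two runs left over have \<open>m - 1\<close> cells each, too few to be
  nonzero, so the truncated series is flat everywhere.\<close>

lemma local_linear_independence:
  fixes c :: "int \<Rightarrow> real"
  assumes "flat_cell (lattice_sum \<phi> c) l" "l - int m < k" "k \<le> l"
  shows "c k = 0"
proof (rule ccontr)
  assume ck: "c k \<noteq> 0"
  define c' where "c' = (\<lambda>j. if j \<in> {l - int m<..l} then c j else 0)"
  define f where "f = lattice_sum \<phi> c'"
  have f: "spl f" unfolding f_def by (rule spl_lattice_sum)
  have cell: "f x = (\<Sum>j\<in>{i - int m<..i}. \<phi> (x - real_of_int j) *\<^sub>R c' j)"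
    if "x \<in> {real_of_int i<..<real_of_int i + 1}" for x i
    unfolding f_def by (rule lattice_sum_cell[OF supported_phi]) (use that in auto)
  have 1: "flat_cell f l"
    unfolding flat_cell_def
  proof
    fix x assume x: "x \<in> {real_of_int l<..<real_of_int l + 1}"
    have "f x = lattice_sum \<phi> c x"
      using x lattice_sum_cell[OF supported_phi, of x l c] cell[OF x] by (simp add: c'_def)
    then show "f x = 0" using assms(1) x by (auto simp: flat_cell_def)
  qed
  have 2: "flat_cell f i" if "i \<le> l - int m \<or> l + int m \<le> i" for i
    unfolding flat_cell_def using cell[of _ i] that by (auto intro!: sum.neutral simp: c'_def)
  have flat: "flat_cell f i" for i
  proof -
    consider "i = l" | "i \<le> l - int m \<or> l + int m \<le> i" | "l - int m < i" "i < l" | "l < i" "i < l + int m"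
      by linarith
    then show ?thesis
    proof cases
      case 3
      show ?thesis by (rule flat_cells_run[OF f 2 1 3]) auto
    next
      case 4
      show ?thesis by (rule flat_cells_run[OF f 1 2 4]) auto
    qed (use 1 2 in auto)
  qed
  \<comment> \<open>On the cell of the least index with nonzero coefficient no other shift
    contributes, and \<open>\<phi>\<close> is positive there.\<close>
  define K where "K = {j \<in> {l - int m<..l}. c j \<noteq> 0}"
  have "finite K" unfolding K_def by (rule finite_subset[of _ "{l - int m<..l}"]) auto
  moreover have "k \<in> K" using ck assms by (auto simp: K_def)
  ultimately have K: "finite K" "K \<noteq> {}" by auto
  define k0 where "k0 = Min K"
  have k0: "k0 \<in> K" "\<And>j. j \<in> K \<Longrightarrow> k0 \<le> j" using K by (auto simp: k0_def)
  have c'0: "c' j = 0" if "j < k0" for j using k0(2)[of j] that by (auto simp: c'_def K_def)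
  let ?x = "real_of_int k0 + 1 / 2"
  have "f ?x = (\<Sum>j\<in>{k0 - int m<..k0}. \<phi> (?x - real_of_int j) *\<^sub>R c' j)"
    by (rule cell) auto
  also have "\<dots> = (\<Sum>j\<in>{k0}. \<phi> (?x - real_of_int j) *\<^sub>R c' j)"
    using c'0 m2 by (intro sum.mono_neutral_right) auto
  also have "\<dots> = \<phi> (1 / 2) * c k0" using k0(1) by (simp add: c'_def K_def)
  finally have "f ?x \<noteq> 0" using k0(1) phi_pos[of "1 / 2"] m2 by (auto simp: K_def)
  with flat[of k0] show False by (auto simp: flat_cell_def)
qed

end

section \<open>Uniqueness from samples\<close>

text \<open>The bounds are not strict, so that they define a closed set of sequences.\<close>

locale gapped =
  fixes x :: "int \<Rightarrow> real" and \<delta> g :: real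
  assumes \<delta>: "0 < \<delta>" and gap_ge: "\<And>j. \<delta> \<le> x (j + 1) - x j" and gap_le: "\<And>j. x (j + 1) - x j \<le> g"
begin

lemma add_ge: "x j + real n * \<delta> \<le> x (j + int n)"
proof (induction n)
  case (Suc n)
  then show ?case using gap_ge[of "j + int n"] by (simp add: algebra_simps)
qed simp

lemma add_le: "x (j + int n) \<le> x j + real n * g"
proof (induction n)
  case (Suc n)
  then show ?case using gap_le[of "j + int n"] by (simp add: algebra_simps)
qed simp

lemma less: "i < j \<Longrightarrow> x i < x j"
  using add_ge[of i "nat (j - i)"] \<delta> by (smt (verit) mult_pos_pos of_nat_0_less_iff zero_less_nat_eq int_nat_eq)

lemma less_iff: "x i < x j \<longleftrightarrow> i < j"
  using less by (metis not_less_iff_gr_or_eq)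

lemma le_iff: "x i \<le> x j \<longleftrightarrow> i \<le> j"
  using less_iff by (metis not_le)

lemma unbounded_above: "\<exists>j\<ge>i. t < x j"
proof -
  obtain n where "(t - x i) / \<delta> < real n" using reals_Archimedean2 by blast
  then have "t < x i + real n * \<delta>" using \<delta> by (simp add: field_simps)
  with add_ge[of i n] show ?thesis by (intro exI[of _ "i + int n"]) auto
qed

lemma unbounded_below: "\<exists>j\<le>i. x j < t"
proof -
  obtain n where "(x i - t) / \<delta> < real n" using reals_Archimedean2 by blast
  then have "x i < t + real n * \<delta>" using \<delta> by (simp add: field_simps)
  with add_ge[of "i - int n" n] show ?thesis by (intro exI[of _ "i - int n"]) auto
qed

lemma bracket: "\<exists>j. x j \<le> t \<and> t < x (j + 1)"
proof -
  obtain a where a: "x a < t" using unbounded_below by blast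
  obtain b where b: "a \<le> b" "t < x b" using unbounded_above by blast
  define S where "S = {j \<in> {a..b}. x j \<le> t}"
  have "finite S" unfolding S_def by (rule finite_subset[of _ "{a..b}"]) auto
  moreover have "a \<in> S" using a b by (simp add: S_def)
  ultimately have S: "Max S \<in> S" "\<And>j. j \<in> S \<Longrightarrow> j \<le> Max S" using Max_in[of S] by fastforce+
  have "Max S < b" using S(1) b less_iff[of "Max S" b] by (auto simp: S_def)
  moreover have "a \<le> Max S" "x (Max S) \<le> t" using S(1) by (auto simp: S_def)
  moreover have "t < x (Max S + 1)"
    using S(2)[of "Max S + 1"] calculation by (force simp: S_def)
  ultimately show ?thesis by blast
qed

end

context peb
begin

lemma no_flat_gap:
  assumes "spl f" "c < d" "\<And>l. c < real_of_int l + 1 \<Longrightarrow> real_of_int l < d \<Longrightarrow> \<not> flat_cell f l"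
  shows "\<exists>t. c < t \<and> t < d \<and> f t \<noteq> 0"
  using flat_cell_of_interval[OF assms(1,2)] assms(3) by blast

text \<open>A maximal run of \<open>b - a\<close> cells that are not flat, cut by the samples into
  \<open>L\<close> pieces, would carry \<open>L * (s + 1)\<close> alternations up to the last
  derivative, because its left end is a zero of all orders. So \<open>L * (s + 1) < b - a\<close>,
  but \<open>L\<close> gaps of the samples cover the run and give
  \<open>b - a \<le> L * g\<close>.\<close>

lemma flat_cell_between:
  assumes f: "spl f" and s: "s \<le> m - 2" and x: "gapped x \<delta> g" and g: "g < real s + 1"
    and z: "\<And>j k. k \<le> s \<Longrightarrow> gd k f (x j) = 0"
    and flat: "flat_cell f l1" "flat_cell f l2" and q: "l1 < q" "q < l2"
  shows "flat_cell f q"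
proof (rule ccontr)
  interpret gapped x \<delta> g by (rule x)
  assume "\<not> flat_cell f q"
  from int_maximal_run[of "flat_cell f", OF flat q this] obtain a' b where
    ab': "a' < q" "q < b" "flat_cell f a'" "flat_cell f b"
    "\<And>l. a' < l \<Longrightarrow> l < b \<Longrightarrow> \<not> flat_cell f l" by blast
  define a where "a = a' + 1"
  have ab: "a < b" using ab' by (simp add: a_def)
  have nf: "\<not> flat_cell f l" if "real_of_int a < real_of_int l + 1" "real_of_int l < real_of_int b" for l
    using that ab'(5)[of l] by (auto simp: a_def)
  have za: "gd k f (real_of_int a) = 0" and zb: "gd k f (real_of_int b) = 0" if "k \<le> m - 2" for k
    using gd_flat_cell[OF f ab'(3) that] gd_flat_cell[OF f ab'(4) that] by (auto simp: a_def)
  obtain j0 where j0: "x j0 \<le> real_of_int a" "real_of_int a < x (j0 + 1)" using bracket by blast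
  define P where "P = (\<lambda>n. real_of_int b \<le> x (j0 + int n))"
  obtain j1 where "j0 \<le> j1" "real_of_int b < x j1" using unbounded_above by blast
  then have "P (nat (j1 - j0))" by (simp add: P_def)
  define L where "L = (LEAST n. P n)"
  have PL: "P L" unfolding L_def by (rule LeastI) fact
  have notP: "\<not> P n" if "n < L" for n using that not_less_Least by (auto simp: L_def)
  have "L \<noteq> 0"
  proof
    assume "L = 0"
    with PL j0 ab show False by (simp add: P_def)
  qed
  then obtain K where K: "L = Suc K" by (cases L) auto
  \<comment> \<open>The outer samples may lie outside the run; they are replaced by its ends, which
    are zeros of at least the same multiplicity.\<close>
  define z' where "z' = (\<lambda>i. if i = 0 then real_of_int a else if i \<ge> L then real_of_int b else x (j0 + int i))"
  have z0: "gd k f (z' i) = 0" if "k \<le> s" for i k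
    using za zb z that s by (auto simp: z'_def)
  have lt: "z' i < z' (Suc i) \<and> real_of_int a \<le> z' i \<and> z' (Suc i) \<le> real_of_int b" if "i \<le> K" for i
  proof -
    have 1: "real_of_int a < x (j0 + int i)" if "i \<noteq> 0" for i
    proof -
      have "x (j0 + 1) \<le> x (j0 + int i)" using that by (simp add: le_iff)
      with j0 show ?thesis by simp
    qed
    have 2: "x (j0 + int i) < real_of_int b" if "i < L" for i
      using notP[OF that] by (simp add: P_def)
    show ?thesis
      using that K ab 1[of i] 1[of "Suc i"] 2[of i] 2[of "Suc i"] less[of "j0 + int i" "j0 + int (Suc i)"]
      by (auto simp: z'_def)
  qed
  have gapnz: "\<exists>t. z' i < t \<and> t < z' (Suc i) \<and> f t \<noteq> 0" if "i \<le> K" for i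
  proof (rule no_flat_gap[OF f])
    show "z' i < z' (Suc i)" using lt[OF that] by blast
    fix l assume "z' i < real_of_int l + 1" "real_of_int l < z' (Suc i)"
    then show "\<not> flat_cell f l" using lt[OF that] by (intro nf) auto
  qed
  have "\<exists>\<sigma>\<in>{1,-1}. sign_changes (gd (Suc s) f) (Suc K * Suc s) \<sigma> (z' 0) (z' (Suc K))"
    by (rule sign_changes_chain[OF f s]) (use z0 gapnz in blast)+
  moreover have "z' 0 = real_of_int a" "z' (Suc K) = real_of_int b" by (simp_all add: z'_def K)
  ultimately obtain \<sigma> where
    "sign_changes (gd (Suc s) f) (L * Suc s) \<sigma> (real_of_int a) (real_of_int b)"
    unfolding K by metis
  from sign_changes_persist[OF f this za, of "m - 1 - Suc s"]
  moreover have "Suc s + (m - 1 - Suc s) = m - 1" using s m2 by simp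
  ultimately have "sign_changes (gd (m - 1) f) (L * Suc s) \<sigma> (real_of_int a) (real_of_int b)"
    by (metis order_refl)
  from sign_changes_gd_last[OF f this] have "int (L * Suc s) < b - a" by simp
  then have "real (L * Suc s) < real_of_int b - real_of_int a"
    by (metis of_int_diff of_int_less_iff of_int_of_nat_eq)
  also have "\<dots> \<le> real L * g" using PL j0 add_le[of j0 L] by (simp add: P_def)
  also have "\<dots> \<le> real L * real (Suc s)" using g by (intro mult_left_mono) auto
  finally have "real (L * Suc s) < real L * real (Suc s)" .
  then show False by (simp only: of_nat_mult)
qed

text \<open>Without flat cells, \<open>K\<close> gaps would give \<open>K * (s + 1)\<close>
  alternations, of which \<open>m - 2 - s\<close> are lost on the way to the last derivative, while
  the cells available admit only about \<open>K * g\<close>. The same \<open>K\<close> works for all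
  \<open>j\<close>.\<close>

lemma flat_cell_near:
  assumes f: "spl f" and s: "s \<le> m - 2" and x: "gapped x \<delta> g" and g: "g < real s + 1"
    and z: "\<And>j k. k \<le> s \<Longrightarrow> gd k f (x j) = 0"
  shows "\<exists>K. \<forall>j. \<exists>l. flat_cell f l \<and> x j < real_of_int l + 1 \<and> real_of_int l < x (j + int K)"
proof -
  interpret gapped x \<delta> g by (rule x)
  \<comment> \<open>The surplus \<open>K * (s + 1 - g)\<close> has to exceed the lost alternations
    and the rounding of the ends to integers, together at most \<open>m\<close>.\<close>
  obtain K where K: "real m / (real s + 1 - g) < real K" using reals_Archimedean2 by blast
  then have K': "real m < real K * (real s + 1 - g)" using g by (simp add: field_simps)
  then obtain K' where K0: "K = Suc K'" by (cases K) auto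
  have "\<exists>l. flat_cell f l \<and> x j < real_of_int l + 1 \<and> real_of_int l < x (j + int K)" for j
  proof (rule ccontr)
    assume neg: "\<not> ?thesis"
    define z' where "z' = (\<lambda>i. x (j + int i))"
    have gapnz: "\<exists>t. z' i < t \<and> t < z' (Suc i) \<and> f t \<noteq> 0" if "i \<le> K'" for i
    proof (rule no_flat_gap[OF f])
      show "z' i < z' (Suc i)" by (simp add: z'_def less_iff)
      fix l assume l: "z' i < real_of_int l + 1" "real_of_int l < z' (Suc i)"
      have "x j \<le> z' i" "z' (Suc i) \<le> x (j + int K)" using that K0 by (auto simp: z'_def le_iff)
      with neg l show "\<not> flat_cell f l" by force
    qed
    have z0: "gd k f (z' i) = 0" if "k \<le> s" for i k using z that by (simp add: z'_def)
    have "\<exists>\<sigma>\<in>{1,-1}. sign_changes (gd (Suc s) f) (Suc K' * Suc s) \<sigma> (z' 0) (z' (Suc K'))"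
      by (rule sign_changes_chain[OF f s]) (use z0 gapnz in blast)+
    then obtain \<sigma> where
      \<sigma>: "sign_changes (gd (Suc s) f) (K * Suc s) \<sigma> (z' 0) (z' K)"
      unfolding K0 by blast
    define d where "d = m - 1 - Suc s"
    have "real d \<le> real m" by (simp add: d_def)
    have g0: "0 \<le> g" using gap_le[of 0] gap_ge[of 0] \<delta> by linarith
    have "real m < real K * (real s + 1)"
    proof -
      have "0 \<le> real K * g" using g0 by simp
      with K' show ?thesis unfolding right_diff_distrib by linarith
    qed
    then have "real d < real (K * Suc s)" using \<open>real d \<le> real m\<close> by (simp add: algebra_simps)
    then have dK: "K * Suc s = (K * Suc s - d) + d" by linarith
    have "Suc s + d = m - 1" using s m2 by (simp add: d_def)
    moreover have "sign_changes (gd (Suc s) f) ((K * Suc s - d) + d) \<sigma> (z' 0) (z' K)"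
      unfolding dK[symmetric] by (rule \<sigma>)
    ultimately obtain \<tau> where
      "sign_changes (gd (m - 1) f) (K * Suc s - d) \<tau> (z' 0) (z' K)"
      using sign_changes_lose[OF f, of "Suc s" "K * Suc s - d" d] by (metis order_refl)
    from sign_changes_gd_last[OF f this]
    have "int (K * Suc s) - int d \<le> \<lceil>z' K\<rceil> - \<lfloor>z' 0\<rfloor> - 1" using dK by linarith
    then have "real_of_int (int (K * Suc s) - int d) \<le> real_of_int (\<lceil>z' K\<rceil> - \<lfloor>z' 0\<rfloor> - 1)"
      by (simp only: of_int_le_iff)
    also have "\<dots> \<le> z' K - z' 0 + 1" by simp linarith
    also have "\<dots> \<le> real K * g + 1" using add_le[of j K] by (simp add: z'_def)
    finally have "real K * (real s + 1 - g) \<le> real d + 1" by (simp add: algebra_simps)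
    moreover have "real d + 1 \<le> real m" using m2 by (simp add: d_def)
    ultimately show False using K' by simp
  qed
  then show ?thesis by blast
qed

theorem uniqueness_real:
  fixes c :: "int \<Rightarrow> real"
  assumes s: "s \<le> m - 2" and x: "gapped x \<delta> g" and g: "g < real s + 1"
    and 0: "\<And>j i. i \<le> s \<Longrightarrow> lattice_sum (nth_derivative i \<phi>) c (x j) = 0"
  shows "c l = 0"
proof -
  interpret gapped x \<delta> g by (rule x)
  define f where "f = lattice_sum \<phi> c"
  have f: "spl f" unfolding f_def by (rule spl_lattice_sum)
  have z: "gd k f (x j) = 0" if "k \<le> s" for j k
  proof (rule gd_eq_0[OF f s _ that])
    show "\<forall>i\<le>s. nth_derivative i f (x j) = 0"
      using 0 s by (auto simp: f_def nth_derivative_lattice_sum)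
  qed
  obtain K where K: "\<And>j. \<exists>l. flat_cell f l \<and> x j < real_of_int l + 1 \<and> real_of_int l < x (j + int K)"
    using flat_cell_near[OF f s x g z] by blast
  obtain j1 where j1: "real_of_int l + 1 < x j1" using unbounded_above by blast
  obtain j2 where j2: "x j2 < real_of_int l" using unbounded_below by blast
  obtain l1 where l1: "flat_cell f l1" "x j1 < real_of_int l1 + 1" using K by blast
  \<comment> \<open>Starting \<open>K\<close> samples before \<open>j2\<close> puts the flat cell to
    the left of \<open>x j2\<close>, hence of \<open>l\<close>.\<close>
  obtain l2 where l2: "flat_cell f l2" "real_of_int l2 < x (j2 - int K + int K)" using K by blast
  have "l2 < l" "l < l1" using l1 l2 j1 j2 by auto
  from flat_cell_between[OF f s x g z l2(1) l1(1) this] have "flat_cell f l" .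
  then show ?thesis unfolding f_def by (rule local_linear_independence) (use m2 in auto)
qed

end

section \<open>Compactness\<close>

text \<open>Tychonoff's theorem, in the product topology that function types carry.\<close>

lemma compact_PiE_UNIV:
  fixes S :: "'i \<Rightarrow> 'a::topological_space set"
  assumes "\<And>i. compact (S i)"
  shows "compact (PiE UNIV S)"
proof -
  have "compactin (product_topology (\<lambda>_. euclidean) UNIV) (PiE UNIV S)"
    using assms by (simp add: compactin_PiE)
  then show ?thesis by (simp add: euclidean_product_topology)
qed

lemma gapped_shift:
  assumes "gapped x \<delta> g"
  shows "gapped (\<lambda>j. x (j + i) - a) \<delta> g"
proof -
  interpret gapped x \<delta> g by (rule assms)
  have eq: "j + 1 + i = j + i + 1" for j by simp
  then show ?thesis
    using \<delta> gap_ge[of "j + i" for j] gap_le[of "j + i" for j] by unfold_locales (simp_all add: eq)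
qed

text \<open>The only point of this choice is that \<open>\<Sum>\<^bsub>k\<^esub> 1 / growth k = 1 / 2\<close>, summed over all integers.\<close>

definition growth :: "int \<Rightarrow> real" where
  "growth k = 2 ^ (int_encode k + 2)"

lemma growth_ge: "4 \<le> growth k"
  by (simp add: growth_def)

definition normalized :: "(int \<Rightarrow> complex) set" where
  "normalized = {c. c 0 = 1 \<and> (\<forall>k. cmod (c k) \<le> growth k)}"

lemma compact_normalized: "compact normalized"
proof -
  have "normalized = PiE UNIV (\<lambda>k. if k = 0 then {1} else cball 0 (growth k))"
    using growth_ge[of 0] by (auto simp: normalized_def PiE_iff split: if_splits)
  also have "compact \<dots>" by (rule compact_PiE_UNIV) auto
  finally show ?thesis .
qed

text \<open>Anchoring \<open>x 0\<close> confines every coordinate to a bounded interval. A gapped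
  sequence takes this form once a chosen integer is translated to 0 and a sample just before it gets
  the index 0.\<close>

definition gapped_seqs :: "real \<Rightarrow> real \<Rightarrow> (int \<Rightarrow> real) set" where
  "gapped_seqs \<delta> g = {x. gapped x \<delta> g \<and> - g \<le> x 0 \<and> x 0 \<le> 0}"

lemma gapped_seqs_bound:
  assumes "x \<in> gapped_seqs \<delta> g"
  shows "\<bar>x j\<bar> \<le> (real_of_int \<bar>j\<bar> + 1) * g"
proof -
  interpret gapped x \<delta> g using assms by (simp add: gapped_seqs_def)
  have x0: "- g \<le> x 0" "x 0 \<le> 0" using assms by (auto simp: gapped_seqs_def)
  have g: "0 \<le> g" using gap_le[of 0] gap_ge[of 0] \<delta> by linarith
  show ?thesis
  proof (cases "0 \<le> j")
    case True
    then have "x j \<le> x 0 + real_of_int \<bar>j\<bar> * g" "x 0 \<le> x j"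
      using add_le[of 0 "nat j"] by (auto simp: le_iff)
    moreover have "0 \<le> real_of_int \<bar>j\<bar> * g" using g by simp
    ultimately show ?thesis using x0 unfolding abs_le_iff distrib_right by linarith
  next
    case False
    then have "x 0 \<le> x j + real_of_int \<bar>j\<bar> * g" "x j \<le> x 0"
      using add_le[of j "nat (- j)"] by (auto simp: le_iff)
    moreover have "0 \<le> real_of_int \<bar>j\<bar> * g" using g by simp
    ultimately show ?thesis using x0 unfolding abs_le_iff distrib_right by linarith
  qed
qed

lemma compact_gapped_seqs:
  assumes "0 < \<delta>"
  shows "compact (gapped_seqs \<delta> g)"
proof -
  let ?B = "PiE UNIV (\<lambda>j::int. {- ((real_of_int \<bar>j\<bar> + 1) * g)..(real_of_int \<bar>j\<bar> + 1) * g})"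
  let ?S = "{x::int \<Rightarrow> real. - g \<le> x 0 \<and> x 0 \<le> 0 \<and> (\<forall>j. \<delta> \<le> x (j + 1) - x j \<and> x (j + 1) - x j \<le> g)}"
  have "closed ?S"
    by (intro closed_Collect_conj closed_Collect_all closed_Collect_le continuous_on_const
        continuous_on_product_coordinates continuous_on_diff)
  moreover have "compact ?B" by (rule compact_PiE_UNIV) simp
  ultimately have "compact (?S \<inter> ?B)" by (rule closed_Int_compact)
  moreover have "gapped_seqs \<delta> g = ?S \<inter> ?B"
  proof (intro set_eqI iffI)
    fix x assume x: "x \<in> gapped_seqs \<delta> g"
    have "x \<in> ?B"
    proof (rule PiE_I)
      fix j :: int
      show "x j \<in> {- ((real_of_int \<bar>j\<bar> + 1) * g)..(real_of_int \<bar>j\<bar> + 1) * g}"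
        using gapped_seqs_bound[OF x, of j] by (simp add: abs_le_iff)
    qed simp
    with x show "x \<in> ?S \<inter> ?B" by (auto simp: gapped_seqs_def gapped_def)
  qed (use assms in \<open>auto simp: gapped_seqs_def gapped_def\<close>)
  ultimately show ?thesis by simp
qed

context peb
begin

lemma lattice_sum_Re:
  assumes "supported \<psi>"
  shows "Re (lattice_sum \<psi> c x) = lattice_sum \<psi> (\<lambda>l. Re (c l)) x"
    and "Im (lattice_sum \<psi> c x) = lattice_sum \<psi> (\<lambda>l. Im (c l)) x"
proof -
  obtain N where N: "\<bar>x\<bar> < real N" using reals_Archimedean2 by blast
  then have x: "x \<in> {- real N<..<real N}" by auto
  show "Re (lattice_sum \<psi> c x) = lattice_sum \<psi> (\<lambda>l. Re (c l)) x"
    "Im (lattice_sum \<psi> c x) = lattice_sum \<psi> (\<lambda>l. Im (c l)) x"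
    by (simp_all add: lattice_sum_window[OF assms x])
qed

lemma lattice_sum_divide:
  fixes c :: "int \<Rightarrow> complex"
  assumes "supported \<psi>"
  shows "lattice_sum \<psi> (\<lambda>l. c l / a) x = lattice_sum \<psi> c x / a"
proof -
  obtain N where N: "\<bar>x\<bar> < real N" using reals_Archimedean2 by blast
  then have x: "x \<in> {- real N<..<real N}" by auto
  show ?thesis by (simp add: lattice_sum_window[OF assms x] sum_divide_distrib scaleR_conv_of_real)
qed

lemma uniqueness:
  fixes c :: "int \<Rightarrow> complex"
  assumes s: "s \<le> m - 2" and x: "gapped x \<delta> g" and g: "g < real s + 1"
    and 0: "\<And>j i. i \<le> s \<Longrightarrow> lattice_sum (nth_derivative i \<phi>) c (x j) = 0"
  shows "c l = 0"
proof (rule complex_eqI)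
  have supp: "supported (nth_derivative i \<phi>)" if "i \<le> s" for i
    using that s by (intro supported_nth_derivative) auto
  have "lattice_sum (nth_derivative i \<phi>) (\<lambda>l. Re (c l)) (x j) = 0"
    "lattice_sum (nth_derivative i \<phi>) (\<lambda>l. Im (c l)) (x j) = 0" if "i \<le> s" for i j
    using 0[OF that] lattice_sum_Re[OF supp[OF that], of c "x j"] by auto
  then show "Re (c l) = Re 0" "Im (c l) = Im 0"
    using uniqueness_real[OF s x g, of "\<lambda>l. Re (c l)"] uniqueness_real[OF s x g, of "\<lambda>l. Im (c l)"] by auto
qed

lemma sampling_compact:
  assumes s: "s \<le> m - 2" and \<delta>: "0 < \<delta>" and g: "g < real s + 1"
  shows "\<exists>F \<eta>. finite F \<and> F \<subseteq> {..s} \<times> UNIV \<and> 0 < \<eta> \<and>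
    (\<forall>c\<in>normalized. \<forall>x\<in>gapped_seqs \<delta> g.
      \<eta> \<le> (\<Sum>(i, j)\<in>F. cmod (lattice_sum (nth_derivative i \<phi>) c (x j))))"
proof -
  define K where "K = normalized \<times> gapped_seqs \<delta> g"
  have K: "compact K" unfolding K_def by (intro compact_Times compact_normalized compact_gapped_seqs \<delta>)
  define N where "N = (\<lambda>j::int. nat \<lceil>(real_of_int \<bar>j\<bar> + 1) * g\<rceil> + 1)"
  \<comment> \<open>On \<open>gapped_seqs\<close> the coordinate \<open>x j\<close> is bounded by
    \<open>N j\<close>, so a finite sum replaces the series; it depends continuously on coefficients
    and samples jointly.\<close>
  define H where "H = (\<lambda>(i::nat, j::int) (p :: (int \<Rightarrow> complex) \<times> (int \<Rightarrow> real)).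
    \<Sum>l\<in>{- int (N j) - int m..int (N j)}. nth_derivative i \<phi> (snd p j - real_of_int l) *\<^sub>R fst p l)"
  have contH: "continuous_on UNIV (H q)" if "fst q \<le> s" for q
  proof -
    have c1: "continuous_on UNIV (\<lambda>p :: (int \<Rightarrow> complex) \<times> (int \<Rightarrow> real). fst p l)" for l
      by (rule continuous_on_compose2[OF continuous_on_product_coordinates continuous_on_fst[OF continuous_on_id]]) auto
    have c2: "continuous_on UNIV (\<lambda>p :: (int \<Rightarrow> complex) \<times> (int \<Rightarrow> real). snd p l)" for l
      by (rule continuous_on_compose2[OF continuous_on_product_coordinates continuous_on_snd[OF continuous_on_id]]) auto
    have c3: "continuous_on UNIV (nth_derivative (fst q) \<phi>)"
      using that s by (intro C_class_nth_derivative_continuous[OF phi_C_class]) auto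
    have "continuous_on UNIV (\<lambda>p :: (int \<Rightarrow> complex) \<times> (int \<Rightarrow> real).
        nth_derivative (fst q) \<phi> (snd p (snd q) - real_of_int l))" for l
      by (rule continuous_on_compose2[OF c3]) (auto intro!: continuous_on_diff c2)
    then show ?thesis
      unfolding H_def case_prod_beta by (intro continuous_on_sum continuous_on_scaleR c1)
  qed
  have H: "H (i, j) (c, x) = lattice_sum (nth_derivative i \<phi>) c (x j)"
    if "i \<le> s" "x \<in> gapped_seqs \<delta> g" for i j c x
  proof -
    have "\<bar>x j\<bar> < real (N j)" using gapped_seqs_bound[OF that(2), of j] unfolding N_def by linarith
    then have "x j \<in> {- real (N j)<..<real (N j)}" by auto
    moreover have "supported (nth_derivative i \<phi>)" using that s by (intro supported_nth_derivative) auto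
    ultimately show ?thesis unfolding H_def by (simp add: lattice_sum_window)
  qed
  \<comment> \<open>Uniqueness says that the open sets where one sample is nonzero cover
    \<open>K\<close>; a finite subcover is the finite set of samples sought.\<close>
  have "K \<subseteq> (\<Union>q\<in>{..s} \<times> UNIV. {p. H q p \<noteq> 0})"
  proof
    fix p assume "p \<in> K"
    then obtain c x where p: "p = (c, x)" "c \<in> normalized" "x \<in> gapped_seqs \<delta> g" by (auto simp: K_def)
    have "gapped x \<delta> g" "c 0 \<noteq> 0" using p by (auto simp: gapped_seqs_def normalized_def)
    have "\<exists>i j. i \<le> s \<and> lattice_sum (nth_derivative i \<phi>) c (x j) \<noteq> 0"
    proof (rule ccontr)
      assume neg: "\<not> ?thesis"
      have "c 0 = 0"
      proof (rule uniqueness[OF s \<open>gapped x \<delta> g\<close> g])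
        fix i j assume "i \<le> s"
        with neg show "lattice_sum (nth_derivative i \<phi>) c (x j) = 0" by blast
      qed
      with \<open>c 0 \<noteq> 0\<close> show False by simp
    qed
    then obtain i j where "i \<le> s" "lattice_sum (nth_derivative i \<phi>) c (x j) \<noteq> 0" by (elim exE conjE)
    with H[OF this(1) p(3)] p(1) show "p \<in> (\<Union>q\<in>{..s} \<times> UNIV. {p. H q p \<noteq> 0})"
      by (intro UN_I[of "(i, j)"]) auto
  qed
  moreover have "open {p. H q p \<noteq> 0}" if "q \<in> {..s} \<times> UNIV" for q
    using that by (intro open_Collect_neq contH continuous_on_const) auto
  ultimately obtain F where F: "F \<subseteq> {..s} \<times> UNIV" "finite F" "K \<subseteq> (\<Union>q\<in>F. {p. H q p \<noteq> 0})"
    using compactE_image[OF K, of "{..s} \<times> UNIV" "\<lambda>q. {p. H q p \<noteq> 0}"] by metis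
  define G where "G = (\<lambda>p. \<Sum>q\<in>F. cmod (H q p))"
  have "continuous_on UNIV G" unfolding G_def
    using F(1) by (intro continuous_on_sum continuous_on_norm contH) auto
  then have contG: "continuous_on K G" by (rule continuous_on_subset) simp
  have posG: "0 < G p" if pK: "p \<in> K" for p
  proof -
    obtain q where "q \<in> F" "H q p \<noteq> 0" using F(3) pK by blast
    then show ?thesis unfolding G_def using F(2) by (intro sum_pos2[of F q]) auto
  qed
  obtain \<eta> where \<eta>: "0 < \<eta>" "\<And>p. p \<in> K \<Longrightarrow> \<eta> \<le> G p"
  proof (cases "K = {}")
    case True
    then show ?thesis using that[of 1] by simp
  next
    case False
    then obtain p where "p \<in> K" "\<And>q. q \<in> K \<Longrightarrow> G p \<le> G q"
      using continuous_attains_inf[OF K False contG] by blast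
    then show ?thesis using that[of "G p"] posG by blast
  qed
  have "\<eta> \<le> (\<Sum>(i, j)\<in>F. cmod (lattice_sum (nth_derivative i \<phi>) c (x j)))"
    if "c \<in> normalized" "x \<in> gapped_seqs \<delta> g" for c x
  proof -
    have "\<eta> \<le> G (c, x)" using that by (intro \<eta>) (auto simp: K_def)
    also have "G (c, x) = (\<Sum>(i, j)\<in>F. cmod (lattice_sum (nth_derivative i \<phi>) c (x j)))"
      unfolding G_def using F(1) H[OF _ that(2), of _ _ c] by (intro sum.cong) auto
    finally show ?thesis .
  qed
  then show ?thesis using F(1,2) \<eta>(1) by (intro exI conjI ballI)
qed

lemma normalizedI:
  assumes "c l \<noteq> 0" "\<And>k. k \<noteq> 0 \<Longrightarrow> cmod (c (l + k)) < cmod (c l) * growth k"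
  shows "(\<lambda>k. c (k + l) / c l) \<in> normalized"
proof -
  have "cmod (c (k + l) / c l) \<le> growth k" for k
    using assms(1) assms(2)[of k] growth_ge[of 0]
    by (cases "k = 0") (auto simp: norm_divide field_simps add.commute)
  then show ?thesis using assms by (simp add: normalized_def)
qed

text \<open>If \<open>c l\<close> dominates in the sense of \<open>growth\<close>, the sequence
  shifted by \<open>l\<close> and divided by \<open>c l\<close> is normalized, and
  \<open>sampling_compact\<close> applies; otherwise the second alternative holds. \<open>F\<close>
  and \<open>\<eta>\<close> depend on \<open>x\<close> only through \<open>\<delta>\<close> and
  \<open>g\<close>.\<close>

lemma sampling_local:
  assumes s: "s \<le> m - 2" and \<delta>: "0 < \<delta>" and g: "g < real s + 1"
  shows "\<exists>F \<eta>. finite F \<and> F \<subseteq> {..s} \<times> UNIV \<and> 0 < \<eta> \<and>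
    (\<forall>(c :: int \<Rightarrow> complex) x l j0. gapped x \<delta> g \<longrightarrow> x j0 \<le> real_of_int l \<longrightarrow> real_of_int l \<le> x (j0 + 1) \<longrightarrow>
      \<eta> * cmod (c l) \<le> (\<Sum>(i, j)\<in>F. cmod (lattice_sum (nth_derivative i \<phi>) c (x (j + j0)))) \<or>
      (\<exists>k. k \<noteq> 0 \<and> cmod (c l) * growth k \<le> cmod (c (l + k))))"
proof -
  obtain F \<eta> where F: "finite F" "F \<subseteq> {..s} \<times> UNIV" "0 < \<eta>"
    "\<And>c x. c \<in> normalized \<Longrightarrow> x \<in> gapped_seqs \<delta> g \<Longrightarrow>
      \<eta> \<le> (\<Sum>(i, j)\<in>F. cmod (lattice_sum (nth_derivative i \<phi>) c (x j)))"
    using sampling_compact[OF assms] by metis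
  have "\<eta> * cmod (c l) \<le> (\<Sum>(i, j)\<in>F. cmod (lattice_sum (nth_derivative i \<phi>) c (x (j + j0))))"
    if x: "gapped x \<delta> g" "x j0 \<le> real_of_int l" "real_of_int l \<le> x (j0 + 1)"
      and k: "\<not> (\<exists>k. k \<noteq> 0 \<and> cmod (c l) * growth k \<le> cmod (c (l + k)))"
    for c :: "int \<Rightarrow> complex" and x l j0
  proof (cases "c l = 0")
    case True
    then show ?thesis by (auto intro!: sum_nonneg)
  next
    case False
    define d where "d = (\<lambda>k. c (k + l) / c l)"
    define y where "y = (\<lambda>j. x (j + j0) - real_of_int l)"
    have "x (j0 + 1) - x j0 \<le> g" using x(1) gapped.gap_le by blast
    then have y: "y \<in> gapped_seqs \<delta> g"
      using gapped_shift[OF x(1)] x by (auto simp: gapped_seqs_def y_def)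
    have d: "d \<in> normalized"
      unfolding d_def using False k by (intro normalizedI) (auto simp: not_le)
    have eq: "lattice_sum (nth_derivative i \<phi>) d (y j) =
        lattice_sum (nth_derivative i \<phi>) c (x (j + j0)) / c l" if "i \<le> s" for i j
    proof -
      have "supported (nth_derivative i \<phi>)" using that s by (intro supported_nth_derivative) auto
      from lattice_sum_divide[OF this, of "\<lambda>k. c (k + l)" "c l" "y j"]
      show ?thesis
        using lattice_sum_shift[of "nth_derivative i \<phi>" c "y j" l] by (simp add: d_def y_def)
    qed
    have "\<eta> \<le> (\<Sum>(i, j)\<in>F. cmod (lattice_sum (nth_derivative i \<phi>) d (y j)))"
      using F(4)[OF d y] .
    also have "\<dots> = (\<Sum>(i, j)\<in>F. cmod (lattice_sum (nth_derivative i \<phi>) c (x (j + j0))) / cmod (c l))"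
      using F(2) eq by (intro sum.cong) (auto simp: norm_divide)
    also have "\<dots> = (\<Sum>(i, j)\<in>F. cmod (lattice_sum (nth_derivative i \<phi>) c (x (j + j0)))) / cmod (c l)"
      by (simp add: sum_divide_distrib case_prod_beta)
    finally show ?thesis using False by (simp add: field_simps)
  qed
  then show ?thesis using F(1-3) by (intro exI[of _ F] exI[of _ \<eta>] conjI allI impI) (assumption | metis)+
qed

end

section \<open>Sums over the integers\<close>

text \<open>Sums over the integers are handled as integrals, which gives access to Tonelli's theorem
  and monotonicity.\<close>

lemma infsum_int_eq_nn_integral:
  fixes f :: "int \<Rightarrow> ennreal"
  shows "(\<Sum>\<^sub>\<infinity>l. f l) = (\<integral>\<^sup>+l. f l \<partial>count_space UNIV)"
proof -
  have "bij int_decode" by (rule bij_int_decode)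
  then have "(\<integral>\<^sup>+l. f l \<partial>count_space UNIV) = (\<integral>\<^sup>+n. f (int_decode n) \<partial>count_space UNIV)"
    by (rule nn_integral_bij_count_space[symmetric])
  also have "\<dots> = (\<Sum>n. f (int_decode n))" by (rule nn_integral_count_space_nat)
  also have "\<dots> = (\<Sum>\<^sub>\<infinity>n. f (int_decode n))"
    by (intro sums_unique[symmetric] has_sum_imp_sums has_sum_infsum nonneg_summable_on_complete) simp
  also have "\<dots> = (\<Sum>\<^sub>\<infinity>l. f l)"
    using \<open>bij int_decode\<close> by (rule infsum_reindex_bij_betw)
  finally show ?thesis ..
qed

lemma nn_integral_count_space_swap:
  fixes f :: "int \<Rightarrow> int \<Rightarrow> ennreal"
  shows "(\<integral>\<^sup>+k. \<integral>\<^sup>+l. f k l \<partial>count_space UNIV \<partial>count_space UNIV) =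
    (\<integral>\<^sup>+l. \<integral>\<^sup>+k. f k l \<partial>count_space UNIV \<partial>count_space UNIV)"
  by (rule nn_integral_count_space_nn_integral) auto

text \<open>Double counting: \<open>a (h l)\<close> is written as a sum over \<open>j\<close> with
  an indicator, and after interchanging the sums each \<open>a j\<close> occurs once per element of
  its fibre.\<close>

lemma nn_integral_count_space_fibers:
  fixes a :: "int \<Rightarrow> ennreal" and h :: "int \<Rightarrow> int"
  assumes "\<And>j. finite {l. h l = j}" "\<And>j. card {l. h l = j} \<le> N"
  shows "(\<integral>\<^sup>+l. a (h l) \<partial>count_space UNIV) \<le> of_nat N * (\<integral>\<^sup>+j. a j \<partial>count_space UNIV)"
proof -
  have "(\<integral>\<^sup>+l. a (h l) \<partial>count_space UNIV) =
      (\<integral>\<^sup>+l. \<integral>\<^sup>+j. a j * indicator {h l} j \<partial>count_space UNIV \<partial>count_space UNIV)"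
  proof (rule nn_integral_cong)
    fix l
    have "(\<integral>\<^sup>+j. a j * indicator {h l} j \<partial>count_space UNIV) = (\<integral>\<^sup>+j. a (h l) * indicator {h l} j \<partial>count_space UNIV)"
      by (rule nn_integral_cong) (auto split: split_indicator)
    also have "\<dots> = a (h l)" by (simp add: nn_integral_cmult)
    finally show "a (h l) = (\<integral>\<^sup>+j. a j * indicator {h l} j \<partial>count_space UNIV)" ..
  qed
  also have "\<dots> = (\<integral>\<^sup>+j. \<integral>\<^sup>+l. a j * indicator {h l} j \<partial>count_space UNIV \<partial>count_space UNIV)"
    by (rule nn_integral_count_space_swap)
  also have "\<dots> \<le> (\<integral>\<^sup>+j. of_nat N * a j \<partial>count_space UNIV)"
  proof (rule nn_integral_mono)
    fix j
    have "(\<integral>\<^sup>+l. a j * indicator {h l} j \<partial>count_space UNIV) = (\<integral>\<^sup>+l. a j * indicator {l. h l = j} l \<partial>count_space UNIV)"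
      by (rule nn_integral_cong) (auto split: split_indicator)
    also have "\<dots> = a j * of_nat (card {l. h l = j})"
      by (simp add: nn_integral_cmult assms(1))
    also have "\<dots> \<le> of_nat N * a j"
      using assms(2)[of j] by (subst mult.commute) (intro mult_right_mono of_nat_mono, auto)
    finally show "(\<integral>\<^sup>+l. a j * indicator {h l} j \<partial>count_space UNIV) \<le> of_nat N * a j" .
  qed
  also have "\<dots> = of_nat N * (\<integral>\<^sup>+j. a j \<partial>count_space UNIV)"
    by (simp add: nn_integral_cmult)
  finally show ?thesis .
qed

lemma nn_integral_count_space_shift:
  fixes a :: "int \<Rightarrow> ennreal"
  shows "(\<integral>\<^sup>+l. a (l + k) \<partial>count_space UNIV) = (\<integral>\<^sup>+l. a l \<partial>count_space UNIV)"
  by (rule nn_integral_bij_count_space) (rule bij_plus_right)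

lemma nn_integral_inverse_growth:
  "(\<integral>\<^sup>+k. ennreal (1 / growth k) \<partial>count_space UNIV) = ennreal (1 / 2)"
proof -
  have "(\<integral>\<^sup>+k. ennreal (1 / growth k) \<partial>count_space UNIV) =
      (\<integral>\<^sup>+n. ennreal (1 / growth (int_decode n)) \<partial>count_space UNIV)"
    by (rule nn_integral_bij_count_space[OF bij_int_decode, symmetric])
  also have "\<dots> = (\<Sum>n. ennreal (1 / growth (int_decode n)))"
    by (rule nn_integral_count_space_nat)
  also have "\<dots> = (\<Sum>n. ennreal ((1 / 4) * (1 / 2) ^ n))"
    by (simp add: growth_def power_one_over)
  also have "\<dots> = ennreal (1 / 2)"
    using sums_mult[OF geometric_sums[of "1 / 2 :: real"], of "1 / 4"]
    by (intro sums_unique[symmetric] iffD2[OF sums_ennreal]) auto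
  finally show ?thesis .
qed

text \<open>Entries for which the growth condition fails are absorbed into half of the left-hand side.\<close>

lemma Schur_growth:
  fixes a :: "int \<Rightarrow> real" and T :: "int \<Rightarrow> ennreal"
  assumes p: "1 \<le> p" and a: "\<And>l. 0 \<le> a l"
    and fin: "(\<integral>\<^sup>+l. ennreal (a l powr p) \<partial>count_space UNIV) < \<infinity>"
    and alt: "\<And>l. ennreal (a l powr p) \<le> T l \<or> (\<exists>k. a l * growth k \<le> a (l + k))"
  shows "(\<integral>\<^sup>+l. ennreal (a l powr p) \<partial>count_space UNIV) \<le> 2 * (\<integral>\<^sup>+l. T l \<partial>count_space UNIV)"
proof -
  let ?S = "\<integral>\<^sup>+l. ennreal (a l powr p) \<partial>count_space UNIV"
  let ?b = "\<lambda>k l. ennreal (1 / growth k) * ennreal (a (l + k) powr p)"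
  have "?S \<le> (\<integral>\<^sup>+l. T l + (\<integral>\<^sup>+k. ?b k l \<partial>count_space UNIV) \<partial>count_space UNIV)"
  proof (rule nn_integral_mono)
    fix l
    consider "ennreal (a l powr p) \<le> T l" | k where "a l * growth k \<le> a (l + k)" using alt by blast
    then show "ennreal (a l powr p) \<le> T l + (\<integral>\<^sup>+k. ?b k l \<partial>count_space UNIV)"
    proof cases
      case 1
      then show ?thesis by (rule order_trans) simp
    next
      case 2
      have g: "1 \<le> growth k" using growth_ge[of k] by simp
      then have "a l \<le> a (l + k) / growth k" using 2 by (simp add: field_simps)
      then have "a l powr p \<le> (a (l + k) / growth k) powr p"
        using a p by (intro powr_mono2) auto
      also have "\<dots> = a (l + k) powr p / growth k powr p" using a g by (simp add: powr_divide)
      also have "\<dots> \<le> a (l + k) powr p / growth k"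
        using powr_mono[OF p, of "growth k"] g by (intro divide_left_mono) auto
      finally have "ennreal (a l powr p) \<le> ?b k l"
        using g by (simp add: ennreal_mult[symmetric] mult.commute ennreal_leI)
      also have "?b k l = (\<integral>\<^sup>+k'. ?b k l * indicator {k} k' \<partial>count_space UNIV)"
        by (simp add: nn_integral_cmult)
      also have "\<dots> \<le> (\<integral>\<^sup>+k. ?b k l \<partial>count_space UNIV)"
        by (rule nn_integral_mono) (auto split: split_indicator)
      finally show ?thesis by (rule order_trans) simp
    qed
  qed
  also have "\<dots> = (\<integral>\<^sup>+l. T l \<partial>count_space UNIV) + (\<integral>\<^sup>+l. \<integral>\<^sup>+k. ?b k l \<partial>count_space UNIV \<partial>count_space UNIV)"
    by (rule nn_integral_add) auto
  also have "(\<integral>\<^sup>+l. \<integral>\<^sup>+k. ?b k l \<partial>count_space UNIV \<partial>count_space UNIV) =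
      (\<integral>\<^sup>+k. \<integral>\<^sup>+l. ?b k l \<partial>count_space UNIV \<partial>count_space UNIV)"
    by (rule nn_integral_count_space_swap)
  also have "\<dots> = (\<integral>\<^sup>+k. ennreal (1 / growth k) * ?S \<partial>count_space UNIV)"
    by (simp add: nn_integral_cmult nn_integral_count_space_shift[of "\<lambda>l. ennreal (a l powr p)"])
  also have "\<dots> = ennreal (1 / 2) * ?S"
    by (simp add: nn_integral_multc nn_integral_inverse_growth)
  finally have *: "?S \<le> (\<integral>\<^sup>+l. T l \<partial>count_space UNIV) + ennreal (1 / 2) * ?S" .
  \<comment> \<open>Subtracting half of the left-hand side is legitimate only because it is
    finite.\<close>
  obtain s where s: "?S = ennreal s" "0 \<le> s" using fin by (cases ?S) auto
  show ?thesis
  proof (cases "\<integral>\<^sup>+l. T l \<partial>count_space UNIV")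
    case (real t)
    note *[unfolded s(1) real(2)]
    also have "ennreal (1 / 2) * ennreal s = ennreal (1 / 2 * s)"
      by (rule ennreal_mult[symmetric]) (use s in auto)
    also have "ennreal t + \<dots> = ennreal (t + 1 / 2 * s)"
      by (rule ennreal_plus[symmetric]) (use s real in auto)
    finally have "ennreal s \<le> ennreal (t + 1 / 2 * s)" .
    then have "s \<le> t + 1 / 2 * s"
      using s real by (subst (asm) ennreal_le_iff) auto
    then have "s \<le> 2 * t" by simp
    then have "ennreal s \<le> ennreal (2 * t)" by (rule ennreal_leI)
    also have "ennreal (2 * t) = 2 * ennreal t"
      using ennreal_mult[of 2 t] real(1) by simp
    finally show ?thesis unfolding s(1) real(2) .
  qed (simp add: ennreal_mult_top)
qed

text \<open>Since \<open>growth k \<ge> 4\<close>, the finite supremum \<open>N\<close> satisfies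
  \<open>N \<le> max t (N / 4)\<close>, which forces \<open>N \<le> t\<close>.\<close>

lemma sup_growth:
  fixes a :: "int \<Rightarrow> real"
  assumes "bdd_above (range a)" "\<And>l. 0 \<le> a l" "0 \<le> t"
    and alt: "\<And>l. a l \<le> t \<or> (\<exists>k. a l * growth k \<le> a (l + k))"
  shows "a l \<le> t"
proof -
  define N where "N = (SUP l. a l)"
  have N: "a l \<le> N" for l unfolding N_def using assms(1) by (intro cSUP_upper) auto
  have "a l \<le> max t (N / 4)" for l
  proof -
    consider "a l \<le> t" | k where "a l * growth k \<le> a (l + k)" using alt by blast
    then show ?thesis
    proof cases
      case 2
      have "a l * 4 \<le> a l * growth k" using growth_ge assms(2) by (intro mult_left_mono)
      also have "\<dots> \<le> N" using 2 N order_trans by blast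
      finally show ?thesis by simp
    qed simp
  qed
  then have "N \<le> max t (N / 4)" unfolding N_def by (intro cSUP_least) auto
  moreover have "0 \<le> N" using N[of 0] assms(2)[of 0] by simp
  ultimately have "N \<le> t" using assms(3) by (auto simp: max_def split: if_splits)
  with N[of l] show ?thesis by simp
qed

text \<open>Comparison with the largest summand; the constant is cruder than that from
  convexity.\<close>

lemma powr_sum_le:
  fixes a :: "'i \<Rightarrow> real"
  assumes "finite A" "\<And>i. i \<in> A \<Longrightarrow> 0 \<le> a i" "1 \<le> p"
  shows "(\<Sum>i\<in>A. a i) powr p \<le> real (card A) powr p * (\<Sum>i\<in>A. a i powr p)"
proof (cases "A = {}")
  case False
  define M where "M = Max (a ` A)"
  have M: "\<And>i. i \<in> A \<Longrightarrow> a i \<le> M" "M \<in> a ` A" using assms False by (auto simp: M_def)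
  then obtain i where i: "i \<in> A" "M = a i" by auto
  have "(\<Sum>i\<in>A. a i) \<le> real (card A) * M"
    using sum_bounded_above[of A a M] M by simp
  then have "(\<Sum>i\<in>A. a i) powr p \<le> (real (card A) * M) powr p"
    using assms by (intro powr_mono2 sum_nonneg) auto
  also have "\<dots> = real (card A) powr p * M powr p" using i assms by (simp add: powr_mult)
  also have "\<dots> \<le> real (card A) powr p * (\<Sum>i\<in>A. a i powr p)"
    unfolding i(2) using member_le_sum[OF i(1), of "\<lambda>i. a i powr p"] assms
    by (intro mult_left_mono) auto
  finally show ?thesis .
qed simp

section \<open>Bounds for coefficients\<close>

context gapped
begin

text \<open>Two samples in one unit cell are less than 1 apart, so by separation their indices
  differ by less than \<open>1 / \<delta>\<close>.\<close>

lemma card_samples_in_cell: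
  "finite {j. \<lfloor>x j\<rfloor> - k = l} \<and> card {j. \<lfloor>x j\<rfloor> - k = l} \<le> 2 * nat \<lceil>1 / \<delta>\<rceil> + 1"
proof (cases "{j. \<lfloor>x j\<rfloor> - k = l} = {}")
  case False
  then obtain i where i: "\<lfloor>x i\<rfloor> - k = l" by auto
  define n where "n = nat \<lceil>1 / \<delta>\<rceil>"
  have "j \<in> {i - int n..i + int n}" if j: "\<lfloor>x j\<rfloor> - k = l" for j
  proof -
    have close: "x i - x j < 1" "x j - x i < 1" using i j by linarith+
    have far: "real_of_int (b - a) < 1 / \<delta>" if "a \<le> b" "x b - x a < 1" for a b
    proof -
      have "x a + real_of_int (b - a) * \<delta> \<le> x b" using add_ge[of a "nat (b - a)"] that(1) by simp
      then have "real_of_int (b - a) * \<delta> < 1" using that(2) by simp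
      then show ?thesis using \<delta> by (simp add: field_simps)
    qed
    have "real_of_int \<bar>i - j\<bar> < 1 / \<delta>"
      using far[of i j] far[of j i] close by (cases "i \<le> j") (auto simp: abs_if)
    then show ?thesis unfolding n_def by (auto simp: abs_if split: if_splits) linarith+
  qed
  then have sub: "{j. \<lfloor>x j\<rfloor> - k = l} \<subseteq> {i - int n..i + int n}" by blast
  have "card {i - int n..i + int n} = 2 * n + 1" by simp
  with card_mono[OF _ sub] finite_subset[OF sub] show ?thesis by (simp add: n_def)
qed simp

text \<open>A fibre consists of integers in one closed gap, whose length is at most
  \<open>g\<close>.\<close>

lemma card_cells_in_gap:
  assumes "\<And>l. x (h l) \<le> real_of_int l \<and> real_of_int l \<le> x (h l + 1)"
  shows "finite {l. i + h l = j} \<and> card {l. i + h l = j} \<le> nat \<lceil>g\<rceil> + 2"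
proof -
  define a b where "a = x (j - i)" and "b = x (j - i + 1)"
  have sub: "{l. i + h l = j} \<subseteq> {\<lceil>a\<rceil>..\<lfloor>b\<rfloor>}"
  proof
    fix l assume "l \<in> {l. i + h l = j}"
    then have "h l = j - i" by auto
    with assms[of l] show "l \<in> {\<lceil>a\<rceil>..\<lfloor>b\<rfloor>}" by (simp add: a_def b_def ceiling_le_iff le_floor_iff)
  qed
  have "b - a \<le> g" unfolding a_def b_def by (rule gap_le)
  then have "\<lfloor>b\<rfloor> - \<lceil>a\<rceil> \<le> \<lceil>g\<rceil>" by linarith
  then have "card {\<lceil>a\<rceil>..\<lfloor>b\<rfloor>} \<le> nat \<lceil>g\<rceil> + 2" by simp
  with card_mono[OF _ sub] finite_subset[OF sub] show ?thesis by simp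
qed

end

context peb
begin

lemma phi_derivatives_bounded: "\<exists>M>0. \<forall>i\<le>m - 2. \<forall>y. \<bar>nth_derivative i \<phi> y\<bar> \<le> M"
proof -
  have "\<exists>M\<ge>0. \<forall>y. \<bar>nth_derivative i \<phi> y\<bar> \<le> M" if "i \<le> m - 2" for i
  proof -
    have "continuous_on {0..real m} (nth_derivative i \<phi>)"
      using C_class_nth_derivative_continuous[OF phi_C_class that] continuous_on_subset by blast
    then have "bounded (nth_derivative i \<phi> ` {0..real m})"
      by (intro compact_imp_bounded compact_continuous_image) auto
    then obtain M where M: "\<forall>y\<in>{0..real m}. \<bar>nth_derivative i \<phi> y\<bar> \<le> M"
      by (auto simp: bounded_iff)
    have "\<bar>nth_derivative i \<phi> y\<bar> \<le> max M 0" for y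
      using M supported_nth_derivative[OF that]
      by (cases "y \<in> {0..real m}") (auto simp: supported_def le_max_iff_disj)
    then show ?thesis by (intro exI[of _ "max M 0"]) auto
  qed
  then obtain M where M: "\<And>i. i \<le> m - 2 \<Longrightarrow> 0 \<le> M i" "\<And>i y. i \<le> m - 2 \<Longrightarrow> \<bar>nth_derivative i \<phi> y\<bar> \<le> M i"
    by metis
  have "\<bar>nth_derivative i \<phi> y\<bar> \<le> 1 + (\<Sum>i\<le>m - 2. M i)" if "i \<le> m - 2" for i y
    using M(2)[OF that, of y] member_le_sum[of i "{..m - 2}" M] M(1) that by force
  moreover have "0 < 1 + (\<Sum>i\<le>m - 2. M i)" using sum_nonneg[of "{..m - 2}" M] M(1) by force
  ultimately show ?thesis by blast
qed

lemma lattice_sum_bound: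
  fixes c :: "int \<Rightarrow> complex"
  assumes "supported \<psi>" "\<And>y. \<bar>\<psi> y\<bar> \<le> M" "x \<in> {real_of_int l..real_of_int l + 1}"
  shows "cmod (lattice_sum \<psi> c x) \<le> M * (\<Sum>k<m. cmod (c (l - int k)))"
proof -
  have "lattice_sum \<psi> c x = (\<Sum>k\<in>{l - int m<..l}. \<psi> (x - real_of_int k) *\<^sub>R c k)"
    by (rule lattice_sum_cell[OF assms(1,3)])
  also have "cmod \<dots> \<le> (\<Sum>k\<in>{l - int m<..l}. M * cmod (c k))"
    by (rule order_trans[OF norm_sum]) (auto intro!: sum_mono mult_right_mono assms(2))
  also have "\<dots> = (\<Sum>k<m. M * cmod (c (l - int k)))"
    by (rule sum.reindex_bij_witness[of _ "\<lambda>k. l - int k" "\<lambda>k. nat (l - k)"]) auto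
  finally show ?thesis by (simp add: sum_distrib_left)
qed

lemma lattice_sum_bound_powr:
  fixes c :: "int \<Rightarrow> complex"
  assumes "supported \<psi>" "\<And>y. \<bar>\<psi> y\<bar> \<le> M" "x \<in> {real_of_int l..real_of_int l + 1}" "1 \<le> p"
  shows "ennreal (cmod (lattice_sum \<psi> c x) powr p) \<le>
    ennreal ((M * real m) powr p) * (\<Sum>k<m. ennreal (cmod (c (l - int k)) powr p))"
proof -
  have M: "0 \<le> M" using assms(2)[of 0] by linarith
  have "cmod (lattice_sum \<psi> c x) powr p \<le> (M * (\<Sum>k<m. cmod (c (l - int k)))) powr p"
    using assms lattice_sum_bound[OF assms(1-3)] by (intro powr_mono2) auto
  also have "\<dots> = M powr p * (\<Sum>k<m. cmod (c (l - int k))) powr p"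
    using M by (simp add: powr_mult sum_nonneg)
  also have "\<dots> \<le> M powr p * (real (card {..<m}) powr p * (\<Sum>k<m. cmod (c (l - int k)) powr p))"
    using assms(4) by (intro mult_left_mono powr_sum_le) auto
  also have "\<dots> = (M * real m) powr p * (\<Sum>k<m. cmod (c (l - int k)) powr p)"
    using M by (simp add: powr_mult)
  finally have "ennreal (cmod (lattice_sum \<psi> c x) powr p) \<le>
      ennreal ((M * real m) powr p * (\<Sum>k<m. cmod (c (l - int k)) powr p))"
    by (rule ennreal_leI)
  also have "\<dots> = ennreal ((M * real m) powr p) * (\<Sum>k<m. ennreal (cmod (c (l - int k)) powr p))"
    by (subst ennreal_mult) (auto intro: sum_nonneg simp: sum_ennreal)
  finally show ?thesis .
qed

section \<open>Local lower bounds for the function by compactness\<close>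

lemma continuous_on_lattice_sum: "continuous_on UNIV (lattice_sum \<phi> (c :: int \<Rightarrow> complex))"
proof -
  have cont: "continuous_on UNIV (lattice_sum \<phi> d)" for d :: "int \<Rightarrow> real"
    using spl_lattice_sum C_class_imp_continuous by (auto simp: spl_def)
  have "continuous_on UNIV (\<lambda>x. complex_of_real (lattice_sum \<phi> (\<lambda>l. Re (c l)) x) +
      \<i> * complex_of_real (lattice_sum \<phi> (\<lambda>l. Im (c l)) x))"
    by (intro continuous_on_add continuous_on_mult continuous_on_of_real cont continuous_on_const)
  moreover have "lattice_sum \<phi> c x = complex_of_real (lattice_sum \<phi> (\<lambda>l. Re (c l)) x) +
      \<i> * complex_of_real (lattice_sum \<phi> (\<lambda>l. Im (c l)) x)" for x
    by (simp add: complex_eq_iff lattice_sum_Re[OF supported_phi])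
  ultimately show ?thesis by (simp cong: continuous_on_cong)
qed

lemma measurable_lattice_sum [measurable]:
  "lattice_sum \<phi> (c :: int \<Rightarrow> complex) \<in> borel_measurable borel"
  by (rule borel_measurable_continuous_onI[OF continuous_on_lattice_sum])

text \<open>The integral is continuous on the compact set \<open>normalized\<close>. It is positive
  there, for otherwise cell 0 would be flat and local linear independence would give
  \<open>Re (c 0) = 0\<close>.\<close>

lemma Riesz_compact:
  assumes p: "1 \<le> p"
  shows "\<exists>\<eta>>0. \<forall>c\<in>normalized.
    ennreal \<eta> \<le> (\<integral>\<^sup>+t. ennreal (cmod (lattice_sum \<phi> c t) powr p) * indicator {0..1} t \<partial>lborel)"
proof -
  \<comment> \<open>The finite sum valid on the unit cell, needed for joint continuity in
    \<open>c\<close> and \<open>t\<close>.\<close>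
  define H where "H = (\<lambda>(c :: int \<Rightarrow> complex) t::real.
    cmod (\<Sum>k\<in>{- int m<..0}. \<phi> (t - real_of_int k) *\<^sub>R c k) powr p)"
  have H: "H c t = cmod (lattice_sum \<phi> c t) powr p" if "t \<in> {0..1}" for c t
    using lattice_sum_cell[OF supported_phi, of t 0 c] that by (simp add: H_def)
  have c1: "continuous_on UNIV (\<lambda>q :: (int \<Rightarrow> complex) \<times> real. fst q l)" for l
    by (rule continuous_on_compose2[OF continuous_on_product_coordinates continuous_on_fst[OF continuous_on_id]]) auto
  have c2: "continuous_on UNIV (\<lambda>q :: (int \<Rightarrow> complex) \<times> real. \<phi> (snd q - a))" for a
    by (rule continuous_on_compose2[OF C_class_imp_continuous[OF phi_C_class]])
      (auto intro!: continuous_on_diff continuous_on_snd continuous_on_id continuous_on_const)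
  have "continuous_on UNIV (\<lambda>q. H (fst q) (snd q))"
    unfolding H_def using p
    by (intro continuous_on_powr' continuous_on_norm continuous_on_sum continuous_on_scaleR c1 c2
        continuous_on_const) auto
  then have "continuous_on (normalized \<times> cbox 0 1) (\<lambda>(c, t). H c t)"
    unfolding case_prod_beta by (rule continuous_on_subset) simp
  then have contI: "continuous_on normalized (\<lambda>c. integral (cbox 0 1) (H c))"
    by (rule integral_continuous_on_param)
  have contH: "continuous_on {0..1} (H c)" for c
  proof -
    have "continuous_on {0..1} (\<lambda>t. cmod (lattice_sum \<phi> c t) powr p)"
      using p continuous_on_subset[OF continuous_on_lattice_sum]
      by (intro continuous_on_powr' continuous_on_norm continuous_on_const) auto
    then show ?thesis by (rule continuous_on_eq) (simp add: H)
  qed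
  have pos: "0 < integral {0..1} (H c)" if c: "c \<in> normalized" for c
  proof -
    have nn: "0 \<le> H c t" for t by (simp add: H_def)
    have "integral {0..1} (H c) \<noteq> 0"
    proof
      assume "integral {0..1} (H c) = 0"
      then have "\<forall>t\<in>{0..1}. H c t = 0"
        using integral_eq_0_iff[OF contH, of c] nn by simp
      then have z: "lattice_sum \<phi> c t = 0" if "t \<in> {0..1}" for t
        using H[OF that, of c] that by simp
      have "flat_cell (lattice_sum \<phi> (\<lambda>l. Re (c l))) 0"
        unfolding flat_cell_def using z by (auto simp flip: lattice_sum_Re[OF supported_phi])
      from local_linear_independence[OF this, of 0] m2 have "Re (c 0) = 0" by simp
      with c show False by (simp add: normalized_def)
    qed
    moreover have "0 \<le> integral {0..1} (H c)"
      by (intro integral_nonneg integrable_continuous_interval contH nn)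
    ultimately show ?thesis by simp
  qed
  have eq: "(\<integral>\<^sup>+t. ennreal (cmod (lattice_sum \<phi> c t) powr p) * indicator {0..1} t \<partial>lborel) =
      ennreal (integral {0..1} (H c))" for c
  proof -
    let ?h = "\<lambda>t. if t \<in> {0..1} then H c t else 0"
    have "(H c has_integral integral {0..1} (H c)) {0..1}"
      by (intro integrable_integral integrable_continuous_interval contH)
    then have "(?h has_integral integral {0..1} (H c)) UNIV"
      by (simp only: has_integral_restrict_UNIV)
    moreover have "?h = (\<lambda>t. cmod (lattice_sum \<phi> c t) powr p * indicator {0..1} t)"
      by (auto simp: H)
    moreover have "(\<lambda>t. cmod (lattice_sum \<phi> c t) powr p * indicator {0..1} t) \<in> borel_measurable borel"
      by measurable
    ultimately have "(\<integral>\<^sup>+t. ennreal (cmod (lattice_sum \<phi> c t) powr p * indicator {0..1} t) \<partial>lborel) =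
        ennreal (integral {0..1} (H c))"
      by (intro nn_integral_has_integral_lborel) auto
    then show ?thesis by (simp add: ennreal_mult' ennreal_indicator mult.commute)
  qed
  show ?thesis
  proof (cases "normalized = {}")
    case True
    then show ?thesis by (intro exI[of _ 1]) auto
  next
    case False
    then obtain d where "d \<in> normalized" "\<And>c. c \<in> normalized \<Longrightarrow> integral (cbox 0 1) (H d) \<le> integral (cbox 0 1) (H c)"
      using continuous_attains_inf[OF compact_normalized False contI] by blast
    then show ?thesis
      using pos by (intro exI[of _ "integral {0..1} (H d)"]) (auto simp: eq intro!: ennreal_leI)
  qed
qed

text \<open>The normalization of \<open>sampling_local\<close> again, with
  \<open>Riesz_compact\<close>; dividing by \<open>c l\<close> contributes the factor
  \<open>cmod (c l) powr p\<close>.\<close>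

lemma Riesz_local:
  assumes p: "1 \<le> p"
  shows "\<exists>\<eta>>0. \<forall>(c :: int \<Rightarrow> complex) l.
    ennreal (\<eta> * cmod (c l) powr p) \<le>
      (\<integral>\<^sup>+t. ennreal (cmod (lattice_sum \<phi> c t) powr p) * indicator {real_of_int l..real_of_int l + 1} t \<partial>lborel) \<or>
    (\<exists>k. k \<noteq> 0 \<and> cmod (c l) * growth k \<le> cmod (c (l + k)))"
proof -
  obtain \<eta> where \<eta>: "0 < \<eta>" "\<And>c. c \<in> normalized \<Longrightarrow>
      ennreal \<eta> \<le> (\<integral>\<^sup>+t. ennreal (cmod (lattice_sum \<phi> c t) powr p) * indicator {0..1} t \<partial>lborel)"
    using Riesz_compact[OF p] by blast
  have "ennreal (\<eta> * cmod (c l) powr p) \<le>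
      (\<integral>\<^sup>+t. ennreal (cmod (lattice_sum \<phi> c t) powr p) * indicator {real_of_int l..real_of_int l + 1} t \<partial>lborel)"
    if k: "\<not> (\<exists>k. k \<noteq> 0 \<and> cmod (c l) * growth k \<le> cmod (c (l + k)))" for c :: "int \<Rightarrow> complex" and l
  proof (cases "c l = 0")
    case True
    then show ?thesis using p by simp
  next
    case False
    let ?L = "real_of_int l" and ?a = "cmod (c l) powr p"
    have d: "(\<lambda>k. c (k + l) / c l) \<in> normalized"
      using False k by (intro normalizedI) (auto simp: not_le)
    have eq: "cmod (lattice_sum \<phi> c (?L + t)) powr p =
        ?a * cmod (lattice_sum \<phi> (\<lambda>k. c (k + l) / c l) t) powr p" for t
    proof -
      have "lattice_sum \<phi> (\<lambda>k. c (k + l) / c l) t = lattice_sum \<phi> c (t + ?L) / c l"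
        unfolding lattice_sum_divide[OF supported_phi] lattice_sum_shift ..
      then show ?thesis using False by (simp add: norm_divide powr_divide add.commute)
    qed
    have "(\<integral>\<^sup>+t. ennreal (cmod (lattice_sum \<phi> c t) powr p) * indicator {?L..?L + 1} t \<partial>lborel) =
        (\<integral>\<^sup>+t. ennreal (cmod (lattice_sum \<phi> c (?L + t)) powr p) * indicator {?L..?L + 1} (?L + t) \<partial>lborel)"
      by (subst nn_integral_real_affine[where c = 1 and t = ?L]) (auto simp: one_ennreal_def[symmetric])
    also have "\<dots> = (\<integral>\<^sup>+t. ennreal ?a * (ennreal (cmod (lattice_sum \<phi> (\<lambda>k. c (k + l) / c l) t) powr p) *
        indicator {0..1} t) \<partial>lborel)"
      by (intro nn_integral_cong) (auto simp: eq ennreal_mult mult.assoc split: split_indicator)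
    also have "\<dots> = ennreal ?a * (\<integral>\<^sup>+t. ennreal (cmod (lattice_sum \<phi> (\<lambda>k. c (k + l) / c l) t) powr p) *
        indicator {0..1} t \<partial>lborel)"
      by (rule nn_integral_cmult) measurable
    also have "\<dots> \<ge> ennreal ?a * ennreal \<eta>" by (intro mult_left_mono \<eta>(2) d) simp
    finally show ?thesis using \<eta>(1) by (simp add: ennreal_mult mult.commute)
  qed
  with \<eta>(1) show ?thesis by blast
qed

section \<open>Norm equivalences for finite exponents\<close>

lemma Lp_le_coefficients:
  assumes p: "1 \<le> p"
  shows "\<exists>C>0. \<forall>c :: int \<Rightarrow> complex.
    (\<integral>\<^sup>+x. ennreal (cmod (lattice_sum \<phi> c x) powr p) \<partial>lborel) \<le>
      ennreal C * (\<integral>\<^sup>+l. ennreal (cmod (c l) powr p) \<partial>count_space UNIV)"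
proof -
  obtain M where M: "0 < M" "\<And>i y. i \<le> m - 2 \<Longrightarrow> \<bar>nth_derivative i \<phi> y\<bar> \<le> M"
    using phi_derivatives_bounded by blast
  define A where "A = (M * real m) powr p"
  have "(\<integral>\<^sup>+x. ennreal (cmod (lattice_sum \<phi> c x) powr p) \<partial>lborel) \<le>
      ennreal (A * real m) * (\<integral>\<^sup>+l. ennreal (cmod (c l) powr p) \<partial>count_space UNIV)"
    for c :: "int \<Rightarrow> complex"
  proof -
    let ?S = "\<integral>\<^sup>+l. ennreal (cmod (c l) powr p) \<partial>count_space UNIV"
    \<comment> \<open>\<open>D l\<close> dominates the integrand on cell \<open>l\<close>. Half-open
      cells partition the line, so exactly one \<open>l\<close> contributes at each point.\<close>
    define D where "D = (\<lambda>l. ennreal A * (\<Sum>k<m. ennreal (cmod (c (l - int k)) powr p)))"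
    have "(\<integral>\<^sup>+x. ennreal (cmod (lattice_sum \<phi> c x) powr p) \<partial>lborel) \<le>
        (\<integral>\<^sup>+x. \<integral>\<^sup>+l. D l * indicator {real_of_int l..<real_of_int l + 1} x \<partial>count_space UNIV \<partial>lborel)"
    proof (rule nn_integral_mono)
      fix x :: real
      have "ennreal (cmod (lattice_sum \<phi> c x) powr p) \<le> D \<lfloor>x\<rfloor>"
        unfolding D_def A_def using M(2)[of 0] p
        by (intro lattice_sum_bound_powr[OF supported_phi]) (auto intro: less_imp_le)
      also have "D \<lfloor>x\<rfloor> = (\<integral>\<^sup>+l. D \<lfloor>x\<rfloor> * indicator {\<lfloor>x\<rfloor>} l \<partial>count_space UNIV)"
        by (simp add: nn_integral_cmult)
      also have "\<dots> = (\<integral>\<^sup>+l. D l * indicator {real_of_int l..<real_of_int l + 1} x \<partial>count_space UNIV)"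
      proof (rule nn_integral_cong)
        fix l :: int
        have "real_of_int l \<le> x \<and> x < real_of_int l + 1 \<longleftrightarrow> l = \<lfloor>x\<rfloor>" by linarith
        then show "D \<lfloor>x\<rfloor> * indicator {\<lfloor>x\<rfloor>} l = D l * indicator {real_of_int l..<real_of_int l + 1} x"
          by (auto simp: indicator_def)
      qed
      finally show "ennreal (cmod (lattice_sum \<phi> c x) powr p) \<le>
        (\<integral>\<^sup>+l. D l * indicator {real_of_int l..<real_of_int l + 1} x \<partial>count_space UNIV)" .
    qed
    also have "\<dots> = (\<integral>\<^sup>+l. \<integral>\<^sup>+x. D l * indicator {real_of_int l..<real_of_int l + 1} x \<partial>lborel \<partial>count_space UNIV)"
      by (rule nn_integral_count_space_nn_integral) auto
    also have "\<dots> = (\<integral>\<^sup>+l. D l \<partial>count_space UNIV)"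
      by (intro nn_integral_cong) (simp add: nn_integral_cmult)
    also have "\<dots> = ennreal A * (\<Sum>k<m. (\<integral>\<^sup>+l. ennreal (cmod (c (l - int k)) powr p) \<partial>count_space UNIV))"
      unfolding D_def by (simp add: nn_integral_cmult nn_integral_sum del: sum_ennreal)
    also have "\<dots> = ennreal A * (\<Sum>k<m. ?S)"
      using nn_integral_count_space_shift[of "\<lambda>l. ennreal (cmod (c l) powr p)" "- int k" for k] by simp
    also have "\<dots> = ennreal (A * real m) * ?S"
      by (simp add: ennreal_mult' A_def mult.assoc ennreal_of_nat_eq_real_of_nat)
    finally show ?thesis .
  qed
  moreover have "0 < A * real m" using M m2 by (simp add: A_def)
  ultimately show ?thesis by blast
qed

text \<open>A sample depends on at most \<open>m\<close> coefficients, and by separation each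
  coefficient is met by boundedly many samples.\<close>

lemma samples_le_coefficients:
  assumes p: "1 \<le> p" and s: "s \<le> m - 2" and x: "gapped x \<delta> g"
  shows "\<exists>C>0. \<forall>c :: int \<Rightarrow> complex.
    (\<integral>\<^sup>+j. (\<Sum>i\<le>s. ennreal (cmod (lattice_sum (nth_derivative i \<phi>) c (x j)) powr p)) \<partial>count_space UNIV) \<le>
      ennreal C * (\<integral>\<^sup>+l. ennreal (cmod (c l) powr p) \<partial>count_space UNIV)"
proof -
  interpret gapped x \<delta> g by (rule x)
  obtain M where M: "0 < M" "\<And>i y. i \<le> m - 2 \<Longrightarrow> \<bar>nth_derivative i \<phi> y\<bar> \<le> M"
    using phi_derivatives_bounded by blast
  define A where "A = (M * real m) powr p"
  define N where "N = 2 * nat \<lceil>1 / \<delta>\<rceil> + 1"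
  have "(\<integral>\<^sup>+j. (\<Sum>i\<le>s. ennreal (cmod (lattice_sum (nth_derivative i \<phi>) c (x j)) powr p)) \<partial>count_space UNIV) \<le>
      ennreal (real (Suc s) * (A * (real m * real N))) * (\<integral>\<^sup>+l. ennreal (cmod (c l) powr p) \<partial>count_space UNIV)"
    for c :: "int \<Rightarrow> complex"
  proof -
    let ?S = "\<integral>\<^sup>+l. ennreal (cmod (c l) powr p) \<partial>count_space UNIV"
    have "(\<integral>\<^sup>+j. ennreal (cmod (c (\<lfloor>x j\<rfloor> - int k)) powr p) \<partial>count_space UNIV) \<le> of_nat N * ?S" for k
      using card_samples_in_cell[of "int k"] unfolding N_def
      by (intro nn_integral_count_space_fibers[of "\<lambda>j. \<lfloor>x j\<rfloor> - int k" _ "\<lambda>l. ennreal (cmod (c l) powr p)"]) blast+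
    then have le: "(\<Sum>k<m. \<integral>\<^sup>+j. ennreal (cmod (c (\<lfloor>x j\<rfloor> - int k)) powr p) \<partial>count_space UNIV) \<le>
        of_nat m * (of_nat N * ?S)"
      using sum_bounded_above[of "{..<m}" "\<lambda>k. \<integral>\<^sup>+j. ennreal (cmod (c (\<lfloor>x j\<rfloor> - int k)) powr p) \<partial>count_space UNIV"]
      by simp
    have "(\<integral>\<^sup>+j. (\<Sum>i\<le>s. ennreal (cmod (lattice_sum (nth_derivative i \<phi>) c (x j)) powr p)) \<partial>count_space UNIV) \<le>
      (\<integral>\<^sup>+j. (\<Sum>i\<le>s. ennreal A * (\<Sum>k<m. ennreal (cmod (c (\<lfloor>x j\<rfloor> - int k)) powr p))) \<partial>count_space UNIV)"
      unfolding A_def using M(2) s p supported_nth_derivative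
      by (intro nn_integral_mono sum_mono lattice_sum_bound_powr) (auto intro: less_imp_le)
    also have "\<dots> = of_nat (Suc s) * (ennreal A * (\<Sum>k<m. \<integral>\<^sup>+j. ennreal (cmod (c (\<lfloor>x j\<rfloor> - int k)) powr p) \<partial>count_space UNIV))"
      by (simp add: nn_integral_cmult nn_integral_sum del: of_nat_Suc sum_ennreal)
    also have "\<dots> \<le> of_nat (Suc s) * (ennreal A * (of_nat m * (of_nat N * ?S)))"
      by (intro mult_left_mono le) auto
    also have "\<dots> = ennreal (real (Suc s) * (A * (real m * real N))) * ?S"
      by (simp add: ennreal_mult' A_def mult.assoc ennreal_of_nat_eq_real_of_nat del: of_nat_Suc)
    finally show ?thesis .
  qed
  moreover have "0 < real (Suc s) * (A * (real m * real N))" using M m2 by (simp add: A_def N_def)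
  ultimately show ?thesis by blast
qed

text \<open>\<open>Schur_growth\<close> with integrals over closed cells as \<open>T\<close>. In the
  constant \<open>4 / \<eta>\<close> one factor 2 is that of \<open>Schur_growth\<close>, the other
  bounds the overlap of adjacent cells.\<close>

lemma coefficients_le_Lp:
  assumes p: "1 \<le> p"
  shows "\<exists>C>0. \<forall>c :: int \<Rightarrow> complex.
    (\<integral>\<^sup>+l. ennreal (cmod (c l) powr p) \<partial>count_space UNIV) < \<infinity> \<longrightarrow>
    (\<integral>\<^sup>+l. ennreal (cmod (c l) powr p) \<partial>count_space UNIV) \<le>
      ennreal C * (\<integral>\<^sup>+x. ennreal (cmod (lattice_sum \<phi> c x) powr p) \<partial>lborel)"
proof -
  obtain \<eta> where \<eta>: "0 < \<eta>" "\<And>(c :: int \<Rightarrow> complex) l.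
      ennreal (\<eta> * cmod (c l) powr p) \<le>
        (\<integral>\<^sup>+t. ennreal (cmod (lattice_sum \<phi> c t) powr p) * indicator {real_of_int l..real_of_int l + 1} t \<partial>lborel) \<or>
      (\<exists>k. k \<noteq> 0 \<and> cmod (c l) * growth k \<le> cmod (c (l + k)))"
    using Riesz_local[OF p] by metis
  have "(\<integral>\<^sup>+l. ennreal (cmod (c l) powr p) \<partial>count_space UNIV) \<le>
      ennreal (4 / \<eta>) * (\<integral>\<^sup>+x. ennreal (cmod (lattice_sum \<phi> c x) powr p) \<partial>lborel)"
    if fin: "(\<integral>\<^sup>+l. ennreal (cmod (c l) powr p) \<partial>count_space UNIV) < \<infinity>" for c :: "int \<Rightarrow> complex"
  proof -
    let ?I = "\<lambda>l t. indicator {real_of_int l..real_of_int l + 1} t :: ennreal"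
    let ?f = "\<lambda>t. ennreal (cmod (lattice_sum \<phi> c t) powr p)"
    define T where "T = (\<lambda>l. ennreal (1 / \<eta>) * (\<integral>\<^sup>+t. ?f t * ?I l t \<partial>lborel))"
    have "ennreal (cmod (c l) powr p) \<le> T l \<or> (\<exists>k. cmod (c l) * growth k \<le> cmod (c (l + k)))" for l
      using \<eta>(2)[of c l]
    proof
      assume "ennreal (\<eta> * cmod (c l) powr p) \<le> (\<integral>\<^sup>+t. ?f t * ?I l t \<partial>lborel)"
      then have "ennreal (1 / \<eta>) * ennreal (\<eta> * cmod (c l) powr p) \<le> T l"
        unfolding T_def by (rule mult_left_mono) simp
      also have "ennreal (1 / \<eta>) * ennreal (\<eta> * cmod (c l) powr p) = ennreal (cmod (c l) powr p)"
        using \<eta>(1) by (simp add: ennreal_mult[symmetric])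
      finally show ?thesis by blast
    qed blast
    then have "(\<integral>\<^sup>+l. ennreal (cmod (c l) powr p) \<partial>count_space UNIV) \<le> 2 * (\<integral>\<^sup>+l. T l \<partial>count_space UNIV)"
      by (intro Schur_growth[OF p _ fin]) auto
    also have "(\<integral>\<^sup>+l. T l \<partial>count_space UNIV) =
        ennreal (1 / \<eta>) * (\<integral>\<^sup>+l. \<integral>\<^sup>+t. ?f t * ?I l t \<partial>lborel \<partial>count_space UNIV)"
      unfolding T_def by (simp add: nn_integral_cmult)
    also have "(\<integral>\<^sup>+l. \<integral>\<^sup>+t. ?f t * ?I l t \<partial>lborel \<partial>count_space UNIV) =
        (\<integral>\<^sup>+t. \<integral>\<^sup>+l. ?f t * ?I l t \<partial>count_space UNIV \<partial>lborel)"
      by (rule nn_integral_count_space_nn_integral[symmetric]) auto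
    also have "\<dots> \<le> (\<integral>\<^sup>+t. 2 * ?f t \<partial>lborel)"
    proof (rule nn_integral_mono)
      fix t :: real
      have "(\<integral>\<^sup>+l. ?f t * ?I l t \<partial>count_space UNIV) \<le> (\<integral>\<^sup>+l. ?f t * indicator {\<lfloor>t\<rfloor> - 1, \<lfloor>t\<rfloor>} l \<partial>count_space UNIV)"
      proof (rule nn_integral_mono)
        fix l :: int
        have "l = \<lfloor>t\<rfloor> - 1 \<or> l = \<lfloor>t\<rfloor>" if "real_of_int l \<le> t" "t \<le> real_of_int l + 1"
          using that by linarith
        then show "?f t * ?I l t \<le> ?f t * indicator {\<lfloor>t\<rfloor> - 1, \<lfloor>t\<rfloor>} l"
          by (auto split: split_indicator)
      qed
      also have "\<dots> = 2 * ?f t" by (simp add: nn_integral_cmult mult.commute)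
      finally show "(\<integral>\<^sup>+l. ?f t * ?I l t \<partial>count_space UNIV) \<le> 2 * ?f t" .
    qed
    also have "\<dots> = 2 * (\<integral>\<^sup>+t. ?f t \<partial>lborel)" by (simp add: nn_integral_cmult)
    finally have "(\<integral>\<^sup>+l. ennreal (cmod (c l) powr p) \<partial>count_space UNIV) \<le>
        2 * (ennreal (1 / \<eta>) * (2 * (\<integral>\<^sup>+t. ?f t \<partial>lborel)))"
      by (simp add: mult_left_mono)
    also have "\<dots> = ennreal (4 / \<eta>) * (\<integral>\<^sup>+t. ?f t \<partial>lborel)"
    proof -
      have 1: "ennreal (1 / \<eta> * 2) = ennreal (1 / \<eta>) * ennreal 2"
        by (rule ennreal_mult) (use \<eta>(1) in auto)
      have 2: "ennreal (2 * (1 / \<eta> * 2)) = ennreal 2 * ennreal (1 / \<eta> * 2)"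
        by (rule ennreal_mult) (use \<eta>(1) in auto)
      have "2 * (1 / \<eta> * 2) = 4 / \<eta>" by simp
      then have "(2 :: ennreal) * (ennreal (1 / \<eta>) * 2) = ennreal (4 / \<eta>)"
        using 2 unfolding 1 by simp
      then show ?thesis by (simp only: mult.assoc[symmetric])
    qed
    finally show ?thesis .
  qed
  moreover have "0 < 4 / \<eta>" using \<eta>(1) by simp
  ultimately show ?thesis by blast
qed

lemma coefficients_le_samples:
  assumes p: "1 \<le> p" and s: "s \<le> m - 2" and x: "gapped x \<delta> g" and g: "g < real s + 1"
  shows "\<exists>C>0. \<forall>c :: int \<Rightarrow> complex.
    (\<integral>\<^sup>+l. ennreal (cmod (c l) powr p) \<partial>count_space UNIV) < \<infinity> \<longrightarrow>
    (\<integral>\<^sup>+l. ennreal (cmod (c l) powr p) \<partial>count_space UNIV) \<le>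
      ennreal C * (\<integral>\<^sup>+j. (\<Sum>i\<le>s. ennreal (cmod (lattice_sum (nth_derivative i \<phi>) c (x j)) powr p)) \<partial>count_space UNIV)"
proof -
  interpret gapped x \<delta> g by (rule x)
  obtain F \<eta> where F: "finite F" "F \<subseteq> {..s} \<times> UNIV" "0 < \<eta>"
    "\<And>(c :: int \<Rightarrow> complex) x l j0. gapped x \<delta> g \<Longrightarrow> x j0 \<le> real_of_int l \<Longrightarrow> real_of_int l \<le> x (j0 + 1) \<Longrightarrow>
      \<eta> * cmod (c l) \<le> (\<Sum>(i, j)\<in>F. cmod (lattice_sum (nth_derivative i \<phi>) c (x (j + j0)))) \<or>
      (\<exists>k. k \<noteq> 0 \<and> cmod (c l) * growth k \<le> cmod (c (l + k)))"
    using sampling_local[OF s \<delta> g] by metis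
  obtain h where h: "\<And>l::int. x (h l) \<le> real_of_int l \<and> real_of_int l \<le> x (h l + 1)"
  proof -
    have "\<exists>j. x j \<le> real_of_int l \<and> real_of_int l \<le> x (j + 1)" for l
      using bracket[of "real_of_int l"] by force
    then show ?thesis using that by metis
  qed
  define A where "A = (real (card F) / \<eta>) powr p"
  define N where "N = nat \<lceil>g\<rceil> + 2"
  \<comment> \<open>The 2 comes from \<open>Schur_growth\<close>, \<open>card F\<close> counts the
    local samples, and \<open>N\<close> bounds how many lattice points use the same sample; adding 1
    makes \<open>C\<close> positive in every case.\<close>
  define C where "C = 2 * (A * (real (card F) * real N)) + 1"
  have "(\<integral>\<^sup>+l. ennreal (cmod (c l) powr p) \<partial>count_space UNIV) \<le>
      ennreal C * (\<integral>\<^sup>+j. (\<Sum>i\<le>s. ennreal (cmod (lattice_sum (nth_derivative i \<phi>) c (x j)) powr p)) \<partial>count_space UNIV)"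
    if fin: "(\<integral>\<^sup>+l. ennreal (cmod (c l) powr p) \<partial>count_space UNIV) < \<infinity>" for c :: "int \<Rightarrow> complex"
  proof -
    let ?v = "\<lambda>i j. cmod (lattice_sum (nth_derivative i \<phi>) c (x j))"
    let ?V = "\<integral>\<^sup>+j. (\<Sum>i\<le>s. ennreal (?v i j powr p)) \<partial>count_space UNIV"
    define T where "T = (\<lambda>l. ennreal A * (\<Sum>(i, j)\<in>F. ennreal (?v i (j + h l) powr p)))"
    have "ennreal (cmod (c l) powr p) \<le> T l \<or> (\<exists>k. cmod (c l) * growth k \<le> cmod (c (l + k)))" for l
      using F(4)[OF x conjunct1[OF h] conjunct2[OF h], of c l]
    proof
      assume "\<eta> * cmod (c l) \<le> (\<Sum>(i, j)\<in>F. ?v i (j + h l))"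
      then have "cmod (c l) \<le> (\<Sum>(i, j)\<in>F. ?v i (j + h l)) / \<eta>" using F(3) by (simp add: field_simps)
      then have "cmod (c l) powr p \<le> ((\<Sum>(i, j)\<in>F. ?v i (j + h l)) / \<eta>) powr p"
        using p by (intro powr_mono2) auto
      also have "\<dots> = (\<Sum>(i, j)\<in>F. ?v i (j + h l)) powr p / \<eta> powr p"
        by (rule powr_divide)
      also have "\<dots> \<le> real (card F) powr p * (\<Sum>q\<in>F. (case q of (i, j) \<Rightarrow> ?v i (j + h l)) powr p) / \<eta> powr p"
        using F(1) p by (intro divide_right_mono powr_sum_le) auto
      also have "\<dots> = A * (\<Sum>(i, j)\<in>F. ?v i (j + h l) powr p)"
        using F(3) by (simp add: A_def powr_divide case_prod_beta)
      finally have "ennreal (cmod (c l) powr p) \<le> ennreal (A * (\<Sum>(i, j)\<in>F. ?v i (j + h l) powr p))"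
        by (rule ennreal_leI)
      also have "\<dots> = T l"
        unfolding T_def by (subst ennreal_mult) (auto intro!: sum_nonneg simp: A_def case_prod_beta sum_ennreal)
      finally show ?thesis by blast
    qed blast
    then have "(\<integral>\<^sup>+l. ennreal (cmod (c l) powr p) \<partial>count_space UNIV) \<le> 2 * (\<integral>\<^sup>+l. T l \<partial>count_space UNIV)"
      by (intro Schur_growth[OF p _ fin]) auto
    also have "(\<integral>\<^sup>+l. T l \<partial>count_space UNIV) =
        ennreal A * (\<Sum>q\<in>F. \<integral>\<^sup>+l. ennreal (?v (fst q) (snd q + h l) powr p) \<partial>count_space UNIV)"
      unfolding T_def case_prod_beta by (simp add: nn_integral_cmult nn_integral_sum del: sum_ennreal)
    also have "\<dots> \<le> ennreal A * (\<Sum>q\<in>F. of_nat N * ?V)"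
    proof (intro mult_left_mono sum_mono)
      fix q assume "q \<in> F"
      then have q: "fst q \<le> s" using F(2) by auto
      have "(\<integral>\<^sup>+l. ennreal (?v (fst q) (snd q + h l) powr p) \<partial>count_space UNIV) \<le>
          of_nat N * (\<integral>\<^sup>+j. ennreal (?v (fst q) j powr p) \<partial>count_space UNIV)"
        using card_cells_in_gap[OF h, of "snd q"] unfolding N_def
        by (intro nn_integral_count_space_fibers[of "\<lambda>l. snd q + h l" _ "\<lambda>j. ennreal (?v (fst q) j powr p)"]) blast+
      also have "\<dots> \<le> of_nat N * ?V"
        using q by (intro mult_left_mono nn_integral_mono member_le_sum[of "fst q" "{..s}" "\<lambda>i. ennreal (?v i _ powr p)"]) auto
      finally show "(\<integral>\<^sup>+l. ennreal (?v (fst q) (snd q + h l) powr p) \<partial>count_space UNIV) \<le> of_nat N * ?V" .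
    qed simp
    also have "2 * (ennreal A * (\<Sum>q\<in>F. of_nat N * ?V)) = ennreal (2 * (A * (real (card F) * real N))) * ?V"
      by (simp add: ennreal_mult' A_def mult.assoc ennreal_of_nat_eq_real_of_nat)
    also have "\<dots> \<le> ennreal C * ?V"
      unfolding C_def by (intro mult_right_mono ennreal_leI) auto
    finally show ?thesis by (simp add: mult_left_mono)
  qed
  moreover have "0 < C" by (simp add: C_def A_def add_nonneg_pos)
  ultimately show ?thesis by blast
qed

section \<open>Supremum bounds\<close>

lemma values_le_sup_coefficients:
  "\<exists>C>0. \<forall>(c :: int \<Rightarrow> complex) N x. (\<forall>l. cmod (c l) \<le> N) \<longrightarrow>
    (\<forall>i\<le>m - 2. cmod (lattice_sum (nth_derivative i \<phi>) c x) \<le> C * N)"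
proof -
  obtain M where M: "0 < M" "\<And>i y. i \<le> m - 2 \<Longrightarrow> \<bar>nth_derivative i \<phi> y\<bar> \<le> M"
    using phi_derivatives_bounded by blast
  have "cmod (lattice_sum (nth_derivative i \<phi>) c x) \<le> M * real m * N"
    if N: "\<And>l. cmod (c l) \<le> N" and i: "i \<le> m - 2" for c :: "int \<Rightarrow> complex" and N x i
  proof -
    have "cmod (lattice_sum (nth_derivative i \<phi>) c x) \<le> M * (\<Sum>k<m. cmod (c (\<lfloor>x\<rfloor> - int k)))"
      using M(2)[OF i] by (intro lattice_sum_bound[OF supported_nth_derivative[OF i]]) (auto intro: less_imp_le)
    also have "\<dots> \<le> M * (real m * N)"
      using M(1) sum_bounded_above[of "{..<m}" "\<lambda>k. cmod (c (\<lfloor>x\<rfloor> - int k))" N] N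
      by (intro mult_left_mono) auto
    finally show ?thesis by (simp add: mult.assoc)
  qed
  moreover have "0 < M * real m" using M m2 by simp
  ultimately show ?thesis by blast
qed

text \<open>The local bound with exponent 1 suffices: a bound \<open>b\<close> almost everywhere
  bounds the integral over a unit cell by \<open>b\<close>.\<close>

lemma sup_coefficients_le_Linf:
  "\<exists>C>0. \<forall>(c :: int \<Rightarrow> complex) b. bounded (range c) \<longrightarrow> 0 \<le> b \<longrightarrow>
    (AE x in lborel. cmod (lattice_sum \<phi> c x) \<le> b) \<longrightarrow> (\<forall>l. cmod (c l) \<le> C * b)"
proof -
  obtain \<eta> where \<eta>0: "0 < \<eta>" and alt: "\<forall>(c :: int \<Rightarrow> complex) l.
      ennreal (\<eta> * cmod (c l) powr 1) \<le>
        (\<integral>\<^sup>+t. ennreal (cmod (lattice_sum \<phi> c t) powr 1) * indicator {real_of_int l..real_of_int l + 1} t \<partial>lborel) \<or>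
      (\<exists>k. k \<noteq> 0 \<and> cmod (c l) * growth k \<le> cmod (c (l + k)))"
    using Riesz_local[OF order_refl] by (elim exE conjE)
  note \<eta> = \<eta>0 alt[THEN spec, THEN spec]
  have "cmod (c l) \<le> 1 / \<eta> * b"
    if bd: "bounded (range c)" and b: "0 \<le> b" and ae: "AE x in lborel. cmod (lattice_sum \<phi> c x) \<le> b"
    for c :: "int \<Rightarrow> complex" and b l
  proof (rule sup_growth[where a = "\<lambda>l. cmod (c l)"])
    show "bdd_above (range (\<lambda>l. cmod (c l)))"
      using bd by (auto simp: bounded_iff bdd_above_def)
    fix l
    show "cmod (c l) \<le> 1 / \<eta> * b \<or> (\<exists>k. cmod (c l) * growth k \<le> cmod (c (l + k)))"
      using \<eta>(2)[of c l]
    proof (elim disjE)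
      let ?I = "indicator {real_of_int l..real_of_int l + 1} :: real \<Rightarrow> ennreal"
      assume "ennreal (\<eta> * cmod (c l) powr 1) \<le>
        (\<integral>\<^sup>+t. ennreal (cmod (lattice_sum \<phi> c t) powr 1) * ?I t \<partial>lborel)"
      also have "\<dots> \<le> (\<integral>\<^sup>+t. ennreal b * ?I t \<partial>lborel)"
        using ae by (intro nn_integral_mono_AE) (auto elim!: eventually_mono intro!: mult_right_mono ennreal_leI)
      also have "\<dots> = ennreal b" by (simp add: nn_integral_cmult)
      finally have "\<eta> * cmod (c l) \<le> b" using b by simp
      then show ?thesis using \<eta>(1) by (simp add: field_simps)
    qed blast
  qed (use \<eta> b in auto)
  moreover have "0 < 1 / \<eta>" using \<eta>(1) by simp
  ultimately show ?thesis by blast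
qed

lemma sup_coefficients_le_samples:
  assumes s: "s \<le> m - 2" and x: "gapped x \<delta> g" and g: "g < real s + 1"
  shows "\<exists>C>0. \<forall>(c :: int \<Rightarrow> complex) b. bounded (range c) \<longrightarrow> 0 \<le> b \<longrightarrow>
    (\<forall>j. \<forall>i\<le>s. cmod (lattice_sum (nth_derivative i \<phi>) c (x j)) \<le> b) \<longrightarrow> (\<forall>l. cmod (c l) \<le> C * b)"
proof -
  interpret gapped x \<delta> g by (rule x)
  obtain F \<eta> where F: "finite F" "F \<subseteq> {..s} \<times> UNIV" "0 < \<eta>"
    "\<And>(c :: int \<Rightarrow> complex) x l j0. gapped x \<delta> g \<Longrightarrow> x j0 \<le> real_of_int l \<Longrightarrow> real_of_int l \<le> x (j0 + 1) \<Longrightarrow>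
      \<eta> * cmod (c l) \<le> (\<Sum>(i, j)\<in>F. cmod (lattice_sum (nth_derivative i \<phi>) c (x (j + j0)))) \<or>
      (\<exists>k. k \<noteq> 0 \<and> cmod (c l) * growth k \<le> cmod (c (l + k)))"
    using sampling_local[OF s \<delta> g] by metis
  define C where "C = real (card F) / \<eta> + 1"
  have "cmod (c l) \<le> C * b"
    if bd: "bounded (range c)" and b: "0 \<le> b"
      and le: "\<And>i j. i \<le> s \<Longrightarrow> cmod (lattice_sum (nth_derivative i \<phi>) c (x j)) \<le> b"
    for c :: "int \<Rightarrow> complex" and b l
  proof (rule sup_growth[where a = "\<lambda>l. cmod (c l)"])
    show "bdd_above (range (\<lambda>l. cmod (c l)))"
      using bd by (auto simp: bounded_iff bdd_above_def)
    show "0 \<le> C * b" using b F(3) by (simp add: C_def)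
    fix l
    obtain j0 where j0: "x j0 \<le> real_of_int l" "real_of_int l < x (j0 + 1)" using bracket by blast
    from F(4)[OF x j0(1) less_imp_le[OF j0(2)], of c]
    show "cmod (c l) \<le> C * b \<or> (\<exists>k. cmod (c l) * growth k \<le> cmod (c (l + k)))"
    proof
      assume "\<eta> * cmod (c l) \<le> (\<Sum>(i, j)\<in>F. cmod (lattice_sum (nth_derivative i \<phi>) c (x (j + j0))))"
      also have "\<dots> \<le> (\<Sum>q\<in>F. b)"
        unfolding case_prod_beta using F(2) by (intro sum_mono le) auto
      finally have "cmod (c l) \<le> real (card F) / \<eta> * b" using F(3) by (simp add: field_simps)
      also have "\<dots> \<le> C * b" unfolding C_def using b by (intro mult_right_mono) auto
      finally show ?thesis by blast
    qed blast
  qed simp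
  moreover have "0 < C" using F(3) by (simp add: C_def add_nonneg_pos)
  ultimately show ?thesis by blast
qed

section \<open>Assembly of the sampling inequalities\<close>

lemma shift_invariant_space_eq:
  "shift_invariant_space p \<phi> = lattice_sum \<phi> ` ell_p p"
  unfolding shift_invariant_space_def lattice_sum_def[abs_def]
  by (auto simp: scaleR_conv_of_real mult.commute)

lemma sampling_set_finite_p:
  assumes x: "gapped x \<delta> g" and s: "s \<le> m - 2" and g: "g < real s + 1"
    and \<mu>: "\<And>t. t \<in> range x \<Longrightarrow> \<mu> t = s" and p: "1 \<le> p" "p \<noteq> \<infinity>"
  shows "sampling_set_mult p \<phi> (range x) \<mu>"
proof -
  interpret gapped x \<delta> g by (rule x)
  define q where "q = enn2real p"
  have q: "1 \<le> q" using p unfolding q_def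
    by (cases p) (auto simp flip: ennreal_1)
  have inj: "inj x" using less_iff by (intro injI) (metis not_less_iff_gr_or_eq)
  define S where "S = (\<lambda>c :: int \<Rightarrow> complex. \<integral>\<^sup>+l. ennreal (cmod (c l) powr q) \<partial>count_space UNIV)"
  have samp: "sampling_sum p (range x) \<mu> (lattice_sum \<phi> c) =
      (\<integral>\<^sup>+j. (\<Sum>i\<le>s. ennreal (cmod (lattice_sum (nth_derivative i \<phi>) c (x j)) powr q)) \<partial>count_space UNIV)"
    for c :: "int \<Rightarrow> complex"
  proof -
    have "sampling_sum p (range x) \<mu> (lattice_sum \<phi> c) =
        (\<Sum>\<^sub>\<infinity>t\<in>range x. \<Sum>i\<le>s. ennreal (cmod (lattice_sum (nth_derivative i \<phi>) c t) powr q))"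
      unfolding sampling_sum_def q_def using s
      by (intro infsum_cong) (auto simp: \<mu> nth_derivative_lattice_sum atMost_atLeast0 intro!: sum.cong)
    also have "\<dots> = (\<Sum>\<^sub>\<infinity>j. \<Sum>i\<le>s. ennreal (cmod (lattice_sum (nth_derivative i \<phi>) c (x j)) powr q))"
      using infsum_reindex[OF inj] by (simp add: o_def)
    finally show ?thesis by (simp only: infsum_int_eq_nn_integral)
  qed
  have fin: "S c < \<infinity>" if "c \<in> ell_p p" for c
  proof -
    have sm: "(\<lambda>l. cmod (c l) powr q) summable_on UNIV"
      using that p by (simp add: ell_p_def q_def)
    have "S c = (\<Sum>\<^sub>\<infinity>l. ennreal (cmod (c l) powr q))" unfolding S_def by (rule infsum_int_eq_nn_integral[symmetric])
    also have "\<dots> = ennreal (\<Sum>\<^sub>\<infinity>l. cmod (c l) powr q)"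
      using infsum_nonneg_is_SUPREMUM_ennreal[OF sm] by (simp add: nonneg_infsum_complete sum_ennreal)
    finally show ?thesis by simp
  qed
  \<comment> \<open>Both sides of the sampling inequality are compared with the coefficient sum
    \<open>S c\<close>; its finiteness, assumed in \<open>C3\<close> and \<open>C4\<close>, is
    supplied by \<open>ell_p\<close>.\<close>
  obtain C1 where C1: "0 < C1" "\<And>c. Lp_norm_power p (lattice_sum \<phi> c) \<le> ennreal C1 * S c"
    using Lp_le_coefficients[OF q] unfolding Lp_norm_power_def S_def q_def by metis
  obtain C2 where C2: "0 < C2" "\<And>c. sampling_sum p (range x) \<mu> (lattice_sum \<phi> c) \<le> ennreal C2 * S c"
    using samples_le_coefficients[OF q s x] unfolding samp S_def by metis
  obtain C3 where C3: "0 < C3" "\<And>c. S c < \<infinity> \<Longrightarrow> S c \<le> ennreal C3 * Lp_norm_power p (lattice_sum \<phi> c)"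
    using coefficients_le_Lp[OF q] unfolding Lp_norm_power_def S_def q_def by metis
  obtain C4 where C4: "0 < C4" "\<And>c. S c < \<infinity> \<Longrightarrow> S c \<le> ennreal C4 * sampling_sum p (range x) \<mu> (lattice_sum \<phi> c)"
    using coefficients_le_samples[OF q s x g] unfolding samp S_def by metis
  have "ennreal (1 / (C1 * C4)) * Lp_norm_power p f \<le> sampling_sum p (range x) \<mu> f \<and>
      sampling_sum p (range x) \<mu> f \<le> ennreal (C2 * C3) * Lp_norm_power p f"
    if f: "f \<in> shift_invariant_space p \<phi>" for f
  proof -
    obtain c where c: "f = lattice_sum \<phi> c" "c \<in> ell_p p" using f by (auto simp: shift_invariant_space_eq)
    have "Lp_norm_power p f \<le> ennreal C1 * (ennreal C4 * sampling_sum p (range x) \<mu> f)"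
      unfolding c(1) by (rule order_trans[OF C1(2) mult_left_mono[OF C4(2)[OF fin[OF c(2)]]]]) simp
    then have "ennreal (1 / (C1 * C4)) * Lp_norm_power p f \<le>
        ennreal (1 / (C1 * C4)) * (ennreal C1 * (ennreal C4 * sampling_sum p (range x) \<mu> f))"
      by (rule mult_left_mono) simp
    also have "\<dots> = ennreal (1 / (C1 * C4) * (C1 * C4)) * sampling_sum p (range x) \<mu> f"
      using C1(1) C4(1) by (simp only: ennreal_mult' mult.assoc divide_nonneg_pos mult_pos_pos less_imp_le zero_le_one)
    also have "\<dots> = sampling_sum p (range x) \<mu> f" using C1(1) C4(1) by simp
    finally have 1: "ennreal (1 / (C1 * C4)) * Lp_norm_power p f \<le> sampling_sum p (range x) \<mu> f" .
    have "sampling_sum p (range x) \<mu> f \<le> ennreal C2 * (ennreal C3 * Lp_norm_power p f)"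
      unfolding c(1) by (rule order_trans[OF C2(2) mult_left_mono[OF C3(2)[OF fin[OF c(2)]]]]) simp
    also have "\<dots> = ennreal (C2 * C3) * Lp_norm_power p f"
      using C2(1) C3(1) by (simp add: ennreal_mult mult.assoc)
    finally show ?thesis using 1 by blast
  qed
  moreover have "0 < 1 / (C1 * C4)" "0 < C2 * C3" using C1(1) C2(1) C3(1) C4(1) by auto
  ultimately show ?thesis unfolding sampling_set_mult_def using p(2)
    by (intro exI[of _ "1 / (C1 * C4)"] exI[of _ "C2 * C3"]) simp
qed

lemma sampling_set_infinite_p:
  assumes x: "gapped x \<delta> g" and s: "s \<le> m - 2" and g: "g < real s + 1"
    and \<mu>: "\<And>t. t \<in> range x \<Longrightarrow> \<mu> t = s"
  shows "sampling_set_mult \<infinity> \<phi> (range x) \<mu>"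
proof -
  obtain C where C: "0 < C" "\<And>(c :: int \<Rightarrow> complex) N x i. (\<And>l. cmod (c l) \<le> N) \<Longrightarrow> i \<le> m - 2 \<Longrightarrow>
      cmod (lattice_sum (nth_derivative i \<phi>) c x) \<le> C * N"
    using values_le_sup_coefficients by metis
  obtain C1 where C1: "0 < C1" "\<And>(c :: int \<Rightarrow> complex) b l. bounded (range c) \<Longrightarrow> 0 \<le> b \<Longrightarrow>
      (AE x in lborel. cmod (lattice_sum \<phi> c x) \<le> b) \<Longrightarrow> cmod (c l) \<le> C1 * b"
    using sup_coefficients_le_Linf by metis
  obtain C2 where C2: "0 < C2" "\<And>(c :: int \<Rightarrow> complex) b l. bounded (range c) \<Longrightarrow> 0 \<le> b \<Longrightarrow>
      (\<And>j i. i \<le> s \<Longrightarrow> cmod (lattice_sum (nth_derivative i \<phi>) c (x j)) \<le> b) \<Longrightarrow> cmod (c l) \<le> C2 * b"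
    using sup_coefficients_le_samples[OF s x g] by metis
  have "ereal (1 / (C * C2)) * Linf_norm f \<le> sampling_sup (range x) \<mu> f \<and>
      sampling_sup (range x) \<mu> f \<le> ereal (C * C1) * Linf_norm f"
    if f: "f \<in> shift_invariant_space \<infinity> \<phi>" for f
  proof -
    obtain c where c: "f = lattice_sum \<phi> c" "bounded (range c)"
      using f by (auto simp: shift_invariant_space_eq ell_p_def)
    obtain N where N: "\<And>l. cmod (c l) \<le> N" using c(2) by (auto simp: bounded_iff)
    have meas: "(\<lambda>t. ereal (cmod (f t))) \<in> borel_measurable lborel"
      unfolding c(1) by measurable
    have Linf_le: "Linf_norm f \<le> ereal b" if "\<And>t. cmod (f t) \<le> b" for b
      unfolding Linf_norm_def using that by (intro esssup_I[OF meas]) auto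
    have bdd: "cmod (f t) \<le> C * b" if "\<And>l. cmod (c l) \<le> b" for t b
      using C(2)[OF that, of 0] c(1) by simp
    have "Linf_norm f \<le> ereal (C * N)" by (rule Linf_le[OF bdd[OF N]])
    \<comment> \<open>Together with the upper bound this makes the extended real norm a real number
      \<open>b\<close>.\<close>
    moreover have "0 \<le> Linf_norm f"
    proof -
      have "(0::ereal) = esssup lborel (\<lambda>t::real. 0 :: ereal)" by (subst esssup_const) auto
      also have "\<dots> \<le> Linf_norm f" unfolding Linf_norm_def by (intro esssup_mono) auto
      finally show ?thesis .
    qed
    ultimately obtain b where b: "Linf_norm f = ereal b" "0 \<le> b"
      by (cases "Linf_norm f") auto
    have "AE t in lborel. ereal (cmod (f t)) \<le> Linf_norm f"
      unfolding Linf_norm_def by (rule esssup_AE)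
    then have "AE t in lborel. cmod (lattice_sum \<phi> c t) \<le> b" unfolding b(1) by (simp add: c(1))
    from C1(2)[OF c(2) b(2) this] have "\<And>l. cmod (c l) \<le> C1 * b" .
    then have val: "cmod (lattice_sum (nth_derivative i \<phi>) c t) \<le> C * (C1 * b)" if "i \<le> m - 2" for i t
      by (rule C(2)[OF _ that])
    have sup_eq: "sampling_sup (range x) \<mu> f =
        (SUP j. SUP i\<in>{0..s}. ereal (cmod (lattice_sum (nth_derivative i \<phi>) c (x j))))"
      unfolding sampling_sup_def image_image using s
      by (intro SUP_cong refl) (auto simp: \<mu> c(1) nth_derivative_lattice_sum)
    have upper: "sampling_sup (range x) \<mu> f \<le> ereal (C * C1) * Linf_norm f"
      unfolding sup_eq b(1) using s val by (intro SUP_least) (auto simp: mult.assoc)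
    have nonneg: "0 \<le> sampling_sup (range x) \<mu> f"
      unfolding sup_eq by (rule SUP_upper2[of 0 UNIV], simp, rule SUP_upper2[of 0]) auto
    have "sampling_sup (range x) \<mu> f \<noteq> \<infinity>" using upper b by auto
    with nonneg obtain d where d: "sampling_sup (range x) \<mu> f = ereal d" "0 \<le> d"
      by (cases "sampling_sup (range x) \<mu> f") auto
    have "cmod (lattice_sum (nth_derivative i \<phi>) c (x j)) \<le> d" if "i \<le> s" for i j
    proof -
      have "ereal (cmod (lattice_sum (nth_derivative i \<phi>) c (x j))) \<le> ereal d"
        unfolding d(1)[symmetric] sup_eq by (rule SUP_upper2[of j UNIV], simp, rule SUP_upper) (use that in auto)
      then show ?thesis by simp
    qed
    \<comment> \<open>The samples bound the coefficients, and these bound \<open>f\<close> at every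
      point, hence its essential supremum.\<close>
    from C2(2)[OF c(2) d(2) this] have "\<And>l. cmod (c l) \<le> C2 * d" .
    from Linf_le[OF bdd[OF this]] have "b \<le> C * (C2 * d)" by (simp add: b)
    then have "1 / (C * C2) * b \<le> d" using C(1) C2(1) by (simp add: field_simps)
    then show ?thesis using upper by (simp add: d b)
  qed
  moreover have "0 < 1 / (C * C2)" "0 < C * C1" using C(1) C1(1) C2(1) by auto
  ultimately show ?thesis unfolding sampling_set_mult_def
    by (intro exI[of _ "1 / (C * C2)"] exI[of _ "C * C1"]) simp
qed

end

theorem corollary6p4:
  fixes m :: nat
    and \<gamma> :: "nat \<Rightarrow> real"
    and r :: "nat \<Rightarrow> real \<Rightarrow> real"
    and \<phi> :: "real \<Rightarrow> real"
    and X :: "real set"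
    and x :: "int \<Rightarrow> real"
  assumes "2 \<le> m"
    and "PEB_spline m \<gamma> r \<phi>"
    and "uniform_discrete X"
    and "strict_mono x" and "X = range x"
  shows "(\<forall>(\<mu> :: real \<Rightarrow> nat) (s :: nat).
            (\<forall>t\<in>X. \<mu> t = s) \<and> s < m - 1 \<and> max_gap x < ereal (real s + 1) \<longrightarrow>
              (\<forall>p::ennreal. 1 \<le> p \<longrightarrow> sampling_set_mult p \<phi> X \<mu>)) \<and>
         (max_gap x < 1 \<longrightarrow> (\<forall>p::ennreal. 1 \<le> p \<longrightarrow> sampling_set p \<phi> X))"
proof -
  interpret peb m \<gamma> r \<phi> using assms by unfold_locales
  have main: "sampling_set_mult p \<phi> X \<mu>"
    if \<mu>: "\<forall>t\<in>X. \<mu> t = s" and s: "s < m - 1" and gap: "max_gap x < ereal (real s + 1)" and p: "1 \<le> p"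
    for \<mu> s p
  proof -
    obtain \<delta> where \<delta>: "0 < \<delta>" "\<And>a b. a \<in> X \<Longrightarrow> b \<in> X \<Longrightarrow> dist a b < \<delta> \<Longrightarrow> a = b"
      using assms(3) by (auto simp: uniform_discrete_def)
    \<comment> \<open>The strict gap condition leaves room for a real \<open>g\<close> that bounds
      all gaps and still lies below \<open>s + 1\<close>.\<close>
    obtain g where g: "max_gap x < ereal g" "g < real s + 1"
      using ereal_dense2[OF gap] by auto
    have "gapped x \<delta> g"
    proof
      fix j
      have lt: "x j < x (j + 1)" using assms(4) by (simp add: strict_mono_def)
      then have "\<not> dist (x (j + 1)) (x j) < \<delta>" using \<delta>(2)[of "x (j + 1)" "x j"] assms(5) by auto
      then show "\<delta> \<le> x (j + 1) - x j" using lt by (simp add: dist_real_def)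
      have "ereal (x (j + 1) - x j) \<le> max_gap x" unfolding max_gap_def by (rule SUP_upper) simp
      with g(1) have "ereal (x (j + 1) - x j) < ereal g" by (rule order_le_less_trans[rotated])
      then show "x (j + 1) - x j \<le> g" by simp
    qed (rule \<delta>(1))
    then show ?thesis
      using sampling_set_finite_p[of x \<delta> g s \<mu> p] sampling_set_infinite_p[of x \<delta> g s \<mu>] \<mu> s g(2) p assms(5)
      by (cases "p = \<infinity>") auto
  qed
  moreover have "sampling_set p \<phi> X" if "max_gap x < 1" "1 \<le> p" for p
    \<comment> \<open>The case \<open>s = 0\<close> is admissible because \<open>m \<ge> 2\<close>
      gives \<open>0 < m - 1\<close>.\<close>
    unfolding sampling_set_def using that assms(1) by (intro main[where s = 0]) (auto simp: one_ereal_def)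
  ultimately show ?thesis by blast
qed

end
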